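(* For distributionally robust 2-stage facility location with scenario metric $\kappa_{sc}$ being either the discrete metric or the asymmetric metric $\kappa^{asym}_\infty$, in the $k$-bounded setting $\mathcal{A}=\{A\subseteq\mathcal{C}:|A|\le k\}$, there is a polynomial-time $(6,1)$-approximation algorithm for computing $g(x,y,A)$, for any $(x,y,A)\in X\times\mathbb{R}_{\ge0}\times\mathcal{A}$.
   Context: Facility location instance: facilities $\mathcal{F}$, clients $\mathcal{C}$, a metric $d$ on $\mathcal{F}\cup\mathcal{C}$, first- and second-stage opening costs $f_i,f^{II}_i$ for $i\in\mathcal{F}$. $X=\{0,1\}^{\mathcal{F}}$ (facilities opened in stage I). For $x\in[0,1]^{\mathcal{F}}$ and a scenario $A\subseteq\mathcal{C}$, $g(x,A)$ is the optimal value of the fractional second-stage LP $\min\{\sum_i f^{II}_i z_i+\sum_{j\in A}\sum_i d_{ij}w_{ij}: \sum_i w_{ij}\ge1\ \forall j\in A,\ w_{ij}\le x_i+z_i\ \forall i,j\in A,\ z,w\ge0\}$. The discrete metric is $\kappa_{sc}(A,A')=1$ if $A\ne A'$ and $0$ otherwise; $\kappa^{asym}_\infty(A,A')=\max_{j'\in A'}d(j',A)$ with $d(j',A)=\min_{j\in A}d_{j'j}$. $g(x,y,A)=\max_{A'\in\mathcal{A}}(g(x,A')-y\kappa_{sc}(A,A'))$. A $(\beta_1,\beta_2)$-approximation algorithm for $g(x,y,A)$ returns $\bar A\in\mathcal{A}$ with $g(x,\bar A)-y\kappa_{sc}(A,\bar A)\ge g(x,A')/\beta_1-\beta_2y\kappa_{sc}(A,A')$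 for all $A'\in\mathcal{A}$. *)

theory Defs
  imports
    "HOL-Analysis.Analysis"
    "HOL-Library.Log_Nat"
    "HOL-Computational_Algebra.Polynomial"
begin

section \<open>Polynomial time: structured programs for a RAM with logarithmic cost\<close>

text \<open>
  A program works on finitely many named unbounded integer arrays (indirect addressing included) and
  has the arithmetic of the usual RAM. Every operation is charged the bit lengths of its operands,
  of its result and of the addresses it uses, so that, as for every logarithmic-cost RAM, running
  time agrees with multitape Turing machine time up to a polynomial.
\<close>

type_synonym store = "nat \<Rightarrow> nat \<Rightarrow> int"

datatype aexp =
    Const int
  | Get nat aexp \<comment> \<open>array name, index; a negative index is read as \<open>0\<close>\<close>
  | Add aexp aexp
  | Sub aexp aexp
  | Mul aexp aexp
  | Div aexp aexp

datatype com =
    Skip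
  | Put nat aexp aexp \<comment> \<open>array name, index, value\<close>
  | Seq com com
  | IfPos aexp com com
  | WhilePos aexp com

definition bit_length :: "int \<Rightarrow> nat" where
  "bit_length n = Suc (floorlog 2 (nat \<bar>n\<bar>))"

fun aval :: "aexp \<Rightarrow> store \<Rightarrow> int" where
  "aval (Const n) s = n"
| "aval (Get a e) s = s a (nat (aval e s))"
| "aval (Add e1 e2) s = aval e1 s + aval e2 s"
| "aval (Sub e1 e2) s = aval e1 s - aval e2 s"
| "aval (Mul e1 e2) s = aval e1 s * aval e2 s"
| "aval (Div e1 e2) s = aval e1 s div aval e2 s"

fun acost :: "aexp \<Rightarrow> store \<Rightarrow> nat" where
  "acost (Const n) s = bit_length n"
| "acost (Get a e) s = acost e s + bit_length (aval (Get a e) s)"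
| "acost (Add e1 e2) s = acost e1 s + acost e2 s + bit_length (aval (Add e1 e2) s)"
| "acost (Sub e1 e2) s = acost e1 s + acost e2 s + bit_length (aval (Sub e1 e2) s)"
| "acost (Mul e1 e2) s = acost e1 s + acost e2 s + bit_length (aval (Mul e1 e2) s)"
| "acost (Div e1 e2) s = acost e1 s + acost e2 s + bit_length (aval (Div e1 e2) s)"

text \<open>\<open>exec c s t s'\<close>: started in \<open>s\<close>, program \<open>c\<close> halts in \<open>s'\<close> after time \<open>t\<close>.\<close>

inductive exec :: "com \<Rightarrow> store \<Rightarrow> nat \<Rightarrow> store \<Rightarrow> bool" where
  exec_Skip: "exec Skip s 1 s"
| exec_Put: "exec (Put a e1 e2) s (1 + acost e1 s + acost e2 s)
    (s(a := (s a)(nat (aval e1 s) := aval e2 s)))"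
| exec_Seq: "exec c1 s t1 s1 \<Longrightarrow> exec c2 s1 t2 s2 \<Longrightarrow> exec (Seq c1 c2) s (t1 + t2) s2"
| exec_IfPos: "0 < aval e s \<Longrightarrow> exec c1 s t s' \<Longrightarrow> exec (IfPos e c1 c2) s (1 + acost e s + t) s'"
| exec_IfNonpos: "aval e s \<le> 0 \<Longrightarrow> exec c2 s t s' \<Longrightarrow> exec (IfPos e c1 c2) s (1 + acost e s + t) s'"
| exec_WhileNonpos: "aval e s \<le> 0 \<Longrightarrow> exec (WhilePos e c) s (1 + acost e s) s"
| exec_WhilePos: "0 < aval e s \<Longrightarrow> exec c s t1 s1 \<Longrightarrow> exec (WhilePos e c) s1 t2 s2
    \<Longrightarrow> exec (WhilePos e c) s (1 + acost e s + t1 + t2) s2"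

inductive_cases exec_SkipE: "exec Skip s t s'"
inductive_cases exec_PutE: "exec (Put a e1 e2) s t s'"
inductive_cases exec_SeqE: "exec (Seq c1 c2) s t s'"
inductive_cases exec_IfE: "exec (IfPos e c1 c2) s t s'"
inductive_cases exec_WhileE: "exec (WhilePos e c) s t s'"

lemma exec_deterministic:
  "exec c s t s' \<Longrightarrow> exec c s u s'' \<Longrightarrow> u = t \<and> s'' = s'"
proof (induction arbitrary: u s'' rule: exec.induct)
  case exec_Skip
  then show ?case by (auto elim: exec_SkipE)
next
  case exec_Put
  then show ?case by (auto elim: exec_PutE)
next
  case (exec_Seq c1 s t1 s1 c2 t2 s2)
  from exec_Seq.prems obtain v1 r v2
    where "exec c1 s v1 r" "exec c2 r v2 s''" "u = v1 + v2"
    by (rule exec_SeqE)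
  with exec_Seq.IH show ?case by blast
next
  case (exec_IfPos e s c1 t s' c2)
  from exec_IfPos.prems exec_IfPos.hyps obtain v
    where "exec c1 s v s''" "u = 1 + acost e s + v"
    by (auto elim!: exec_IfE)
  with exec_IfPos.IH show ?case by blast
next
  case (exec_IfNonpos e s c2 t s' c1)
  from exec_IfNonpos.prems exec_IfNonpos.hyps obtain v
    where "exec c2 s v s''" "u = 1 + acost e s + v"
    by (auto elim!: exec_IfE)
  with exec_IfNonpos.IH show ?case by blast
next
  case (exec_WhileNonpos e s c)
  from exec_WhileNonpos.prems exec_WhileNonpos.hyps show ?case
    by (auto elim: exec_WhileE)
next
  case (exec_WhilePos e s c t1 s1 t2 s2)
  from exec_WhilePos.prems exec_WhilePos.hyps(1) obtain v1 r v2
    where "exec c s v1 r" "exec (WhilePos e c) r v2 s''" "u = 1 + acost e s + v1 + v2"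
    by (cases rule: exec.cases) auto
  with exec_WhilePos.IH show ?case by blast
qed

text \<open>
  The input word is stored in array \<open>0\<close>, all other cells start as \<open>0\<close>; the output is a set of
  numbers, given by its characteristic sequence in array \<open>1\<close>.
\<close>

definition input_store :: "int list \<Rightarrow> store" where
  "input_store xs = (\<lambda>a i. if a = 0 \<and> i < length xs then xs ! i else 0)"

definition output_set :: "store \<Rightarrow> nat set" where
  "output_set s = {j. s 1 j \<noteq> 0}"

definition input_size :: "int list \<Rightarrow> nat" where
  "input_size xs = (\<Sum>n\<leftarrow>xs. bit_length n)"

definition polytime_solvable :: "'i set \<Rightarrow> ('i \<Rightarrow> int list) \<Rightarrow> ('i \<Rightarrow> nat set \<Rightarrow> bool) \<Rightarrow> bool" where
  "polytime_solvable Inputs enc correct \<longleftrightarrow>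
     (\<exists>(c :: com) (p :: nat poly). \<forall>a\<in>Inputs. \<exists>t s.
        exec c (input_store (enc a)) t s \<and>
        t \<le> poly p (input_size (enc a)) \<and>
        correct a (output_set s))"


section \<open>Two-stage facility location\<close>

text \<open>
  The points of \<open>\<F> \<union> \<C>\<close> are numbered \<open>0, \<dots>, npoints - 1\<close>; a point may be both a facility and a
  client. Numerical data are rational, as they are part of the input of an algorithm.
\<close>

record fl_instance =
  npoints :: nat
  facilities :: "nat set"
  clients :: "nat set"
  fl_dist :: "nat \<Rightarrow> nat \<Rightarrow> rat"
  cost_I :: "nat \<Rightarrow> rat"
  cost_II :: "nat \<Rightarrow> rat"

text \<open>
  \<^const>\<open>Metric_space\<close> also asks for symmetry and nonnegativity outside the carrier. This is no
  restriction, since the values of \<^const>\<open>fl_dist\<close> there are not used. A facility is required to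
  exist because the second-stage program is infeasible otherwise.
\<close>

definition valid_instance :: "fl_instance \<Rightarrow> bool" where
  "valid_instance I \<longleftrightarrow>
     facilities I \<union> clients I = {..<npoints I} \<and>
     facilities I \<noteq> {} \<and>
     Metric_space (facilities I \<union> clients I) (\<lambda>u v. real_of_rat (fl_dist I u v)) \<and>
     (\<forall>i\<in>facilities I. 0 \<le> cost_I I i \<and> 0 \<le> cost_II I i)"

definition stage_I_decisions :: "fl_instance \<Rightarrow> (nat \<Rightarrow> real) set" where
  "stage_I_decisions I = facilities I \<rightarrow> {0, 1}"

definition second_stage_feasible ::
    "fl_instance \<Rightarrow> (nat \<Rightarrow> real) \<Rightarrow> nat set \<Rightarrow> (nat \<Rightarrow> real) \<Rightarrow> (nat \<Rightarrow> nat \<Rightarrow> real) \<Rightarrow> bool" where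
  "second_stage_feasible I x A z w \<longleftrightarrow>
     (\<forall>j\<in>A. (\<Sum>i\<in>facilities I. w i j) \<ge> 1) \<and>
     (\<forall>i\<in>facilities I. \<forall>j\<in>A. w i j \<le> x i + z i) \<and>
     (\<forall>i\<in>facilities I. z i \<ge> 0) \<and>
     (\<forall>i\<in>facilities I. \<forall>j\<in>A. w i j \<ge> 0)"

definition second_stage_cost ::
    "fl_instance \<Rightarrow> nat set \<Rightarrow> (nat \<Rightarrow> real) \<Rightarrow> (nat \<Rightarrow> nat \<Rightarrow> real) \<Rightarrow> real" where
  "second_stage_cost I A z w =
     (\<Sum>i\<in>facilities I. real_of_rat (cost_II I i) * z i) +
     (\<Sum>j\<in>A. \<Sum>i\<in>facilities I. real_of_rat (fl_dist I i j) * w i j)"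

definition second_stage_value :: "fl_instance \<Rightarrow> (nat \<Rightarrow> real) \<Rightarrow> nat set \<Rightarrow> real" where
  "second_stage_value I x A =
     Inf {second_stage_cost I A z w | z w. second_stage_feasible I x A z w}"

definition k_bounded_scenarios :: "fl_instance \<Rightarrow> nat \<Rightarrow> nat set set" where
  "k_bounded_scenarios I k = {A. A \<subseteq> clients I \<and> card A \<le> k}"

definition kappa_discrete :: "fl_instance \<Rightarrow> nat set \<Rightarrow> nat set \<Rightarrow> ennreal" where
  "kappa_discrete I A A' = (if A \<noteq> A' then 1 else 0)"

text \<open>
  The empty scenario is covered by the conventions of \<^typ>\<open>ennreal\<close>: \<open>d(j', {}) = \<infinity>\<close>, and the
  maximum over \<open>A' = {}\<close> is \<open>0\<close>.
\<close>

definition kappa_asym :: "fl_instance \<Rightarrow> nat set \<Rightarrow> nat set \<Rightarrow> ennreal" where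
  "kappa_asym I A A' = (SUP j'\<in>A'. INF j\<in>A. ennreal (real_of_rat (fl_dist I j' j)))"

text \<open>
  \<open>approx_scenario \<kappa> \<beta>\<^sub>1 \<beta>\<^sub>2 I k x y A B\<close>: the scenario \<open>B\<close> is an admissible answer of a
  \<open>(\<beta>\<^sub>1, \<beta>\<^sub>2)\<close>-approximation algorithm for \<open>g(x, y, A)\<close>. For \<open>y = 0\<close> the penalty vanishes even if
  the distance is infinite, as \<open>0 * \<infinity> = 0\<close> in \<^typ>\<open>ereal\<close>.
\<close>

definition approx_scenario ::
    "(fl_instance \<Rightarrow> nat set \<Rightarrow> nat set \<Rightarrow> ennreal) \<Rightarrow> real \<Rightarrow> real \<Rightarrow>
     fl_instance \<Rightarrow> nat \<Rightarrow> (nat \<Rightarrow> real) \<Rightarrow> real \<Rightarrow> nat set \<Rightarrow> nat set \<Rightarrow> bool" where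
  "approx_scenario \<kappa> \<beta>\<^sub>1 \<beta>\<^sub>2 I k x y A B \<longleftrightarrow>
     B \<in> k_bounded_scenarios I k \<and>
     (\<forall>A'\<in>k_bounded_scenarios I k.
        ereal (second_stage_value I x B) - ereal y * enn2ereal (\<kappa> I A B)
        \<ge> ereal (second_stage_value I x A' / \<beta>\<^sub>1) - ereal (\<beta>\<^sub>2 * y) * enn2ereal (\<kappa> I A A'))"

type_synonym fl_query = "fl_instance \<times> nat \<times> (nat \<Rightarrow> real) \<times> rat \<times> nat set"

definition fl_queries :: "fl_query set" where
  "fl_queries = {(I, k, x, y, A). valid_instance I \<and> x \<in> stage_I_decisions I \<and>
     0 \<le> y \<and> A \<in> k_bounded_scenarios I k}"

definition encode_rat :: "rat \<Rightarrow> int list" where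
  "encode_rat r = [fst (quotient_of r), snd (quotient_of r)]"

definition encode_query :: "fl_query \<Rightarrow> int list" where
  "encode_query = (\<lambda>(I, k, x, y, A).
     [int (npoints I), int k] @ encode_rat y @
     concat (map (\<lambda>v.
       [of_bool (v \<in> facilities I), of_bool (v \<in> clients I),
        of_bool (v \<in> facilities I \<and> x v = 1), of_bool (v \<in> A)] @
       encode_rat (if v \<in> facilities I then cost_I I v else 0) @
       encode_rat (if v \<in> facilities I then cost_II I v else 0)) [0..<npoints I]) @
     concat (map (\<lambda>u. concat (map (\<lambda>v. encode_rat (fl_dist I u v)) [0..<npoints I]))
       [0..<npoints I]))"

definition has_polytime_approximation ::
    "(fl_instance \<Rightarrow> nat set \<Rightarrow> nat set \<Rightarrow> ennreal) \<Rightarrow> real \<Rightarrow> real \<Rightarrow> bool" where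
  "has_polytime_approximation \<kappa> \<beta>\<^sub>1 \<beta>\<^sub>2 \<longleftrightarrow>
     polytime_solvable fl_queries encode_query
       (\<lambda>(I, k, x, y, A) B. approx_scenario \<kappa> \<beta>\<^sub>1 \<beta>\<^sub>2 I k x (real_of_rat y) A B)"

end

theory Submission
  imports Defs
begin

text \<open>
  Give facility \<open>i\<close> cost \<open>0\<close> if it is already open. For a set \<open>S\<close> of clients let \<open>t\<^sub>i(S)\<close> be the time at
  which \<open>\<Sum>j\<in>S. max 0 (t - d i j)\<close> reaches the cost of \<open>i\<close>, and let the share of \<open>j\<close> be
  \<open>\<alpha>\<^sub>j(S) = min\<^sub>i max t\<^sub>i(S) (d i j)\<close> (Pal and Tardos). The shares are dual feasible, they pay for a third
  of an integral solution, and they decrease when \<open>S\<close> grows, so their sum \<open>h(S)\<close> satisfies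
  \<open>h(S) \<le> g(S) \<le> 3 h(S)\<close>.

  Starting from \<open>B = {}\<close>, repeatedly add a client \<open>j\<close> for which \<open>\<alpha>\<^sub>j(B \<union> {j})\<close> is largest, and let \<open>a\<close> be the
  share of the last client added. The shares of the added clients decrease, which makes the uniform
  dual solution \<open>a\<close> on \<open>B\<close> feasible; hence \<open>h(B) + \<bar>B\<bar> a \<le> 2 g(B)\<close>. On the other hand,
  \<open>g(A') \<le> 3 h(B \<union> A') \<le> 3 (h(B) + \<bar>B\<bar> a)\<close> for every admissible \<open>A'\<close>. So \<open>(h(B) + \<bar>B\<bar> a) / 2\<close> is at most
  \<open>g(B)\<close> and at least \<open>g(A') / 6\<close>.

  Both scenario metrics are handled by giving every client a level (\<open>0\<close> or \<open>1\<close>, respectively its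
  distance to \<open>A\<close>): the penalty of a scenario is governed by its largest level \<open>R\<close>, so it suffices to
  run the greedy algorithm on the clients of level at most \<open>R\<close> for each \<open>R\<close> that occurs. After scaling by
  \<open>n!\<close> times all denominators every number that occurs is an integer.
\<close>

section \<open>Loop programs run in polynomial time\<close>

text \<open>The optimum of the second-stage program is never computed, which would require a
  polynomial-time LP solver on the machine. Dual solutions have closed formulas instead, so the
  greedy sets of different levels are compared by a certified lower bound, half the estimate minus
  the penalty of the level. The constant 6 is 3 * 2: the 3 is lost in rounding, the 2 in averaging
  two dual solutions on \<open>B\<close>, the shares and the constant \<open>a\<close>. The second
  constant is 1 because nothing approximate happens to the penalty: every possible largest level is
  tried, and within one level the greedy choice ignores the distance to \<open>A\<close>. The other
  obstacle is logarithmic cost. Programs are restricted to n-fold loops and to multiplication by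
  input entries, so that polynomial time follows from the syntax. The n! in the scaling is there
  because opening times are quotients by cardinalities of client sets; it has only O(n log n)
  bits.\<close>

definition upd :: "store \<Rightarrow> nat \<Rightarrow> nat \<Rightarrow> int \<Rightarrow> store" where
  "upd s a i x = s(a := (s a)(i := x))"

lemma upd_apply: "upd s a i x b j = (if b = a \<and> j = i then x else s b j)"
  by (simp add: upd_def)

lemma upd_same [simp]: "upd s a i x a = (s a)(i := x)"
  by (simp add: upd_def)

lemma upd_other [simp]: "b \<noteq> a \<Longrightarrow> upd s a i x b = s b"
  by (simp add: upd_def)

text \<open>Every loop makes as many rounds as the first input entry says, which for an encoded
  query is the number of points. Nesting therefore costs only a polynomial factor, and termination
  needs no argument.\<close>

datatype lprog =
    LPut nat aexp aexp
  | LSeq lprog lprog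
  | LIf aexp lprog lprog
  | LFor nat lprog

fun run :: "lprog \<Rightarrow> store \<Rightarrow> store" where
  "run (LPut a e1 e2) s = upd s a (nat (aval e1 s)) (aval e2 s)"
| "run (LSeq p q) s = run q (run p s)"
| "run (LIf e p q) s = (if 0 < aval e s then run p s else run q s)"
| "run (LFor a p) s =
     ((\<lambda>s. upd (run p s) a 0 (run p s a 0 + 1)) ^^ nat (s 0 0)) (upd s a 0 0)"

abbreviation cell :: "nat \<Rightarrow> aexp" where
  "cell a \<equiv> Get a (Const 0)"

fun compile :: "lprog \<Rightarrow> com" where
  "compile (LPut a e1 e2) = Put a e1 e2"
| "compile (LSeq p q) = Seq (compile p) (compile q)"
| "compile (LIf e p q) = IfPos e (compile p) (compile q)"
| "compile (LFor a p) = Seq (Put a (Const 0) (Const 0))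
     (WhilePos (Sub (cell 0) (cell a))
       (Seq (compile p) (Put a (Const 0) (Add (cell a) (Const 1)))))"

fun writes :: "lprog \<Rightarrow> nat set" where
  "writes (LPut a e1 e2) = {a}"
| "writes (LSeq p q) = writes p \<union> writes q"
| "writes (LIf e p q) = writes p \<union> writes q"
| "writes (LFor a p) = insert a (writes p)"

text \<open>Multiplying only by input entries keeps the growth of bit lengths additive.\<close>

fun tame :: "aexp \<Rightarrow> bool" where
  "tame (Const n) \<longleftrightarrow> True"
| "tame (Get a e) \<longleftrightarrow> tame e"
| "tame (Add e1 e2) \<longleftrightarrow> tame e1 \<and> tame e2"
| "tame (Sub e1 e2) \<longleftrightarrow> tame e1 \<and> tame e2"
| "tame (Mul e1 e2) \<longleftrightarrow> tame e1 \<and> tame e2 \<and> (\<exists>e. e1 = Get 0 e)"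
| "tame (Div e1 e2) \<longleftrightarrow> tame e1 \<and> tame e2"

fun wf_lprog :: "lprog \<Rightarrow> bool" where
  "wf_lprog (LPut a e1 e2) \<longleftrightarrow> a \<noteq> 0 \<and> tame e1 \<and> tame e2"
| "wf_lprog (LSeq p q) \<longleftrightarrow> wf_lprog p \<and> wf_lprog q"
| "wf_lprog (LIf e p q) \<longleftrightarrow> tame e \<and> wf_lprog p \<and> wf_lprog q"
| "wf_lprog (LFor a p) \<longleftrightarrow> a \<noteq> 0 \<and> wf_lprog p \<and> a \<notin> writes p"

text \<open>Growth in units of N + 1 bits, where N bounds the bits of input entries: a sum or
  difference gains one bit, a product with an input entry at most N, a quotient none, and a constant
  pays for its own length.\<close>

fun weight :: "aexp \<Rightarrow> nat" where
  "weight (Const n) = Suc (bit_length n)"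
| "weight (Get a e) = Suc (weight e)"
| "weight (Add e1 e2) = Suc (weight e1 + weight e2)"
| "weight (Sub e1 e2) = Suc (weight e1 + weight e2)"
| "weight (Mul e1 e2) = Suc (weight e1 + weight e2)"
| "weight (Div e1 e2) = Suc (weight e1 + weight e2)"

section \<open>Bit lengths and costs of expressions\<close>

definition bounded_store :: "nat \<Rightarrow> store \<Rightarrow> bool" where
  "bounded_store X s \<longleftrightarrow> (\<forall>a i. \<bar>s a i\<bar> \<le> 2 ^ X)"

definition bounded_input :: "nat \<Rightarrow> store \<Rightarrow> bool" where
  "bounded_input N s \<longleftrightarrow> (\<forall>i. \<bar>s 0 i\<bar> \<le> 2 ^ N)"

lemma bounded_store_mono: "bounded_store X s \<Longrightarrow> X \<le> Y \<Longrightarrow> bounded_store Y s"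
  unfolding bounded_store_def by (meson order_trans one_le_numeral power_increasing)

lemma abs_le_bit_length: "\<bar>n\<bar> \<le> 2 ^ bit_length n"
proof -
  have "nat \<bar>n\<bar> < 2 ^ floorlog 2 (nat \<bar>n\<bar>)"
  proof (cases "n = 0")
    case False
    then show ?thesis using floorlog_bounds[of "nat \<bar>n\<bar>" 2] by simp
  qed (simp add: floorlog_def)
  then have "\<bar>n\<bar> < 2 ^ floorlog 2 (nat \<bar>n\<bar>)"
    by (simp add: zless_nat_eq_int_zless nat_less_iff)
  then show ?thesis by (simp add: bit_length_def)
qed

lemma bit_length_le:
  assumes "\<bar>n\<bar> \<le> 2 ^ m"
  shows "bit_length n \<le> m + 2"
proof -
  have "nat \<bar>n\<bar> \<le> 2 ^ m" using assms by (simp add: nat_le_iff)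
  also have "\<dots> < (2::nat) ^ Suc m" by simp
  finally have "floorlog 2 (nat \<bar>n\<bar>) \<le> Suc m" by (intro floorlog_leI) auto
  then show ?thesis by (simp add: bit_length_def)
qed

text \<open>Rounding goes down, so a negative quotient moves away from 0, but for a positive divisor
  it never falls below the numerator. A negative divisor is treated by changing both signs, and
  division by 0 gives 0.\<close>

lemma abs_div_le: "\<bar>x div y\<bar> \<le> \<bar>x :: int\<bar>"
proof (cases "y = 0")
  case False
  have *: "\<bar>a div b\<bar> \<le> \<bar>a\<bar>" if "b > 0" for a b :: int
  proof (cases "a \<ge> 0")
    case True
    then show ?thesis using that
      using zdiv_mono2[of a 1 b] by (simp add: pos_imp_zdiv_nonneg_iff)
  next
    case neg: False
    have "a div b < 0" using neg that by (simp add: neg_imp_zdiv_neg_iff div_neg_pos_less0)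
    moreover have "a \<le> a div b"
    proof -
      have "a div 1 \<le> a div b" using neg that by (intro zdiv_mono2_neg) auto
      then show ?thesis by simp
    qed
    ultimately show ?thesis by simp
  qed
  show ?thesis
  proof (cases "y > 0")
    case True then show ?thesis by (rule *)
  next
    case neg: False
    then have "\<bar>(- x) div (- y)\<bar> \<le> \<bar>- x\<bar>" using False by (intro *) auto
    then show ?thesis by simp
  qed
qed simp

lemma abs_aval_le:
  assumes "bounded_store X s" "bounded_input N s" "tame e"
  shows "\<bar>aval e s\<bar> \<le> 2 ^ (X + weight e * (N + 1))"
  using assms(3)
proof (induction e)
  case (Const n)
  have "\<bar>n\<bar> \<le> 2 ^ bit_length n" by (rule abs_le_bit_length)
  also have "\<dots> \<le> 2 ^ (X + weight (Const n) * (N + 1))"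
    by (rule power_increasing) auto
  finally show ?case by simp
next
  case (Get a e)
  have "\<bar>aval (Get a e) s\<bar> \<le> 2 ^ X" using assms(1) by (simp add: bounded_store_def)
  also have "\<dots> \<le> 2 ^ (X + weight (Get a e) * (N + 1))" by (rule power_increasing) auto
  finally show ?case .
next
  case (Add e1 e2)
  let ?m = "X + (weight e1 + weight e2) * (N + 1)"
  have m: "(2::int) ^ (X + weight e1 * (N + 1)) \<le> 2 ^ ?m" "(2::int) ^ (X + weight e2 * (N + 1)) \<le> 2 ^ ?m"
    by (rule power_increasing; simp add: add_mult_distrib)+
  have "tame e1" "tame e2" using Add.prems by simp_all
  then have "\<bar>aval e1 s\<bar> \<le> 2 ^ ?m" "\<bar>aval e2 s\<bar> \<le> 2 ^ ?m"
    using order_trans[OF Add.IH(1) m(1)] order_trans[OF Add.IH(2) m(2)] by blast+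
  then have "\<bar>aval (Add e1 e2) s\<bar> \<le> 2 ^ Suc ?m" by simp
  also have "\<dots> \<le> 2 ^ (X + weight (Add e1 e2) * (N + 1))" by (rule power_increasing) auto
  finally show ?case .
next
  case (Sub e1 e2)
  let ?m = "X + (weight e1 + weight e2) * (N + 1)"
  have m: "(2::int) ^ (X + weight e1 * (N + 1)) \<le> 2 ^ ?m" "(2::int) ^ (X + weight e2 * (N + 1)) \<le> 2 ^ ?m"
    by (rule power_increasing; simp add: add_mult_distrib)+
  have "tame e1" "tame e2" using Sub.prems by simp_all
  then have "\<bar>aval e1 s\<bar> \<le> 2 ^ ?m" "\<bar>aval e2 s\<bar> \<le> 2 ^ ?m"
    using order_trans[OF Sub.IH(1) m(1)] order_trans[OF Sub.IH(2) m(2)] by blast+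
  then have "\<bar>aval (Sub e1 e2) s\<bar> \<le> 2 ^ Suc ?m" by simp
  also have "\<dots> \<le> 2 ^ (X + weight (Sub e1 e2) * (N + 1))" by (rule power_increasing) auto
  finally show ?case .
next
  case (Mul e1 e2)
  then obtain e where e: "e1 = Get 0 e" by auto
  have "\<bar>aval (Mul e1 e2) s\<bar> \<le> 2 ^ N * 2 ^ (X + weight e2 * (N + 1))"
    using Mul assms(2) unfolding e by (auto simp: abs_mult bounded_input_def intro!: mult_mono)
  also have "\<dots> = 2 ^ (N + (X + weight e2 * (N + 1)))" by (simp add: power_add)
  also have "\<dots> \<le> 2 ^ (X + weight (Mul e1 e2) * (N + 1))"
    by (rule power_increasing) (auto simp: algebra_simps)
  finally show ?case .
next
  case (Div e1 e2)
  have "\<bar>aval (Div e1 e2) s\<bar> \<le> \<bar>aval e1 s\<bar>" by (simp add: abs_div_le)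
  also have "\<dots> \<le> 2 ^ (X + weight e1 * (N + 1))" using Div by simp
  also have "\<dots> \<le> 2 ^ (X + weight (Div e1 e2) * (N + 1))"
    by (rule power_increasing) (auto simp: algebra_simps)
  finally show ?case .
qed

text \<open>The separate bound \<open>w\<close> is for the induction: every node is charged the bit
  length allowed for the whole expression, so the cost is the weight times one common
  length.\<close>

lemma acost_le:
  assumes "bounded_store X s" "bounded_input N s" "tame e" "weight e \<le> w"
  shows "acost e s \<le> weight e * (X + w * (N + 1) + 2)"
  using assms(3,4)
proof (induction e)
  case (Const n)
  have "bit_length n \<le> weight (Const n) * 1" by simp
  also have "\<dots> \<le> weight (Const n) * (X + w * (N + 1) + 2)" by (intro mult_le_mono) auto
  finally show ?case by simp
next
  note [simp del] = aval.simps
  have *: "bit_length (aval e s) \<le> X + w * (N + 1) + 2" if "tame e" "weight e \<le> w" for e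
  proof (rule bit_length_le)
    have "\<bar>aval e s\<bar> \<le> 2 ^ (X + weight e * (N + 1))" by (rule abs_aval_le[OF assms(1,2) that(1)])
    also have "\<dots> \<le> 2 ^ (X + w * (N + 1))"
      using that(2) by (intro power_increasing add_mono mult_le_mono1) auto
    finally show "\<bar>aval e s\<bar> \<le> 2 ^ (X + w * (N + 1))" .
  qed
  {
    case (Get a e)
    then show ?case using *[OF Get.prems] by simp
  next
    case (Add e1 e2)
    then show ?case using *[OF Add.prems] by (simp add: add_mult_distrib)
  next
    case (Sub e1 e2)
    then show ?case using *[OF Sub.prems] by (simp add: add_mult_distrib)
  next
    case (Mul e1 e2)
    then show ?case using *[OF Mul.prems] by (simp add: add_mult_distrib)
  next
    case (Div e1 e2)
    then show ?case using *[OF Div.prems] by (simp add: add_mult_distrib)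
  }
qed

lemma run_frame: "a \<notin> writes p \<Longrightarrow> run p s a = s a"
proof (induction p arbitrary: s)
  case (LFor b p)
  have "((\<lambda>s. upd (run p s) b 0 (run p s b 0 + 1)) ^^ m) s' a = s' a" for m s'
    using LFor by (induction m) auto
  then show ?case using LFor.prems by simp
qed auto

lemma wf_lprog_writes: "wf_lprog p \<Longrightarrow> 0 \<notin> writes p"
  by (induction p) auto

section \<open>Polynomial bounds for compiled loop programs\<close>

definition while_weight :: nat where
  "while_weight = weight (Sub (cell 0) (cell 0))"

definition inc_weight :: nat where
  "inc_weight = weight (Const 0) + weight (Add (cell 0) (Const 1))"

text \<open>\<open>growth\<close> bounds the gain in bit length in units of N + 1, and
  \<open>steps\<close> the number of charged operations. Both are polynomials in N because N also
  bounds the rounds of a loop, which contributes the variable as a factor.\<close>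

fun growth :: "lprog \<Rightarrow> nat poly" where
  "growth (LPut a e1 e2) = [:weight e1 + weight e2:]"
| "growth (LSeq p q) = growth p + growth q"
| "growth (LIf e p q) = [:weight e:] + growth p + growth q"
| "growth (LFor a p) = [:0, 1:] * (growth p + [:inc_weight:]) + [:while_weight + 2 * weight (Const 0):]"

fun steps :: "lprog \<Rightarrow> nat poly" where
  "steps (LPut a e1 e2) = [:1 + weight e1 + weight e2:]"
| "steps (LSeq p q) = steps p + steps q"
| "steps (LIf e p q) = [:1 + weight e:] + steps p + steps q"
| "steps (LFor a p) = [:0, 1:] * (steps p + [:1 + inc_weight + while_weight + 1:])
     + [:while_weight + 1 + (1 + 2 * weight (Const 0)):]"

text \<open>\<open>X\<close> bounds the bit lengths at the start, and each of the \<open>T\<close>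
  units of time is charged at the length reached at the end. In this form both \<open>T\<close> and
  \<open>g\<close> simply add up under composition.\<close>

definition tracks :: "nat \<Rightarrow> com \<Rightarrow> nat \<Rightarrow> nat \<Rightarrow> nat \<Rightarrow> store \<Rightarrow> store \<Rightarrow> bool" where
  "tracks N c T g X s s' \<longleftrightarrow>
     (\<exists>t. exec c s t s' \<and> t \<le> T * (X + g * (N + 1) + 2)) \<and> bounded_store (X + g * (N + 1)) s'"

lemma tracks_Put:
  assumes "bounded_store X s" "bounded_input N s" "tame e1" "tame e2"
  shows "tracks N (Put a e1 e2) (1 + weight e1 + weight e2) (weight e1 + weight e2) X s
    (upd s a (nat (aval e1 s)) (aval e2 s))"
proof -
  let ?w = "weight e1 + weight e2"
  let ?Y = "X + ?w * (N + 1) + 2"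
  have "acost e1 s \<le> weight e1 * ?Y" "acost e2 s \<le> weight e2 * ?Y"
    by (rule acost_le[OF assms(1,2)]; use assms in simp)+
  then have "1 + acost e1 s + acost e2 s \<le> (1 + weight e1 + weight e2) * ?Y"
    by (simp add: add_mult_distrib del: mult_Suc_right)
  moreover have "\<bar>aval e2 s\<bar> \<le> 2 ^ (X + ?w * (N + 1))"
    by (rule order_trans[OF abs_aval_le[OF assms(1,2,4)] power_increasing])
      (simp_all add: add_mult_distrib)
  moreover have "bounded_store (X + ?w * (N + 1)) s"
    using assms(1) by (rule bounded_store_mono) simp
  ultimately show ?thesis
    using exec_Put[of a e1 e2 s] unfolding tracks_def bounded_store_def
    by (auto simp: upd_def)
qed

text \<open>The second command is assumed for every \<open>Y\<close> because a bound on the bit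
  lengths in \<open>s1\<close> is known only through the first command.\<close>

lemma tracks_Seq:
  assumes 1: "tracks N c1 T1 g1 X s s1"
    and 2: "\<And>Y. bounded_store Y s1 \<Longrightarrow> tracks N c2 T2 g2 Y s1 s2"
  shows "tracks N (Seq c1 c2) (T1 + T2) (g1 + g2) X s s2"
proof -
  from 1 obtain t1 where t1: "exec c1 s t1 s1" "t1 \<le> T1 * (X + g1 * (N + 1) + 2)"
    and b1: "bounded_store (X + g1 * (N + 1)) s1"
    unfolding tracks_def by blast
  from 2[OF b1] obtain t2 where t2: "exec c2 s1 t2 s2"
      "t2 \<le> T2 * (X + g1 * (N + 1) + g2 * (N + 1) + 2)"
    and b2: "bounded_store (X + g1 * (N + 1) + g2 * (N + 1)) s2"
    unfolding tracks_def by blast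
  have "t1 \<le> T1 * (X + (g1 + g2) * (N + 1) + 2)"
    by (rule order_trans[OF t1(2)]) (intro mult_le_mono2 add_mono mult_le_mono1; simp)
  moreover have "t2 \<le> T2 * (X + (g1 + g2) * (N + 1) + 2)"
    using t2(2) by (simp add: algebra_simps)
  ultimately have "t1 + t2 \<le> (T1 + T2) * (X + (g1 + g2) * (N + 1) + 2)"
    by (simp add: add_mult_distrib del: mult_Suc_right)
  moreover have "bounded_store (X + (g1 + g2) * (N + 1)) s2"
    using b2 by (simp add: algebra_simps)
  ultimately show ?thesis
    unfolding tracks_def using exec_Seq[OF t1(1) t2(1)] by blast
qed

lemma tracks_mono:
  assumes "tracks N c T g X s s'" "T \<le> T'" "g \<le> g'"
  shows "tracks N c T' g' X s s'"
proof -
  have le: "X + g * (N + 1) \<le> X + g' * (N + 1)" using assms(3) by (intro add_mono mult_le_mono1) auto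
  have "T * (X + g * (N + 1) + 2) \<le> T' * (X + g' * (N + 1) + 2)"
    using le by (intro mult_le_mono assms add_mono) auto
  with assms(1) le show ?thesis unfolding tracks_def by (meson bounded_store_mono order_trans)
qed

text \<open>\<open>m\<close> is the number of rounds still to go, that is, the value of the guard.
  Fixing the whole input array as \<open>z\<close> supplies the bound on input entries in every
  round, while the bound on the store grows by \<open>g * (N + 1)\<close> per round.\<close>

lemma tracks_While:
  assumes body: "\<And>s X. bounded_store X s \<Longrightarrow> s 0 = z \<Longrightarrow> tracks N b T g X s (f s)"
    and f0: "\<And>s. f s 0 = s 0" and fa: "\<And>s. f s a 0 = s a 0 + 1"
    and z: "\<And>s. s 0 = z \<Longrightarrow> bounded_input N s"
    and "bounded_store X s" "s 0 = z" "s a 0 = s 0 0 - int m"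
  shows "tracks N (WhilePos (Sub (cell 0) (cell a)) b) (m * (T + while_weight + 1) + (while_weight + 1))
    (m * g + while_weight) X s ((f ^^ m) s)"
  using assms(5-7)
proof (induction m arbitrary: s X)
  case 0
  let ?e = "Sub (cell 0) (cell a)"
  have w: "weight ?e = while_weight" by (simp add: while_weight_def)
  have "acost ?e s \<le> while_weight * (X + while_weight * (N + 1) + 2)"
    using acost_le[OF "0.prems"(1) z[of s, OF "0.prems"(2)], of ?e while_weight] unfolding w by (simp del: acost.simps weight.simps)
  moreover have "exec (WhilePos ?e b) s (1 + acost ?e s) s"
    using 0 by (intro exec_WhileNonpos) simp
  moreover have "bounded_store (X + while_weight * (N + 1)) s"
    by (rule bounded_store_mono[OF 0(1)]) simp
  ultimately show ?case
    unfolding tracks_def by (auto simp del: mult_Suc_right acost.simps intro!: exI)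
next
  case (Suc m)
  let ?e = "Sub (cell 0) (cell a)"
  let ?w = while_weight
  define Y where "Y = X + (Suc m * g + ?w) * (N + 1) + 2"
  have w: "weight ?e = ?w" by (simp add: while_weight_def)
  have "acost ?e s \<le> ?w * (X + ?w * (N + 1) + 2)"
    using acost_le[OF Suc.prems(1) z[of s, OF Suc.prems(2)], of ?e ?w] unfolding w by (simp del: acost.simps weight.simps)
  also have "\<dots> \<le> ?w * Y" unfolding Y_def by (intro mult_le_mono2 add_mono mult_le_mono1) auto
  finally have c0: "acost ?e s \<le> ?w * Y" .
  obtain t1 where t1: "exec b s t1 (f s)" "t1 \<le> T * (X + g * (N + 1) + 2)"
    and b1: "bounded_store (X + g * (N + 1)) (f s)"
    using body[OF Suc.prems(1,2)] unfolding tracks_def by blast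
  have c1: "t1 \<le> T * Y"
    by (rule order_trans[OF t1(2)], unfold Y_def) (intro mult_le_mono2 add_mono mult_le_mono1; simp)
  have "f s 0 = z" using Suc.prems(2) f0 by simp
  moreover have "f s a 0 = f s 0 0 - int m" using Suc.prems(3) f0 fa by simp
  ultimately have "tracks N (WhilePos ?e b) (m * (T + ?w + 1) + (?w + 1)) (m * g + ?w)
      (X + g * (N + 1)) (f s) ((f ^^ m) (f s))"
    by (rule Suc.IH[OF b1])
  moreover have "X + g * (N + 1) + (m * g + ?w) * (N + 1) + 2 = Y"
    by (simp add: Y_def algebra_simps)
  moreover have "X + g * (N + 1) + (m * g + ?w) * (N + 1) = X + (Suc m * g + ?w) * (N + 1)"
    by (simp add: algebra_simps)
  ultimately obtain t2 where t2: "exec (WhilePos ?e b) (f s) t2 ((f ^^ m) (f s))"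
      and c2: "t2 \<le> (m * (T + ?w + 1) + (?w + 1)) * Y"
    and b2: "bounded_store (X + (Suc m * g + ?w) * (N + 1)) ((f ^^ m) (f s))"
    unfolding tracks_def by metis
  have "exec (WhilePos ?e b) s (1 + acost ?e s + t1 + t2) ((f ^^ m) (f s))"
    using Suc.prems(3) by (intro exec_WhilePos[OF _ t1(1) t2]) simp
  moreover have "1 + acost ?e s + t1 + t2 \<le> (Suc m * (T + ?w + 1) + (?w + 1)) * Y"
  proof -
    have "1 \<le> Y" by (simp add: Y_def)
    with c0 c1 c2 have "1 + acost ?e s + t1 + t2
        \<le> Y + ?w * Y + T * Y + (m * (T + ?w + 1) + (?w + 1)) * Y" by linarith
    also have "\<dots> = (Suc m * (T + ?w + 1) + (?w + 1)) * Y" by (simp add: algebra_simps)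
    finally show ?thesis .
  qed
  ultimately show ?case
    using b2 unfolding tracks_def Y_def funpow_Suc_right comp_def by blast
qed

text \<open>The same \<open>N\<close> bounds the bit lengths of input entries and the number of
  rounds of a loop; the latter is what makes a loop controlled by a number polynomial.\<close>

theorem tracks_compile:
  assumes "wf_lprog p" "bounded_store X s" "bounded_input N s" "nat (s 0 0) \<le> N" "0 \<le> s 0 0"
  shows "tracks N (compile p) (poly (steps p) N) (poly (growth p) N) X s (run p s)"
  using assms
proof (induction p arbitrary: X s)
  case (LPut a e1 e2)
  then show ?case using tracks_Put[of X s N e1 e2 a] by simp
next
  case (LSeq p q)
  have fr: "run p s 0 = s 0" using LSeq.prems(1) by (intro run_frame wf_lprog_writes) auto
  show ?case
    using LSeq fr by (auto intro!: tracks_Seq simp: bounded_input_def)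
next
  case (LIf e p q)
  define g where "g = weight e + poly (growth p) N + poly (growth q) N"
  define Y where "Y = X + g * (N + 1) + 2"
  define r where "r = (if 0 < aval e s then p else q)"
  have "tracks N (compile r) (poly (steps r) N) (poly (growth r) N) X s (run r s)"
    using LIf by (auto simp: r_def)
  then have "tracks N (compile r) (poly (steps p) N + poly (steps q) N) g X s (run r s)"
    by (rule tracks_mono) (auto simp: r_def g_def)
  then obtain t where t: "exec (compile r) s t (run r s)" "t \<le> (poly (steps p) N + poly (steps q) N) * Y"
    and b: "bounded_store (X + g * (N + 1)) (run r s)"
    unfolding tracks_def Y_def by blast
  have c: "acost e s \<le> weight e * Y"
    unfolding Y_def using LIf.prems by (intro acost_le) (auto simp: g_def)
  have "exec (compile (LIf e p q)) s (1 + acost e s + t) (run r s)"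
    using t(1) exec_IfPos[of e s "compile p" t "run p s" "compile q"]
      exec_IfNonpos[of e s "compile q" t "run q s" "compile p"]
    by (cases "0 < aval e s") (auto simp: r_def)
  moreover have "1 + acost e s + t \<le> poly (steps (LIf e p q)) N * Y"
  proof -
    have "1 \<le> Y" by (simp add: Y_def)
    then show ?thesis using c t(2) by (simp add: algebra_simps)
  qed
  moreover have "run (LIf e p q) s = run r s" by (simp add: r_def)
  moreover have "poly (growth (LIf e p q)) N = g" by (simp add: g_def)
  ultimately show ?case using b unfolding tracks_def Y_def by metis
next
  case (LFor a p)
  let ?f = "\<lambda>s. upd (run p s) a 0 (run p s a 0 + 1)"
  let ?inc = "Put a (Const 0) (Add (cell a) (Const 1))"
  let ?n = "nat (s 0 0)"
  let ?T = "poly (steps p) N" and ?g = "poly (growth p) N" and ?c = "weight (Const 0)"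
  have a: "a \<noteq> 0" "wf_lprog p" "a \<notin> writes p" using LFor.prems by auto
  have fr: "run p s 0 = s 0" "run p s a = s a" for s
    using a by (auto intro!: run_frame wf_lprog_writes)
  define s1 where "s1 = upd s a 0 0"
  have s10: "s1 0 = s 0" using a by (simp add: s1_def)
  have inc: "tracks N ?inc (1 + inc_weight) inc_weight X' s' (upd s' a 0 (s' a 0 + 1))"
    if "bounded_store X' s'" "bounded_input N s'" for X' s'
    using tracks_Put[OF that, of "Const 0" "Add (cell a) (Const 1)" a]
    by (simp add: inc_weight_def add.assoc)
  have body: "tracks N (Seq (compile p) ?inc) (?T + (1 + inc_weight)) (?g + inc_weight) X' s' (?f s')"
    if "bounded_store X' s'" "bounded_input N s'" "s' 0 = s 0" for X' s'
  proof (rule tracks_Seq)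
    show "tracks N (compile p) ?T ?g X' s' (run p s')"
      using that LFor.prems a by (intro LFor.IH) simp_all
    show "tracks N ?inc (1 + inc_weight) inc_weight Y (run p s') (?f s')"
      if "bounded_store Y (run p s')" for Y
      using that \<open>bounded_input N s'\<close> fr by (intro inc) (simp_all add: bounded_input_def)
  qed
  have s1: "tracks N (Put a (Const 0) (Const 0)) (1 + 2 * ?c) (2 * ?c) X s s1"
    using tracks_Put[OF LFor.prems(2,3), of "Const 0" "Const 0" a] by (simp add: s1_def mult_2)
  have "tracks N (WhilePos (Sub (cell 0) (cell a)) (Seq (compile p) ?inc))
      (?n * (?T + (1 + inc_weight) + while_weight + 1) + (while_weight + 1))
      (?n * (?g + inc_weight) + while_weight) Y s1 ((?f ^^ ?n) s1)" if "bounded_store Y s1" for Y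
  proof (rule tracks_While[where f = ?f and z = "s 0"])
    show "bounded_input N s'" if "s' 0 = s 0" for s'
      using that LFor.prems(3) by (simp add: bounded_input_def)
    then show "tracks N (Seq (compile p) ?inc) (?T + (1 + inc_weight)) (?g + inc_weight) X' s' (?f s')"
      if "bounded_store X' s'" "s' 0 = s 0" for X' s'
      using that by (intro body)
    show "?f s' 0 = s' 0" "?f s' a 0 = s' a 0 + 1" for s'
      using a fr by simp_all
    show "s1 a 0 = s1 0 0 - int ?n"
      using a LFor.prems(5) by (simp add: s1_def)
  qed (use that s10 in simp_all)
  from tracks_Seq[OF s1 this] have "tracks N (compile (LFor a p))
      (1 + 2 * ?c + (?n * (?T + (1 + inc_weight) + while_weight + 1) + (while_weight + 1)))
      (2 * ?c + (?n * (?g + inc_weight) + while_weight)) X s (run (LFor a p) s)"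
    by (simp add: s1_def)
  then show ?case
  proof (rule tracks_mono)
    have "?n * x \<le> N * x" for x using LFor.prems(4) by simp
    from this[of "?T + (1 + inc_weight) + while_weight + 1"] this[of "?g + inc_weight"]
    show "1 + 2 * ?c + (?n * (?T + (1 + inc_weight) + while_weight + 1) + (while_weight + 1))
        \<le> poly (steps (LFor a p)) N"
      "2 * ?c + (?n * (?g + inc_weight) + while_weight) \<le> poly (growth (LFor a p)) N"
      by (simp_all add: algebra_simps)
  qed
qed


section \<open>Expressions with bounded folds\<close>

text \<open>\<open>RV k\<close> is a bound variable in de Bruijn level notation: at depth \<open>d\<close>, the body of a
  \<open>RFold\<close> sees the accumulator as \<open>RV d\<close> and the index as \<open>RV (d + 1)\<close>. The first factor of
  \<open>RMul\<close> is the address of an input entry.\<close>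

datatype rexp =
    RC int
  | RV nat
  | RG nat rexp
  | RAdd rexp rexp
  | RSub rexp rexp
  | RMul rexp rexp
  | RDiv rexp rexp
  | RIf rexp rexp rexp
  | RFold rexp rexp

fun reval :: "rexp \<Rightarrow> nat \<Rightarrow> (nat \<Rightarrow> int) \<Rightarrow> store \<Rightarrow> int" where
  "reval (RC n) d \<rho> s = n"
| "reval (RV k) d \<rho> s = \<rho> k"
| "reval (RG a e) d \<rho> s = s a (nat (reval e d \<rho> s))"
| "reval (RAdd e1 e2) d \<rho> s = reval e1 d \<rho> s + reval e2 d \<rho> s"
| "reval (RSub e1 e2) d \<rho> s = reval e1 d \<rho> s - reval e2 d \<rho> s"
| "reval (RMul e1 e2) d \<rho> s = s 0 (nat (reval e1 d \<rho> s)) * reval e2 d \<rho> s"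
| "reval (RDiv e1 e2) d \<rho> s = reval e1 d \<rho> s div reval e2 d \<rho> s"
| "reval (RIf e1 e2 e3) d \<rho> s = (if 0 < reval e1 d \<rho> s then reval e2 d \<rho> s else reval e3 d \<rho> s)"
| "reval (RFold e1 e2) d \<rho> s =
     fold (\<lambda>v x. reval e2 (d + 2) (\<rho>(d := x, d + 1 := int v)) s) [0..<nat (s 0 0)] (reval e1 d \<rho> s)"

text \<open>Arrays below \<open>visible\<close> belong to the program; the others are scratch space of the compiler.\<close>

definition visible :: nat where "visible = 12"
text \<open>Scalars occupy cell 0 of an array of their own, and parity separates variables from
  registers, so that frame facts need to speak of array names only.\<close>

definition var :: "nat \<Rightarrow> nat" where "var k = visible + 2 * k"
definition tmp :: "nat \<Rightarrow> nat" where "tmp r = visible + 2 * r + 1"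

lemma var_tmp_simps [simp]:
  "var k = var l \<longleftrightarrow> k = l" "tmp k = tmp l \<longleftrightarrow> k = l" "var k \<noteq> tmp l" "tmp l \<noteq> var k"
  "\<not> var k < visible" "\<not> tmp k < visible"
  unfolding var_def tmp_def by presburger+

lemma var_tmp_nonzero [simp]: "0 < var k" "0 < tmp k"
  by (simp_all add: var_def tmp_def visible_def)

fun wf_rexp :: "nat \<Rightarrow> rexp \<Rightarrow> bool" where
  "wf_rexp d (RC n) \<longleftrightarrow> True"
| "wf_rexp d (RV k) \<longleftrightarrow> k < d"
| "wf_rexp d (RG a e) \<longleftrightarrow> a < visible \<and> wf_rexp d e"
| "wf_rexp d (RAdd e1 e2) \<longleftrightarrow> wf_rexp d e1 \<and> wf_rexp d e2"
| "wf_rexp d (RSub e1 e2) \<longleftrightarrow> wf_rexp d e1 \<and> wf_rexp d e2"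
| "wf_rexp d (RMul e1 e2) \<longleftrightarrow> wf_rexp d e1 \<and> wf_rexp d e2"
| "wf_rexp d (RDiv e1 e2) \<longleftrightarrow> wf_rexp d e1 \<and> wf_rexp d e2"
| "wf_rexp d (RIf e1 e2 e3) \<longleftrightarrow> wf_rexp d e1 \<and> wf_rexp d e2 \<and> wf_rexp d e3"
| "wf_rexp d (RFold e1 e2) \<longleftrightarrow> wf_rexp d e1 \<and> wf_rexp (d + 2) e2"

text \<open>Stack discipline: the value ends up in \<open>tmp r\<close>, and only registers from
  \<open>r\<close> on and variables from depth \<open>d\<close> on may change. The accumulator of a
  fold waits in \<open>var d\<close> because the body reuses \<open>tmp r\<close>.\<close>

fun comp :: "rexp \<Rightarrow> nat \<Rightarrow> nat \<Rightarrow> lprog" where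
  "comp (RC n) d r = LPut (tmp r) (Const 0) (Const n)"
| "comp (RV k) d r = LPut (tmp r) (Const 0) (cell (var k))"
| "comp (RG a e) d r = LSeq (comp e d r) (LPut (tmp r) (Const 0) (Get a (cell (tmp r))))"
| "comp (RAdd e1 e2) d r = LSeq (comp e1 d r) (LSeq (comp e2 d (Suc r))
     (LPut (tmp r) (Const 0) (Add (cell (tmp r)) (cell (tmp (Suc r))))))"
| "comp (RSub e1 e2) d r = LSeq (comp e1 d r) (LSeq (comp e2 d (Suc r))
     (LPut (tmp r) (Const 0) (Sub (cell (tmp r)) (cell (tmp (Suc r))))))"
| "comp (RMul e1 e2) d r = LSeq (comp e1 d r) (LSeq (comp e2 d (Suc r))
     (LPut (tmp r) (Const 0) (Mul (Get 0 (cell (tmp r))) (cell (tmp (Suc r))))))"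
| "comp (RDiv e1 e2) d r = LSeq (comp e1 d r) (LSeq (comp e2 d (Suc r))
     (LPut (tmp r) (Const 0) (Div (cell (tmp r)) (cell (tmp (Suc r))))))"
| "comp (RIf e1 e2 e3) d r = LSeq (comp e1 d r) (LIf (cell (tmp r)) (comp e2 d r) (comp e3 d r))"
| "comp (RFold e1 e2) d r = LSeq (comp e1 d r) (LSeq (LPut (var d) (Const 0) (cell (tmp r)))
     (LSeq (LFor (var (d + 1)) (LSeq (comp e2 (d + 2) r) (LPut (var d) (Const 0) (cell (tmp r)))))
       (LPut (tmp r) (Const 0) (cell (var d)))))"

lemma writes_comp: "writes (comp e d r) \<subseteq> var ` {d..} \<union> tmp ` {r..}"
proof (induction e arbitrary: d r)
  case (RFold e1 e2)
  have "var ` {d + 2..} \<subseteq> var ` {d..}" by (intro image_mono) auto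
  then show ?case using RFold(1)[of d r] RFold(2)[of "d + 2" r] by (auto simp: subset_iff)
next
  case (RAdd e1 e2)
  show ?case using RAdd(1)[of d r] RAdd(2)[of d "Suc r"] by (fastforce simp: subset_iff)
next
  case (RSub e1 e2)
  show ?case using RSub(1)[of d r] RSub(2)[of d "Suc r"] by (fastforce simp: subset_iff)
next
  case (RMul e1 e2)
  show ?case using RMul(1)[of d r] RMul(2)[of d "Suc r"] by (fastforce simp: subset_iff)
next
  case (RDiv e1 e2)
  show ?case using RDiv(1)[of d r] RDiv(2)[of d "Suc r"] by (fastforce simp: subset_iff)
next
  case (RIf e1 e2 e3)
  show ?case using RIf(1)[of d r] RIf(2)[of d r] RIf(3)[of d r] by auto
next
  case (RG a e)
  show ?case using RG(1)[of d r] by auto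
qed auto

lemma writes_comp_iff:
  "a < visible \<Longrightarrow> a \<notin> writes (comp e d r)"
  "k < d \<Longrightarrow> var k \<notin> writes (comp e d r)"
  "q < r \<Longrightarrow> tmp q \<notin> writes (comp e d r)"
  using writes_comp[of e d r] by (auto dest!: subsetD)

lemma run_comp_frame [simp]:
  "a < visible \<Longrightarrow> run (comp e d r) s a = s a"
  "k < d \<Longrightarrow> run (comp e d r) s (var k) = s (var k)"
  "q < r \<Longrightarrow> run (comp e d r) s (tmp q) = s (tmp q)"
  by (auto intro!: run_frame simp: writes_comp_iff)

lemma wf_comp: "wf_lprog (comp e d r)"
  by (induction e arbitrary: d r) (auto simp: writes_comp_iff)

text \<open>Compiled code writes only scratch arrays outside the variables in scope, so this makes
  it irrelevant whether an operand is evaluated before or after the code of another operand has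
  run.\<close>

lemma reval_cong:
  assumes "wf_rexp d e" "\<And>k. k < d \<Longrightarrow> \<rho> k = \<rho>' k" "\<And>a. a < visible \<Longrightarrow> s a = s' a"
  shows "reval e d \<rho> s = reval e d \<rho>' s'"
  using assms
proof (induction e arbitrary: d \<rho> \<rho>')
  case (RFold e1 e2)
  have 0: "s 0 = s' 0" using RFold.prems(3)[of 0] by (simp add: visible_def)
  have "reval e2 (d + 2) (\<rho>(d := x, d + 1 := int v)) s = reval e2 (d + 2) (\<rho>'(d := x, d + 1 := int v)) s'"
    for x v
    using RFold.prems by (intro RFold.IH) (auto simp: less_Suc_eq)
  then show ?case using RFold.IH(1)[of d \<rho> \<rho>'] RFold.prems 0 by (auto intro: fold_cong)
next
  case (RMul e1 e2)
  have 0: "s 0 = s' 0" using RMul.prems(3)[of 0] by (simp add: visible_def)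
  show ?case using RMul.IH(1)[of d \<rho> \<rho>'] RMul.IH(2)[of d \<rho> \<rho>'] RMul.prems 0 by simp
next
  case (RIf e1 e2 e3)
  show ?case using RIf.IH(1)[of d \<rho> \<rho>'] RIf.IH(2)[of d \<rho> \<rho>'] RIf.IH(3)[of d \<rho> \<rho>'] RIf.prems by simp
next
  case (RG a e)
  show ?case using RG.IH[of d \<rho> \<rho>'] RG.prems by simp
next
  case (RAdd e1 e2)
  show ?case using RAdd.IH(1)[of d \<rho> \<rho>'] RAdd.IH(2)[of d \<rho> \<rho>'] RAdd.prems by simp
next
  case (RSub e1 e2)
  show ?case using RSub.IH(1)[of d \<rho> \<rho>'] RSub.IH(2)[of d \<rho> \<rho>'] RSub.prems by simp
next
  case (RDiv e1 e2)
  show ?case using RDiv.IH(1)[of d \<rho> \<rho>'] RDiv.IH(2)[of d \<rho> \<rho>'] RDiv.prems by simp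
qed auto

lemma reval_run_comp:
  assumes "wf_rexp d e"
  shows "reval e d (\<lambda>k. run (comp e' d r) s (var k) 0) (run (comp e' d r) s)
    = reval e d (\<lambda>k. s (var k) 0) s"
  using assms by (intro reval_cong) auto

lemma run_comp:
  "wf_rexp d e \<Longrightarrow> run (comp e d r) s (tmp r) 0 = reval e d (\<lambda>k. s (var k) 0) s"
proof (induction e arbitrary: d r s)
  case (RFold e1 e2)
  define s1 where "s1 = run (comp e1 d r) s"
  define s2 where "s2 = upd s1 (var d) 0 (s1 (tmp r) 0)"
  define s3 where "s3 = upd s2 (var (d + 1)) 0 0"
  define p where "p = LSeq (comp e2 (d + 2) r) (LPut (var d) (Const 0) (cell (tmp r)))"
  define f where "f = (\<lambda>s. upd (run p s) (var (d + 1)) 0 (run p s (var (d + 1)) 0 + 1))"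
  define \<rho> where "\<rho> = (\<lambda>k. s (var k) 0)"
  define g where "g = (\<lambda>v x. reval e2 (d + 2) (\<rho>(d := x, d + 1 := int v)) s)"
  have wf: "wf_rexp d e1" "wf_rexp (d + 2) e2" using RFold.prems by auto
  have nv: "a \<noteq> var k" "a \<noteq> tmp k" if "a < visible" for a k
    using that var_tmp_simps(5,6) by metis+
  have s1: "s1 (tmp r) 0 = reval e1 d \<rho> s" unfolding s1_def \<rho>_def by (rule RFold.IH(1)[OF wf(1)])
  \<comment> \<open>Before round \<open>m\<close> the two loop variables hold what the body reads as
    \<open>RV d\<close> and \<open>RV (d + 1)\<close>, and the surrounding environment is
    intact.\<close>
  have inv: "((f ^^ m) s3) (var (d + 1)) 0 = int m \<and> ((f ^^ m) s3) (var d) 0 = fold g [0..<m] (reval e1 d \<rho> s)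
      \<and> (\<forall>a<visible. ((f ^^ m) s3) a = s a) \<and> (\<forall>k<d. ((f ^^ m) s3) (var k) = s (var k))" for m
  proof (induction m)
    case 0
    show ?case using s1 nv by (auto simp: s3_def s2_def s1_def)
  next
    case (Suc m)
    let ?s = "(f ^^ m) s3"
    have "run (comp e2 (d + 2) r) ?s (tmp r) 0 = reval e2 (d + 2) (\<lambda>k. ?s (var k) 0) ?s"
      by (rule RFold.IH(2)[OF wf(2)])
    also have "\<dots> = reval e2 (d + 2) (\<rho>(d := fold g [0..<m] (reval e1 d \<rho> s), d + 1 := int m)) s"
      using Suc wf(2) by (intro reval_cong) (auto simp: \<rho>_def less_Suc_eq)
    also have "\<dots> = g m (fold g [0..<m] (reval e1 d \<rho> s))"
      by (simp add: g_def)
    finally show ?case using Suc nv by (auto simp: f_def p_def)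
  qed
  have "run (comp (RFold e1 e2) d r) s = upd ((f ^^ nat (s 0 0)) s3) (tmp r) 0 (((f ^^ nat (s 0 0)) s3) (var d) 0)"
  proof -
    have "s2 0 = s 0" using nv by (simp add: s2_def s1_def visible_def)
    then show ?thesis by (simp add: s3_def s2_def s1_def f_def p_def)
  qed
  then show ?case using inv by (simp add: g_def \<rho>_def)
next
  case (RG a e)
  then show ?case by simp
next
  case (RAdd e1 e2)
  then show ?case by (simp add: reval_run_comp)
next
  case (RSub e1 e2)
  then show ?case by (simp add: reval_run_comp)
next
  case (RMul e1 e2)
  then show ?case by (simp add: reval_run_comp visible_def)
next
  case (RDiv e1 e2)
  then show ?case by (simp add: reval_run_comp)
next
  case (RIf e1 e2 e3)
  then show ?case by (simp add: reval_run_comp)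
qed auto

section \<open>Imperative programs over expressions with folds\<close>

datatype hprog =
    HPut nat rexp rexp
  | HSeq hprog hprog
  | HFor nat hprog

abbreviation eval0 :: "rexp \<Rightarrow> store \<Rightarrow> int" where
  "eval0 e s \<equiv> reval e 0 (\<lambda>_. 0) s"

fun hrun :: "hprog \<Rightarrow> store \<Rightarrow> store" where
  "hrun (HPut a e1 e2) s = upd s a (nat (eval0 e1 s)) (eval0 e2 s)"
| "hrun (HSeq p q) s = hrun q (hrun p s)"
| "hrun (HFor a p) s = ((\<lambda>s. upd (hrun p s) a 0 (hrun p s a 0 + 1)) ^^ nat (s 0 0)) (upd s a 0 0)"

fun hwrites :: "hprog \<Rightarrow> nat set" where
  "hwrites (HPut a e1 e2) = {a}"
| "hwrites (HSeq p q) = hwrites p \<union> hwrites q"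
| "hwrites (HFor a p) = insert a (hwrites p)"

fun wf_hprog :: "hprog \<Rightarrow> bool" where
  "wf_hprog (HPut a e1 e2) \<longleftrightarrow> 0 < a \<and> a < visible \<and> wf_rexp 0 e1 \<and> wf_rexp 0 e2"
| "wf_hprog (HSeq p q) \<longleftrightarrow> wf_hprog p \<and> wf_hprog q"
| "wf_hprog (HFor a p) \<longleftrightarrow> 0 < a \<and> a < visible \<and> wf_hprog p \<and> a \<notin> hwrites p"

fun hcomp :: "hprog \<Rightarrow> lprog" where
  "hcomp (HPut a e1 e2) = LSeq (comp e1 0 0) (LSeq (comp e2 0 1)
     (LPut a (cell (tmp 0)) (cell (tmp 1))))"
| "hcomp (HSeq p q) = LSeq (hcomp p) (hcomp q)"
| "hcomp (HFor a p) = LFor a (hcomp p)"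

lemma writes_hcomp: "a < visible \<Longrightarrow> a \<in> writes (hcomp p) \<longleftrightarrow> a \<in> hwrites p"
  by (induction p) (auto simp: writes_comp_iff)

lemma wf_hcomp: "wf_hprog p \<Longrightarrow> wf_lprog (hcomp p)"
  by (induction p) (auto simp: writes_hcomp wf_comp)

lemma hrun_frame: "a \<notin> hwrites p \<Longrightarrow> hrun p s a = s a"
proof (induction p arbitrary: s)
  case (HFor b p)
  have "((\<lambda>s. upd (hrun p s) b 0 (hrun p s b 0 + 1)) ^^ m) s' a = s' a" for m s'
    using HFor by (induction m) auto
  then show ?case using HFor.prems by simp
qed auto

text \<open>Two stores are compared because the compiled run spoils scratch arrays that the abstract
  run never touches. Agreement on visible arrays is what survives from one loop round to the
  next.\<close>

lemma run_hcomp: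
  assumes "wf_hprog p" "\<And>a. a < visible \<Longrightarrow> s a = s' a" "a < visible"
  shows "run (hcomp p) s a = hrun p s' a"
  using assms
proof (induction p arbitrary: s s' a)
  case (HPut b e1 e2)
  define s1 where "s1 = run (comp e1 0 0) s"
  define s2 where "s2 = run (comp e2 0 1) s1"
  have vis: "s1 c = s' c" "s2 c = s' c" if "c < visible" for c
    using HPut.prems(2) that by (simp_all add: s1_def s2_def)
  have "s2 (tmp 0) 0 = reval e1 0 (\<lambda>k. s (var k) 0) s"
    using HPut.prems(1) run_comp[of 0 e1 0 s] by (simp add: s1_def s2_def)
  also have "\<dots> = eval0 e1 s'" using HPut.prems by (intro reval_cong) auto
  finally have 1: "s2 (tmp 0) 0 = eval0 e1 s'" .
  have "s2 (tmp 1) 0 = reval e2 0 (\<lambda>k. s1 (var k) 0) s1"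
    unfolding s2_def using HPut.prems(1) by (intro run_comp) simp
  also have "\<dots> = eval0 e2 s'" using HPut.prems vis by (intro reval_cong) auto
  finally have 2: "s2 (tmp 1) 0 = eval0 e2 s'" .
  have "run (hcomp (HPut b e1 e2)) s = upd s2 b (nat (s2 (tmp 0) 0)) (s2 (tmp 1) 0)"
    by (simp add: s1_def s2_def)
  then show ?case using vis[OF HPut.prems(3)] unfolding 1 2 by (auto simp: upd_apply fun_eq_iff)
next
  case (HSeq p q)
  then show ?case by simp
next
  case (HFor b p)
  let ?f = "\<lambda>s. upd (run (hcomp p) s) b 0 (run (hcomp p) s b 0 + 1)"
  let ?g = "\<lambda>s. upd (hrun p s) b 0 (hrun p s b 0 + 1)"
  have b: "b < visible" "wf_hprog p" using HFor.prems by auto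
  have *: "(?f ^^ m) u c = (?g ^^ m) u' c" if "\<And>c. c < visible \<Longrightarrow> u c = u' c" "c < visible" for m u u' c
    using that(2)
  proof (induction m arbitrary: c)
    case 0
    then show ?case using that(1) by simp
  next
    case (Suc m)
    have "run (hcomp p) ((?f ^^ m) u) e = hrun p ((?g ^^ m) u') e" if "e < visible" for e
      using Suc.IH b that by (intro HFor.IH) auto
    from this[OF Suc.prems] this[OF b(1)] show ?case by (cases "c = b") simp_all
  qed
  have "s 0 = s' 0" using HFor.prems(2)[of 0] by (simp add: visible_def)
  moreover have "upd s b 0 0 c = upd s' b 0 0 c" if "c < visible" for c
    using HFor.prems(2)[OF that] by (simp add: upd_apply fun_eq_iff)
  ultimately show ?case using *[of "upd s b 0 0" "upd s' b 0 0" a] HFor.prems(3) by simp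
qed

lemma hrun_HFor_invariant:
  assumes "Inv 0 (upd s a 0 0)" "a \<noteq> 0" "a \<notin> hwrites p" "0 \<notin> hwrites p"
    and "\<And>i s'. i < nat (s 0 0) \<Longrightarrow> s' 0 = s 0 \<Longrightarrow> s' a 0 = int i \<Longrightarrow> Inv i s' \<Longrightarrow>
      Inv (Suc i) (upd (hrun p s') a 0 (int i + 1))"
  shows "Inv (nat (s 0 0)) (hrun (HFor a p) s)"
proof -
  let ?g = "\<lambda>s. upd (hrun p s) a 0 (hrun p s a 0 + 1)"
  have "(?g ^^ m) (upd s a 0 0) 0 = s 0 \<and> (?g ^^ m) (upd s a 0 0) a 0 = int m
      \<and> Inv m ((?g ^^ m) (upd s a 0 0))" if "m \<le> nat (s 0 0)" for m
    using that
  proof (induction m)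
    case 0
    then show ?case using assms by simp
  next
    case (Suc m)
    let ?s = "(?g ^^ m) (upd s a 0 0)"
    have IH: "?s 0 = s 0" "?s a 0 = int m" "Inv m ?s" using Suc by auto
    have "Inv (Suc m) (upd (hrun p ?s) a 0 (int m + 1))"
      using Suc.prems IH by (intro assms(5)) auto
    then show ?case using IH assms(2-4) by (auto simp: hrun_frame)
  qed
  from this[of "nat (s 0 0)"] show ?thesis by simp
qed

text \<open>The entry about to be overwritten still has its old value, so \<open>e\<close> may read
  it. This is used where the old output is kept unless a better one has been found.\<close>

lemma hrun_fill:
  assumes "a \<noteq> 0" "b \<noteq> 0" "a \<noteq> b"
    and e: "\<And>i s'. i < nat (s 0 0) \<Longrightarrow> (\<And>c. c \<noteq> a \<Longrightarrow> c \<noteq> b \<Longrightarrow> s' c = s c) \<Longrightarrow> s' a 0 = int i \<Longrightarrow>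
      s' b i = s b i \<Longrightarrow> eval0 e s' = f i"
  shows "hrun (HFor a (HPut b (RG a (RC 0)) e)) s b = (\<lambda>i. if i < nat (s 0 0) then f i else s b i)"
proof -
  define Inv where "Inv = (\<lambda>m s'. (\<forall>c. c \<noteq> a \<longrightarrow> c \<noteq> b \<longrightarrow> s' c = s c) \<and>
    s' b = (\<lambda>i. if i < m then f i else s b i))"
  have "Inv (nat (s 0 0)) (hrun (HFor a (HPut b (RG a (RC 0)) e)) s)"
  proof (rule hrun_HFor_invariant)
    show "Inv 0 (upd s a 0 0)" using assms by (auto simp: Inv_def)
    fix i s' assume i: "i < nat (s 0 0)" "s' 0 = s 0" "s' a 0 = int i" "Inv i s'"
    then have "eval0 e s' = f i" by (intro e) (auto simp: Inv_def)
    then show "Inv (Suc i) (upd (hrun (HPut b (RG a (RC 0)) e) s') a 0 (int i + 1))"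
      using i assms(3) by (auto simp: Inv_def fun_eq_iff)
  qed (use assms in auto)
  then show ?thesis by (simp add: Inv_def)
qed

lemma length_le_input_size: "length xs \<le> input_size xs"
  by (induction xs) (auto simp: input_size_def bit_length_def)

lemma bit_length_le_input_size: "x \<in> set xs \<Longrightarrow> bit_length x \<le> input_size xs"
  by (induction xs) (auto simp: input_size_def)

text \<open>The number of rounds is the value of the first input entry, which could be exponential
  in the input size; hence the requirement that it be at most the length of the input. The input
  size then serves both as \<open>N\<close> and as the initial bound on bit lengths.\<close>

theorem polytime_solvable_hprog:
  assumes "wf_hprog p"
    and "\<And>q. q \<in> Q \<Longrightarrow> 0 \<le> input_store (enc q) 0 0 \<and> nat (input_store (enc q) 0 0) \<le> length (enc q)"
    and "\<And>q. q \<in> Q \<Longrightarrow> correct q (output_set (hrun p (input_store (enc q))))"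
  shows "polytime_solvable Q enc correct"
proof -
  define c where "c = compile (hcomp p)"
  define P where "P = steps (hcomp p) * ([:0, 1:] + growth (hcomp p) * [:1, 1:] + [:2:])"
  have "\<exists>t s. exec c (input_store (enc q)) t s \<and> t \<le> poly P (input_size (enc q)) \<and>
      correct q (output_set s)" if q: "q \<in> Q" for q
  proof -
    let ?s = "input_store (enc q)" and ?N = "input_size (enc q)"
    have b: "\<bar>?s a i\<bar> \<le> 2 ^ ?N" for a i
    proof (cases "a = 0 \<and> i < length (enc q)")
      case True
      then have "?s a i \<in> set (enc q)" by (simp add: input_store_def)
      from bit_length_le_input_size[OF this] have "(2::int) ^ bit_length (?s a i) \<le> 2 ^ ?N"
        by (intro power_increasing) auto
      with abs_le_bit_length[of "?s a i"] show ?thesis by linarith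
    qed (auto simp: input_store_def)
    have "tracks ?N c (poly (steps (hcomp p)) ?N) (poly (growth (hcomp p)) ?N) ?N ?s (run (hcomp p) ?s)"
      unfolding c_def using b assms(2)[OF q] length_le_input_size[of "enc q"]
      by (intro tracks_compile wf_hcomp assms(1)) (auto simp: bounded_store_def bounded_input_def)
    then obtain t where t: "exec c ?s t (run (hcomp p) ?s)"
      "t \<le> poly (steps (hcomp p)) ?N * (?N + poly (growth (hcomp p)) ?N * (?N + 1) + 2)"
      unfolding tracks_def by blast
    have "run (hcomp p) ?s 1 = hrun p ?s 1"
      by (rule run_hcomp[OF assms(1)]) (auto simp: visible_def)
    then have "output_set (run (hcomp p) ?s) = output_set (hrun p ?s)"
      by (simp add: output_set_def)
    moreover have "t \<le> poly P ?N" using t(2) by (simp add: P_def algebra_simps)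
    ultimately show ?thesis using t(1) assms(3)[OF q] by (intro exI[of _ t] exI[of _ "run (hcomp p) ?s"]) simp
  qed
  then show ?thesis unfolding polytime_solvable_def by blast
qed


section \<open>Cost shares and the greedy choice of a scenario\<close>

locale second_stage =
  fixes I :: fl_instance and x :: "nat \<Rightarrow> real"
  assumes valid: "valid_instance I" and decision: "x \<in> stage_I_decisions I"
begin

definition d :: "nat \<Rightarrow> nat \<Rightarrow> real" where
  "d u v = real_of_rat (fl_dist I u v)"

definition f :: "nat \<Rightarrow> real" where
  "f i = (if x i = 1 then 0 else real_of_rat (cost_II I i))"

abbreviation "Fac \<equiv> facilities I"
abbreviation "P \<equiv> facilities I \<union> clients I"
abbreviation "g \<equiv> second_stage_value I x"

lemma P_eq: "P = {..<npoints I}" and Fac_nonempty: "Fac \<noteq> {}"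
  using valid by (auto simp: valid_instance_def)

lemma finite_Fac [simp]: "finite Fac" and finite_clients [simp]: "finite (clients I)"
  using P_eq by (metis finite_Un finite_lessThan)+

lemma metric: "Metric_space P d"
  using valid unfolding valid_instance_def d_def[abs_def] by blast

lemma d_nonneg [simp]: "0 \<le> d u v"
  using Metric_space.nonneg[OF metric] .

lemma d_commute: "d u v = d v u"
  using Metric_space.commute[OF metric] .

lemma d_triangle: "u \<in> P \<Longrightarrow> v \<in> P \<Longrightarrow> w \<in> P \<Longrightarrow> d u w \<le> d u v + d v w"
  using Metric_space.triangle[OF metric] .

lemma d_self: "u \<in> P \<Longrightarrow> d u u = 0"
  using Metric_space.zero[OF metric] by blast

lemma f_nonneg: "i \<in> Fac \<Longrightarrow> 0 \<le> f i"
  using valid by (auto simp: f_def valid_instance_def)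

lemma x_cases: "i \<in> Fac \<Longrightarrow> x i = 0 \<or> x i = 1"
  using decision by (auto simp: stage_I_decisions_def)

text \<open>\<open>open_time S i\<close> is the moment at which the clients in \<open>S\<close>, each offering \<open>t - d i j\<close> at
  time \<open>t\<close>, have paid for facility \<open>i\<close>.\<close>

definition paid :: "nat set \<Rightarrow> nat \<Rightarrow> real \<Rightarrow> real" where
  "paid S i t = (\<Sum>j\<in>S. max 0 (t - d i j))"

definition closest :: "nat set \<Rightarrow> nat \<Rightarrow> nat \<Rightarrow> nat set" where
  "closest S i l = {j \<in> S. d i j \<le> d i l}"

text \<open>The root t of |T| t - (sum of \<open>d i j\<close> over T) = \<open>f i\<close> for T =
  \<open>closest S i l\<close>. For every subset T of \<open>S\<close> the left side is a lower
  bound on what is paid at time t, and it is exact if T consists of the clients within distance t.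
  So the smallest of these roots inverts the piecewise linear function \<open>paid S i\<close>,
  without sorting the distances.\<close>

definition ratio :: "nat set \<Rightarrow> nat \<Rightarrow> nat \<Rightarrow> real" where
  "ratio S i l = (f i + (\<Sum>j\<in>closest S i l. d i j)) / card (closest S i l)"

definition open_time :: "nat set \<Rightarrow> nat \<Rightarrow> real" where
  "open_time S i = Min (ratio S i ` S)"

definition share :: "nat set \<Rightarrow> nat \<Rightarrow> real" where
  "share S j = Min ((\<lambda>i. max (open_time S i) (d i j)) ` Fac)"

section \<open>Opening times and monotonicity of shares\<close>

lemma card_closest_pos: "finite S \<Longrightarrow> l \<in> S \<Longrightarrow> 0 < card (closest S i l)"
  by (auto simp: closest_def card_gt_0_iff)

lemma paid_ge_subset:
  fixes t :: real
  assumes "finite S" "T \<subseteq> S"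
  shows "card T * t - (\<Sum>j\<in>T. d i j) \<le> paid S i t"
proof -
  have "card T * t - (\<Sum>j\<in>T. d i j) = (\<Sum>j\<in>T. t - d i j)"
    by (simp add: sum_subtractf)
  also have "\<dots> \<le> (\<Sum>j\<in>T. max 0 (t - d i j))" by (intro sum_mono) auto
  also have "\<dots> \<le> paid S i t" unfolding paid_def using assms by (intro sum_mono2) auto
  finally show ?thesis .
qed

text \<open>For the direct implication, the clients within distance \<open>t\<close> form
  \<open>closest S i l\<close> with \<open>l\<close> the farthest of them, and on them the offers
  are linear in \<open>t\<close>. The converse uses that each ratio comes from a lower bound on the
  amount paid.\<close>

lemma le_open_time_iff:
  assumes "finite S" "S \<noteq> {}" "i \<in> Fac"
  shows "t \<le> open_time S i \<longleftrightarrow> paid S i t \<le> f i"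
proof
  assume le: "t \<le> open_time S i"
  define T where "T = {j \<in> S. d i j \<le> t}"
  have fT: "finite T" using assms(1) by (simp add: T_def)
  have "paid S i t = (\<Sum>j\<in>T. max 0 (t - d i j))"
    unfolding paid_def using assms(1) by (intro sum.mono_neutral_right) (auto simp: T_def)
  also have "\<dots> = (\<Sum>j\<in>T. t - d i j)" by (intro sum.cong) (auto simp: T_def)
  also have "\<dots> \<le> f i"
  proof (cases "T = {}")
    case False
    have "Max (d i ` T) \<in> d i ` T" using fT False by (intro Max_in) auto
    then obtain l where "l \<in> T" "d i l = Max (d i ` T)" by auto
    then have l: "l \<in> T" "\<And>j. j \<in> T \<Longrightarrow> d i j \<le> d i l" using fT by simp_all
    then have T: "closest S i l = T" by (auto simp: closest_def T_def)
    have "t \<le> ratio S i l"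
      using le l(1) assms(1) unfolding open_time_def by (subst (asm) Min_ge_iff) (auto simp: T_def)
    moreover have "0 < card T" using l(1) fT by (auto simp: card_gt_0_iff)
    ultimately have "t * card T \<le> f i + (\<Sum>j\<in>T. d i j)"
      by (simp add: ratio_def T pos_le_divide_eq)
    then show ?thesis by (simp add: sum_subtractf mult.commute)
  qed (use f_nonneg assms in simp)
  finally show "paid S i t \<le> f i" .
next
  assume le: "paid S i t \<le> f i"
  have "t \<le> ratio S i l" if "l \<in> S" for l
  proof -
    have "card (closest S i l) * t - (\<Sum>j\<in>closest S i l. d i j) \<le> f i"
      using paid_ge_subset[OF assms(1), of "closest S i l" t i] le by (auto simp: closest_def)
    then show ?thesis using card_closest_pos[OF assms(1) that, of i]
      by (simp add: ratio_def pos_le_divide_eq mult.commute)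
  qed
  then show "t \<le> open_time S i" using assms unfolding open_time_def by (subst Min_ge_iff) auto
qed

lemma paid_open_time:
  assumes "finite S" "S \<noteq> {}" "i \<in> Fac"
  shows "paid S i (open_time S i) = f i"
proof (rule antisym)
  show "paid S i (open_time S i) \<le> f i" using le_open_time_iff[OF assms] by blast
  have "open_time S i \<in> ratio S i ` S" unfolding open_time_def using assms by (intro Min_in) auto
  then obtain l where l: "l \<in> S" "open_time S i = ratio S i l" by auto
  have "f i = card (closest S i l) * open_time S i - (\<Sum>j\<in>closest S i l. d i j)"
    using card_closest_pos[OF assms(1) l(1), of i] by (simp add: l(2) ratio_def)
  also have "\<dots> \<le> paid S i (open_time S i)"
    by (rule paid_ge_subset[OF assms(1)]) (auto simp: closest_def)
  finally show "f i \<le> paid S i (open_time S i)" .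
qed

lemma open_time_nonneg:
  assumes "finite S" "S \<noteq> {}" "i \<in> Fac"
  shows "0 \<le> open_time S i"
  using le_open_time_iff[OF assms, of 0] f_nonneg[OF assms(3)] by (simp add: paid_def max_absorb1)

lemma paid_mono: "finite S' \<Longrightarrow> S \<subseteq> S' \<Longrightarrow> paid S i t \<le> paid S' i t"
  unfolding paid_def by (intro sum_mono2) auto

lemma paid_mono_time: "t \<le> t' \<Longrightarrow> paid S i t \<le> paid S i t'"
  unfolding paid_def by (intro sum_mono) auto

lemma open_time_antimono:
  assumes "finite S'" "S \<noteq> {}" "S \<subseteq> S'" "i \<in> Fac"
  shows "open_time S' i \<le> open_time S i"
proof -
  have S: "finite S" "S' \<noteq> {}" using assms finite_subset by auto
  have "paid S i (open_time S' i) \<le> paid S' i (open_time S' i)" by (rule paid_mono[OF assms(1,3)])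
  also have "\<dots> = f i" by (rule paid_open_time[OF assms(1) S(2) assms(4)])
  finally show ?thesis using le_open_time_iff[OF S(1) assms(2,4)] by blast
qed

lemma share_le: "i \<in> Fac \<Longrightarrow> share S j \<le> max (open_time S i) (d i j)"
  unfolding share_def by (intro Min_le) auto

lemma share_attained: "\<exists>i\<in>Fac. share S j = max (open_time S i) (d i j)"
proof -
  have "share S j \<in> (\<lambda>i. max (open_time S i) (d i j)) ` Fac"
    unfolding share_def using Fac_nonempty by (intro Min_in) auto
  then show ?thesis by auto
qed

lemma share_nonneg: "0 \<le> share S j"
  using share_attained[of S j] d_nonneg by (metis max.coboundedI2)

lemma share_antimono:
  assumes "finite S'" "S \<noteq> {}" "S \<subseteq> S'"
  shows "share S' j \<le> share S j"
proof -
  obtain i where i: "i \<in> Fac" "share S j = max (open_time S i) (d i j)" using share_attained by blast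
  have "share S' j \<le> max (open_time S' i) (d i j)" by (rule share_le[OF i(1)])
  also have "\<dots> \<le> share S j" unfolding i(2) using open_time_antimono[OF assms i(1)] by auto
  finally show ?thesis .
qed

section \<open>Duality for the second-stage program\<close>

lemma second_stage_cost_nonneg:
  assumes "second_stage_feasible I x A z w"
  shows "0 \<le> second_stage_cost I A z w"
proof -
  have "0 \<le> real_of_rat (cost_II I i)" if "i \<in> Fac" for i
    using valid that by (auto simp: valid_instance_def)
  moreover have "0 \<le> real_of_rat (fl_dist I i j)" for i j using d_nonneg[of i j] by (simp add: d_def)
  ultimately show ?thesis
    using assms unfolding second_stage_cost_def second_stage_feasible_def
    by (intro add_nonneg_nonneg sum_nonneg mult_nonneg_nonneg) auto
qed

lemma g_le_cost: "second_stage_feasible I x A z w \<Longrightarrow> g A \<le> second_stage_cost I A z w"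
  unfolding second_stage_value_def using second_stage_cost_nonneg
  by (intro cInf_lower) (auto intro!: bdd_belowI[of _ 0])

lemma second_stage_feasible_exists: "\<exists>z w. second_stage_feasible I x A z w"
proof -
  have "1 \<le> card Fac" using Fac_nonempty by (simp add: Suc_le_eq card_gt_0_iff)
  then have "second_stage_feasible I x A (\<lambda>_. 1) (\<lambda>_ _. 1)"
    using x_cases by (force simp: second_stage_feasible_def)
  then show ?thesis by blast
qed

text \<open>The dual variables of the constraints w i j \<le> x i + z i are max 0 (v j - d i j).
  They enter the dual objective with the factor - x i, but where x i = 1 the bound f i = 0 forces
  them to vanish, so the objective is the plain sum of \<open>v\<close>.\<close>

lemma weak_duality:
  assumes "finite A" "\<And>j. j \<in> A \<Longrightarrow> 0 \<le> v j"
    and dual: "\<And>i. i \<in> Fac \<Longrightarrow> (\<Sum>j\<in>A. max 0 (v j - d i j)) \<le> f i"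
  shows "(\<Sum>j\<in>A. v j) \<le> g A"
  unfolding second_stage_value_def
proof (rule cInf_greatest)
  show "{second_stage_cost I A z w |z w. second_stage_feasible I x A z w} \<noteq> {}"
    using second_stage_feasible_exists by blast
  fix c assume "c \<in> {second_stage_cost I A z w |z w. second_stage_feasible I x A z w}"
  then obtain z w where c: "c = second_stage_cost I A z w" and feas: "second_stage_feasible I x A z w"
    by blast
  have w0: "0 \<le> w i j" and wz: "w i j \<le> x i + z i" if "i \<in> Fac" "j \<in> A" for i j
    using feas that by (auto simp: second_stage_feasible_def)
  have fz: "(\<Sum>j\<in>A. w i j * max 0 (v j - d i j)) \<le> real_of_rat (cost_II I i) * z i" if i: "i \<in> Fac" for i
  proof -
    have z: "0 \<le> z i" using feas i by (auto simp: second_stage_feasible_def)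
    have c: "0 \<le> real_of_rat (cost_II I i)" using valid i by (auto simp: valid_instance_def)
    show ?thesis
    proof (cases "x i = 1")
      case True
      then have "(\<Sum>j\<in>A. max 0 (v j - d i j)) \<le> 0" using dual[OF i] by (simp add: f_def)
      moreover have "0 \<le> (\<Sum>j\<in>A. max 0 (v j - d i j))" by (intro sum_nonneg) auto
      ultimately have "(\<Sum>j\<in>A. max 0 (v j - d i j)) = 0" by linarith
      then have "\<forall>j\<in>A. max 0 (v j - d i j) = 0" using assms(1) by (subst (asm) sum_nonneg_eq_0_iff) auto
      then show ?thesis using c z by (simp add: mult_nonneg_nonneg)
    next
      case False
      then have "x i = 0" using x_cases[OF i] by simp
      then have "(\<Sum>j\<in>A. w i j * max 0 (v j - d i j)) \<le> (\<Sum>j\<in>A. z i * max 0 (v j - d i j))"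
        using wz[OF i] by (intro sum_mono mult_right_mono) auto
      also have "\<dots> = z i * (\<Sum>j\<in>A. max 0 (v j - d i j))" by (simp add: sum_distrib_left)
      also have "\<dots> \<le> z i * f i" using dual[OF i] z by (intro mult_left_mono)
      finally show ?thesis using False by (simp add: f_def mult.commute)
    qed
  qed
  have "(\<Sum>j\<in>A. v j) \<le> (\<Sum>j\<in>A. v j * (\<Sum>i\<in>Fac. w i j))"
  proof (rule sum_mono)
    fix j assume j: "j \<in> A"
    have "1 \<le> (\<Sum>i\<in>Fac. w i j)" using feas j by (auto simp: second_stage_feasible_def)
    then show "v j \<le> v j * (\<Sum>i\<in>Fac. w i j)" using assms(2)[OF j] by (simp add: mult_le_cancel_left1)
  qed
  also have "\<dots> = (\<Sum>j\<in>A. \<Sum>i\<in>Fac. v j * w i j)" by (simp add: sum_distrib_left)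
  also have "\<dots> \<le> (\<Sum>j\<in>A. \<Sum>i\<in>Fac. w i j * max 0 (v j - d i j) + d i j * w i j)"
  proof (intro sum_mono)
    fix j i assume "j \<in> A" "i \<in> Fac"
    then have "w i j * (v j - d i j) \<le> w i j * max 0 (v j - d i j)" using w0 by (intro mult_left_mono) auto
    then show "v j * w i j \<le> w i j * max 0 (v j - d i j) + d i j * w i j" by (simp add: algebra_simps)
  qed
  also have "\<dots> = (\<Sum>i\<in>Fac. \<Sum>j\<in>A. w i j * max 0 (v j - d i j)) + (\<Sum>j\<in>A. \<Sum>i\<in>Fac. d i j * w i j)"
    by (simp add: sum.distrib sum.swap[of _ A])
  also have "\<dots> \<le> (\<Sum>i\<in>Fac. real_of_rat (cost_II I i) * z i) + (\<Sum>j\<in>A. \<Sum>i\<in>Fac. d i j * w i j)"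
    by (intro add_right_mono sum_mono fz)
  also have "\<dots> = c" by (simp add: c second_stage_cost_def d_def)
  finally show "(\<Sum>j\<in>A. v j) \<le> c" .
qed

text \<open>A share is at most the larger of opening time and distance, so it offers facility
  \<open>i\<close> no more than the client does at the opening time of \<open>i\<close>, when the
  offers add up to exactly the cost.\<close>

lemma sum_share_le:
  assumes "finite S"
  shows "(\<Sum>j\<in>S. share S j) \<le> g S"
proof (rule weak_duality[OF assms share_nonneg])
  fix i assume i: "i \<in> Fac"
  show "(\<Sum>j\<in>S. max 0 (share S j - d i j)) \<le> f i"
  proof (cases "S = {}")
    case False
    have "(\<Sum>j\<in>S. max 0 (share S j - d i j)) \<le> paid S i (open_time S i)"
      unfolding paid_def
    proof (rule sum_mono)
      fix j assume "j \<in> S"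
      show "max 0 (share S j - d i j) \<le> max 0 (open_time S i - d i j)"
        using share_le[OF i, of S j] by auto
    qed
    then show ?thesis using paid_open_time[OF assms False i] by simp
  qed (use f_nonneg[OF i] in simp)
qed

text \<open>Facilities are inserted by increasing \<open>t\<close>. The new one has the largest
  time, so either a chosen facility lies within twice that time and covers it, or all of them are
  farther away and it can be chosen itself, its own time being the maximum in the separation
  condition.\<close>

lemma separated_facilities:
  fixes t :: "nat \<Rightarrow> real"
  assumes "finite G" "G \<subseteq> Fac" "\<And>i. i \<in> G \<Longrightarrow> 0 \<le> t i"
  shows "\<exists>H\<subseteq>G. (\<forall>i\<in>H. \<forall>i'\<in>H. i \<noteq> i' \<longrightarrow> 2 * max (t i) (t i') < d i i') \<and>
    (\<forall>i\<in>G. \<exists>i'\<in>H. d i i' \<le> 2 * t i \<and> t i' \<le> t i)"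
  using assms
proof (induction G rule: finite_ranking_induct[where f = t])
  case empty
  then show ?case by auto
next
  case (insert i G)
  then obtain H where H: "H \<subseteq> G" "\<forall>i\<in>H. \<forall>i'\<in>H. i \<noteq> i' \<longrightarrow> 2 * max (t i) (t i') < d i i'"
    "\<forall>i\<in>G. \<exists>i'\<in>H. d i i' \<le> 2 * t i \<and> t i' \<le> t i" by auto
  have le: "t k \<le> t i" if "k \<in> G" for k using insert.hyps(2) that by auto
  show ?case
  proof (cases "\<exists>i'\<in>H. d i i' \<le> 2 * t i")
    case True
    then show ?thesis using H le by (intro exI[of _ H]) blast
  next
    case False
    have far: "2 * max (t k) (t i) < d k i" "2 * max (t i) (t k) < d i k" if "k \<in> H" for k
    proof -
      have "t k \<le> t i" using that H(1) by (intro le) auto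
      moreover have "2 * t i < d i k" using False that by (auto simp: not_le)
      ultimately show "2 * max (t k) (t i) < d k i" "2 * max (t i) (t k) < d i k"
        using d_commute[of i k] by simp_all
    qed
    have "d i i \<le> 2 * t i" using d_self[of i] insert.prems by auto
    then show ?thesis using H far by (intro exI[of _ "insert i H"]) blast
  qed
qed

text \<open>Pal and Tardos: opening a maximal family of facilities whose balls of radius \<open>open_time\<close> are
  disjoint costs at most three times the shares.\<close>

lemma g_le_sum_share:
  assumes "finite S" "S \<noteq> {}" "S \<subseteq> clients I" "A \<subseteq> S"
  shows "g A \<le> 3 * (\<Sum>j\<in>S. share S j)"
proof -
  define t where "t = open_time S"
  have t0: "0 \<le> t i" if "i \<in> Fac" for i unfolding t_def by (rule open_time_nonneg[OF assms(1,2) that])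
  obtain H where HF: "H \<subseteq> Fac"
    and sep: "\<And>i i'. i \<in> H \<Longrightarrow> i' \<in> H \<Longrightarrow> i \<noteq> i' \<Longrightarrow> 2 * max (t i) (t i') < d i i'"
    and cov: "\<And>i. i \<in> Fac \<Longrightarrow> \<exists>i'\<in>H. d i i' \<le> 2 * t i \<and> t i' \<le> t i"
    using separated_facilities[of Fac t] t0 by auto
  have fH: "finite H" by (rule finite_subset[OF HF finite_Fac])
  \<comment> \<open>It suffices to charge each client its connection plus its offers to
    \<open>H\<close>. Outside all balls it goes to the facility \<open>k'\<close> that covers the
    facility \<open>k\<close> defining its share, at distance at most 2 t k + d k j. Inside the ball
    of \<open>i\<close> it goes to \<open>i\<close>, and connection plus offer are exactly t i. If i
    \<noteq> k', then 2 t i < d i k' \<le> d i j + d j k' < t i + 3 share, so t i is below three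
    shares as well.\<close>
  have ex: "\<exists>i\<in>H. d i j + (\<Sum>i'\<in>H. max 0 (t i' - d i' j)) \<le> 3 * share S j" if j: "j \<in> S" for j
  proof -
    obtain k where k: "k \<in> Fac" "share S j = max (t k) (d k j)"
      using share_attained unfolding t_def by blast
    obtain k' where k': "k' \<in> H" "d k k' \<le> 2 * t k" "t k' \<le> t k" using cov[OF k(1)] by blast
    have P: "j \<in> P" "k \<in> P" "k' \<in> P" using j assms(3) k(1) k'(1) HF by auto
    have kj: "d k' j \<le> 3 * share S j"
      using d_triangle[OF P(3,2,1)] d_commute[of k k'] k k'(2) by (auto simp: max_def)
    show ?thesis
    proof (cases "\<exists>i\<in>H. d i j < t i")
      case False
      then have "(\<Sum>i'\<in>H. max 0 (t i' - d i' j)) = 0" by (intro sum.neutral) auto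
      then show ?thesis using kj k'(1) by auto
    next
      case True
      then obtain i where i: "i \<in> H" "d i j < t i" by blast
      have iP: "i \<in> P" using i HF by auto
      \<comment> \<open>The balls are disjoint, so a client in the ball of \<open>i\<close> offers
        nothing to any other facility of \<open>H\<close>.\<close>
      have uniq: "max 0 (t l - d l j) = 0" if "l \<in> H" "l \<noteq> i" for l
      proof -
        have "l \<in> P" using that HF by auto
        from d_triangle[OF iP P(1) this] have "d i l \<le> d i j + d l j" using d_commute[of j l] by simp
        with sep[OF i(1) that(1)] that(2) i(2) show ?thesis by (auto simp: max_def split: if_splits)
      qed
      have "(\<Sum>i'\<in>H. max 0 (t i' - d i' j)) = (\<Sum>i'\<in>{i}. max 0 (t i' - d i' j))"
        using i(1) fH uniq by (intro sum.mono_neutral_right) auto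
      then have "d i j + (\<Sum>i'\<in>H. max 0 (t i' - d i' j)) = t i" using i(2) by simp
      moreover have "t i \<le> 3 * share S j"
      proof (cases "i = k'")
        case True
        then show ?thesis using k'(3) k(2) t0[OF k(1)] by (auto simp: max_def split: if_splits)
      next
        case False
        have "d i k' \<le> d i j + d j k'" by (rule d_triangle[OF iP P(1,3)])
        with sep[OF i(1) k'(1) False] i(2) kj d_commute[of j k'] show ?thesis
          by (auto simp: max_def split: if_splits)
      qed
      ultimately show ?thesis using i(1) by (intro bexI[of _ i]) linarith
    qed
  qed
  then obtain \<sigma> where \<sigma>: "\<And>j. j \<in> S \<Longrightarrow> \<sigma> j \<in> H"
    "\<And>j. j \<in> S \<Longrightarrow> d (\<sigma> j) j + (\<Sum>i'\<in>H. max 0 (t i' - d i' j)) \<le> 3 * share S j"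
    by metis
  define z where "z = (\<lambda>i. if i \<in> H \<and> x i \<noteq> 1 then 1 else 0 :: real)"
  define w where "w = (\<lambda>i j. if i = \<sigma> j then 1 else 0 :: real)"
  have AS: "finite A" using assms finite_subset by blast
  have "second_stage_feasible I x A z w"
    unfolding second_stage_feasible_def
  proof (intro conjI ballI)
    fix j assume "j \<in> A"
    then have \<sigma>j: "\<sigma> j \<in> H" using \<sigma>(1) assms(4) by auto
    then have "(\<Sum>i\<in>Fac. w i j) = 1" using HF by (auto simp: w_def sum.delta)
    then show "1 \<le> (\<Sum>i\<in>Fac. w i j)" by simp
    fix i assume i: "i \<in> Fac"
    show "w i j \<le> x i + z i" using \<sigma>j x_cases[OF i] by (auto simp: w_def z_def)
    show "0 \<le> w i j" by (simp add: w_def)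
  qed (auto simp: z_def)
  then have "g A \<le> second_stage_cost I A z w" by (rule g_le_cost)
  also have "\<dots> = (\<Sum>i\<in>H. f i) + (\<Sum>j\<in>A. d (\<sigma> j) j)"
  proof -
    have "(\<Sum>i\<in>Fac. real_of_rat (cost_II I i) * z i) = (\<Sum>i\<in>H. real_of_rat (cost_II I i) * z i)"
      using HF by (intro sum.mono_neutral_right) (auto simp: z_def)
    also have "\<dots> = (\<Sum>i\<in>H. f i)" by (intro sum.cong) (auto simp: z_def f_def)
    finally have 1: "(\<Sum>i\<in>Fac. real_of_rat (cost_II I i) * z i) = (\<Sum>i\<in>H. f i)" .
    have "(\<Sum>i\<in>Fac. real_of_rat (fl_dist I i j) * w i j) = d (\<sigma> j) j" if "j \<in> A" for j
    proof -
      have "(\<Sum>i\<in>Fac. real_of_rat (fl_dist I i j) * w i j) = (\<Sum>i\<in>Fac. if i = \<sigma> j then d i j else 0)"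
        by (intro sum.cong) (auto simp: w_def d_def)
      also have "\<dots> = d (\<sigma> j) j" using \<sigma>(1) that assms(4) HF by (subst sum.delta) auto
      finally show ?thesis .
    qed
    with 1 show ?thesis by (simp add: second_stage_cost_def)
  qed
  also have "\<dots> \<le> (\<Sum>i\<in>H. f i) + (\<Sum>j\<in>S. d (\<sigma> j) j)"
    using assms by (intro add_left_mono sum_mono2) auto
  \<comment> \<open>The cost of a facility is what all of \<open>S\<close> offers at its opening
    time; this is why the shares of all of \<open>S\<close> are needed even if only \<open>A\<close>
    is served.\<close>
  also have "(\<Sum>i\<in>H. f i) = (\<Sum>i\<in>H. \<Sum>j\<in>S. max 0 (t i - d i j))"
    using paid_open_time[OF assms(1,2)] HF by (intro sum.cong) (auto simp: paid_def t_def)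
  also have "\<dots> = (\<Sum>j\<in>S. \<Sum>i\<in>H. max 0 (t i - d i j))" by (rule sum.swap)
  also have "\<dots> + (\<Sum>j\<in>S. d (\<sigma> j) j) = (\<Sum>j\<in>S. d (\<sigma> j) j + (\<Sum>i\<in>H. max 0 (t i - d i j)))"
    by (simp add: sum.distrib)
  also have "\<dots> \<le> (\<Sum>j\<in>S. 3 * share S j)" by (intro sum_mono \<sigma>(2))
  finally show ?thesis by (simp add: sum_distrib_left)
qed

lemma g_empty: "g {} = 0"
proof (rule antisym)
  have "second_stage_feasible I x {} (\<lambda>_. 0) (\<lambda>_ _. 0)" by (simp add: second_stage_feasible_def)
  from g_le_cost[OF this] show "g {} \<le> 0" by (simp add: second_stage_cost_def)
  show "0 \<le> g {}" using weak_duality[of "{}" "\<lambda>_. 0"] f_nonneg by simp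
qed

lemma g_nonneg: "finite A \<Longrightarrow> 0 \<le> g A"
  using sum_share_le[of A] share_nonneg sum_nonneg[of A "share A"] by fastforce

text \<open>The invariant of the greedy choice of \<open>B \<subseteq> C\<close>; \<open>a\<close> is the share of the client chosen last.\<close>

definition greedy_inv :: "nat set \<Rightarrow> nat set \<Rightarrow> real \<Rightarrow> bool" where
  "greedy_inv C B a \<longleftrightarrow> B \<subseteq> C \<and> (B \<noteq> {} \<longrightarrow> 0 \<le> a \<and>
     (\<forall>i\<in>Fac. paid B i a \<le> f i) \<and> (\<forall>j\<in>C - B. share (insert j B) j \<le> a))"

text \<open>If \<open>j\<close> offers nothing to \<open>i\<close> at the new share, only
  \<open>B\<close> pays, and no more than before since the new share is at most the old
  \<open>a\<close>. If \<open>j\<close> does offer something, the new share cannot exceed the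
  opening time of \<open>i\<close>, because a share is at most the larger of opening time and
  distance.\<close>

lemma greedy_inv_insert:
  assumes inv: "greedy_inv C B a" and "finite C" "j \<in> C - B"
    and max: "\<And>l. l \<in> C - B \<Longrightarrow> share (insert l B) l \<le> share (insert j B) j"
  shows "greedy_inv C (insert j B) (share (insert j B) j)"
  unfolding greedy_inv_def
proof (intro conjI impI ballI)
  let ?B = "insert j B" and ?a = "share (insert j B) j"
  have fB: "finite B" using assms by (auto simp: greedy_inv_def intro: finite_subset)
  show "?B \<subseteq> C" using assms by (auto simp: greedy_inv_def)
  show "0 \<le> ?a" by (rule share_nonneg)
  fix i assume i: "i \<in> Fac"
  show "paid ?B i ?a \<le> f i"
  proof (cases "?a \<le> d i j")
    case True
    have "paid ?B i ?a = paid B i ?a" using True fB assms(3) by (simp add: paid_def max_absorb1)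
    also have "\<dots> \<le> f i"
    proof (cases "B = {}")
      case False
      then have "paid B i ?a \<le> paid B i a" using inv assms(3) by (intro paid_mono_time) (auto simp: greedy_inv_def)
      also have "\<dots> \<le> f i" using inv False i by (auto simp: greedy_inv_def)
      finally show ?thesis .
    qed (use f_nonneg[OF i] in \<open>simp add: paid_def\<close>)
    finally show ?thesis .
  next
    case False
    then have "?a \<le> open_time ?B i" using share_le[OF i, of ?B j] by (auto simp: max_def split: if_splits)
    then show ?thesis using le_open_time_iff[of ?B i] fB i by simp
  qed
next
  let ?B = "insert j B"
  have fB: "finite B" using assms by (auto simp: greedy_inv_def intro: finite_subset)
  fix l assume l: "l \<in> C - ?B"
  have "share (insert l ?B) l \<le> share (insert l B) l" using fB by (intro share_antimono) auto
  also have "\<dots> \<le> share ?B j" using l by (intro max) auto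
  finally show "share (insert l ?B) l \<le> share ?B j" .
qed

definition estimate :: "nat set \<Rightarrow> real \<Rightarrow> real" where
  "estimate B a = (\<Sum>j\<in>B. share B j + a)"

lemma estimate_le:
  assumes "greedy_inv C B a" "finite C"
  shows "estimate B a \<le> 2 * g B"
proof (cases "B = {}")
  case False
  have fB: "finite B" using assms by (auto simp: greedy_inv_def intro: finite_subset)
  have "(\<Sum>j\<in>B. a) \<le> g B"
    using assms(1) False by (intro weak_duality[OF fB]) (auto simp: greedy_inv_def paid_def)
  then show ?thesis using sum_share_le[OF fB] by (simp add: estimate_def sum.distrib)
qed (simp add: estimate_def g_empty)

text \<open>Passing from \<open>B\<close> to the union with \<open>A\<close> lowers all shares. A
  client of \<open>A - B\<close> already had share at most \<open>a\<close> when joined to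
  \<open>B\<close> alone, since the greedy choice passed it over, and there are at most as many such
  clients as elements of \<open>B\<close>.\<close>

lemma le_estimate:
  assumes inv: "greedy_inv C B a" and C: "C \<subseteq> clients I" and B: "card B = min k (card C)"
    and A: "A \<subseteq> C" "card A \<le> k"
  shows "g A \<le> 3 * estimate B a"
proof (cases "A = {}")
  case True
  have "0 \<le> estimate B a"
    using inv share_nonneg by (cases "B = {}") (auto simp: estimate_def greedy_inv_def intro!: sum_nonneg)
  then show ?thesis using True by (simp add: g_empty)
next
  case False
  have fC: "finite C" using C finite_clients by (rule finite_subset)
  then have fA: "finite A" using A(1) finite_subset by blast
  have BC: "B \<subseteq> C" using inv by (simp add: greedy_inv_def)
  then have fB: "finite B" using fC finite_subset by blast
  have "0 < card A" using False fA by (simp add: card_gt_0_iff)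
  moreover have "card A \<le> card C" by (rule card_mono[OF fC A(1)])
  ultimately have "0 < card B" using B A by auto
  then have B0: "B \<noteq> {}" by auto
  have a: "0 \<le> a" "\<And>j. j \<in> C - B \<Longrightarrow> share (insert j B) j \<le> a"
    using inv B0 by (auto simp: greedy_inv_def)
  \<comment> \<open>Either \<open>B\<close> has the full size \<open>k\<close>, which bounds the
    size of \<open>A\<close>, or the greedy choice ran out of clients and \<open>A - B\<close> is
    empty.\<close>
  have AB: "card (A - B) \<le> card B"
  proof (cases "card B = k")
    case True
    then show ?thesis using A(2) card_mono[OF fA, of "A - B"] by force
  next
    case False
    then have "card B = card C" using B by auto
    then have "B = C" using BC fC by (simp add: card_subset_eq)
    then have "A - B = {}" using A(1) by auto
    then show ?thesis by (simp only: card.empty)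
  qed
  let ?S = "B \<union> A"
  have "g A \<le> 3 * (\<Sum>j\<in>?S. share ?S j)"
    using fB fA B0 BC A(1) C by (intro g_le_sum_share) auto
  also have "(\<Sum>j\<in>?S. share ?S j) = (\<Sum>j\<in>B. share ?S j) + (\<Sum>j\<in>A - B. share ?S j)"
    using fA fB by (subst sum.union_disjoint[symmetric]) (auto simp: Un_Diff_cancel)
  also have "(\<Sum>j\<in>B. share ?S j) \<le> (\<Sum>j\<in>B. share B j)"
    using fA fB B0 by (intro sum_mono share_antimono) auto
  also have "(\<Sum>j\<in>A - B. share ?S j) \<le> (\<Sum>j\<in>A - B. a)"
  proof (rule sum_mono)
    fix j assume j: "j \<in> A - B"
    have "share ?S j \<le> share (insert j B) j" using j fA fB by (intro share_antimono) auto
    also have "\<dots> \<le> a" using j A(1) by (intro a) auto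
    finally show "share ?S j \<le> a" .
  qed
  also have "(\<Sum>j\<in>A - B. a) \<le> (\<Sum>j\<in>B. a)" using AB a(1) by (simp add: mult_right_mono)
  finally show ?thesis by (simp add: estimate_def sum.distrib)
qed

end


section \<open>The algorithm\<close>

lemma concat_map_upt_nth:
  assumes "\<And>v. v < n \<Longrightarrow> length (h v) = w" "v < n" "i < w"
  shows "concat (map h [0..<n]) ! (w * v + i) = h v ! i"
    and "length (concat (map h [0..<n])) = w * n"
proof -
  have len: "length (concat (map h [0..<m])) = w * m" if "m \<le> n" for m
    using that assms(1) by (induction m) auto
  then show "length (concat (map h [0..<n])) = w * n" by simp
  have "concat (map h [0..<m]) ! (w * v + i) = h v ! i" if "m \<le> n" "v < m" for m
    using that
  proof (induction m)
    case (Suc m)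
    have lm: "length (concat (map h [0..<m])) = w * m" using Suc.prems by (intro len) simp
    show ?case
    proof (cases "v = m")
      case True
      then show ?thesis using lm by (simp add: nth_append)
    next
      case False
      then have vm: "v < m" using Suc.prems by simp
      have "w * v + i < w * Suc v" using assms(3) by simp
      also have "\<dots> \<le> w * m" using vm by (intro mult_le_mono2) simp
      finally show ?thesis using Suc vm lm by (simp add: nth_append)
    qed
  qed simp
  then show "concat (map h [0..<n]) ! (w * v + i) = h v ! i" using assms(2) by simp
qed

lemma fold_upt_cong:
  "(\<And>v x. v < m \<Longrightarrow> h v x = h' v x) \<Longrightarrow> fold h [0..<m] a = fold h' [0..<m] a"
  by (intro fold_cong) auto

lemma Collect_less_Suc: "{v. v < Suc m \<and> Q v} = (if Q m then insert m {v. v < m \<and> Q v} else {v. v < m \<and> Q v})"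
  by (auto simp: less_Suc_eq)

lemma fold_sum:
  "fold (\<lambda>v x. if Q v then x + h v else x) [0..<m] (0::int) = (\<Sum>v | v < m \<and> Q v. h v)"
  by (induction m) (auto simp: Collect_less_Suc)

lemma fold_prod: "fold (\<lambda>v x. h v * x) [0..<m] (a::int) = (\<Prod>v<m. h v) * a"
  by (induction m) (auto simp: algebra_simps)

text \<open>-1 stands for a minimum over nothing so far, which is unambiguous because all values are
  nonnegative; the test \<open>0 < x + 1\<close> asks whether some value has been seen.\<close>

lemma fold_min:
  assumes "\<And>v. v < m \<Longrightarrow> Q v \<Longrightarrow> 0 \<le> h v"
  shows "fold (\<lambda>v x. if Q v then if 0 < x + 1 then if 0 < x - h v then h v else x else h v else x) [0..<m] (-1::int)
    = (if \<exists>v<m. Q v then Min (h ` {v. v < m \<and> Q v}) else -1)"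
  using assms
proof (induction m)
  case (Suc m)
  let ?S = "{v. v < m \<and> Q v}"
  show ?case
  proof (cases "\<exists>v<m. Q v")
    case True
    then have ne: "?S \<noteq> {}" by auto
    define M where "M = Min (h ` ?S)"
    have "0 \<le> M" unfolding M_def using Suc.prems ne by (subst Min_ge_iff) auto
    moreover have "Min (h ` {v. v < Suc m \<and> Q v}) = (if Q m then min (h m) M else M)"
      unfolding Collect_less_Suc M_def using ne by simp
    moreover have "\<exists>v<Suc m. Q v" using True less_SucI by blast
    moreover have "fold (\<lambda>v x. if Q v then if 0 < x + 1 then if 0 < x - h v then h v else x else h v else x)
        [0..<m] (-1) = M"
      unfolding M_def using Suc True by simp
    ultimately show ?thesis by (simp add: min_def)
  next
    case False
    then have "{v. v < Suc m \<and> Q v} = (if Q m then {m} else {})" "(\<exists>v<Suc m. Q v) \<longleftrightarrow> Q m"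
      by (auto simp: less_Suc_eq)
    then show ?thesis using Suc False by simp
  qed
qed simp

text \<open>The accumulator is an index, with -1 for none; ties keep the earlier index, and
  \<open>h\<close> is consulted at the accumulator only when that is a genuine index.\<close>

lemma fold_argmax:
  fixes h :: "nat \<Rightarrow> int" and Q :: "nat \<Rightarrow> bool"
  defines "F \<equiv> \<lambda>m. fold (\<lambda>v x. if Q v then if 0 < x + 1 then if 0 < h v - h (nat x) then int v else x else int v else x)
    [0..<m] (-1)"
  shows "(F m = -1 \<and> (\<forall>v<m. \<not> Q v)) \<or> (\<exists>l<m. F m = int l \<and> Q l \<and> (\<forall>v<m. Q v \<longrightarrow> h v \<le> h l))"
proof (induction m)
  case 0
  then show ?case by (simp add: F_def)
next
  case (Suc m)
  have F: "F (Suc m) = (if Q m then if 0 < F m + 1 then if 0 < h m - h (nat (F m)) then int m else F m else int m else F m)"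
    by (simp add: F_def)
  show ?case
    using Suc
  proof
    assume "F m = -1 \<and> (\<forall>v<m. \<not> Q v)"
    then show ?thesis unfolding F by (auto simp: less_Suc_eq)
  next
    assume "\<exists>l<m. F m = int l \<and> Q l \<and> (\<forall>v<m. Q v \<longrightarrow> h v \<le> h l)"
    then obtain l where l: "l < m" "F m = int l" "Q l" "\<forall>v<m. Q v \<longrightarrow> h v \<le> h l" by blast
    show ?thesis
    proof (cases "Q m \<and> h l < h m")
      case True
      then have "F (Suc m) = int m" using l(2) unfolding F by simp
      then show ?thesis using True l(4) by (intro disjI2 exI[of _ m]) (auto simp: less_Suc_eq)
    next
      case False
      then have "F (Suc m) = int l" using l(2) unfolding F by auto
      then show ?thesis using False l by (intro disjI2 exI[of _ l]) (auto simp: less_Suc_eq)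
    qed
  qed
qed

lemma of_int_Min_scaled:
  fixes h :: "'b \<Rightarrow> int" and r :: "'b \<Rightarrow> real"
  assumes "finite S" "S \<noteq> {}" "0 < c" "\<And>v. v \<in> S \<Longrightarrow> of_int (h v) = c * r v"
  shows "of_int (Min (h ` S)) = c * Min (r ` S)"
proof -
  have "Min (h ` S) \<in> h ` S" using assms by (intro Min_in) auto
  then obtain v where v: "v \<in> S" "Min (h ` S) = h v" by auto
  have "Min (r ` S) = r v"
  proof (rule Min_eqI)
    fix z assume "z \<in> r ` S"
    then obtain u where u: "u \<in> S" "z = r u" by auto
    have "h v \<le> h u" unfolding v(2)[symmetric] using u assms(1) by simp
    then have "real_of_int (h v) \<le> real_of_int (h u)" by simp
    then have "c * r v \<le> c * r u" using assms(4) u v by metis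
    then show "r v \<le> z" using assms(3) u(2) by simp
  qed (use v assms in auto)
  then show ?thesis using assms(4) v by simp
qed

section \<open>Expressions of the algorithm\<close>

definition sumE :: "nat \<Rightarrow> rexp \<Rightarrow> rexp \<Rightarrow> rexp" where
  "sumE d c b = RFold (RC 0) (RIf c (RAdd (RV d) b) (RV d))"

definition minE :: "nat \<Rightarrow> rexp \<Rightarrow> rexp \<Rightarrow> rexp" where
  "minE d c b = RFold (RC (-1))
     (RIf c (RIf (RAdd (RV d) (RC 1)) (RIf (RSub (RV d) b) b (RV d)) b) (RV d))"

definition andE :: "rexp \<Rightarrow> rexp \<Rightarrow> rexp" where
  "andE e1 e2 = RIf e1 e2 (RC 0)"

definition leE :: "rexp \<Rightarrow> rexp \<Rightarrow> rexp" where
  "leE e1 e2 = RAdd (RSub e2 e1) (RC 1)"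

definition twiceE :: "rexp \<Rightarrow> rexp" where
  "twiceE e = RAdd e e"

text \<open>The encoding has a header of 4 entries followed by a record of 8 entries for each point;
  doubling three times multiplies by 8 without \<open>RMul\<close>.\<close>

definition recordE :: "int \<Rightarrow> rexp \<Rightarrow> rexp" where
  "recordE c v = RAdd (RC (4 + c)) (twiceE (twiceE (twiceE v)))"

text \<open>The table of distances starts where a record of the nonexistent point n would start and
  is stored by rows, two entries for each distance. \<open>RMul (RC 0) u\<close> is n * u, since n
  is input entry 0.\<close>

definition pairE :: "int \<Rightarrow> rexp \<Rightarrow> rexp \<Rightarrow> rexp" where
  "pairE c u v = RAdd (recordE c (RG 0 (RC 0))) (twiceE (RAdd (RMul (RC 0) u) v))"

definition fieldE :: "int \<Rightarrow> rexp \<Rightarrow> rexp" where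
  "fieldE c v = RG 0 (recordE c v)"

abbreviation cellE :: "nat \<Rightarrow> rexp" where
  "cellE a \<equiv> RG a (RC 0)"

text \<open>The numerator is an input entry and so an admissible factor. The common denominator is
  divided first, exactly, by the denominator of the distance.\<close>

definition distE :: "rexp \<Rightarrow> rexp \<Rightarrow> rexp" where
  "distE u v = RMul (pairE 0 u v) (RDiv (cellE 2) (RG 0 (pairE 1 u v)))"

definition costE :: "rexp \<Rightarrow> rexp" where
  "costE i = RIf (fieldE 2 i) (RC 0) (RMul (recordE 6 i) (RDiv (cellE 2) (fieldE 7 i)))"

text \<open>Shares are needed only for sets of the form \<open>insert j B\<close>. Treating
  \<open>j\<close> as a member avoids storing that set; for a client already in \<open>B\<close> the
  set is \<open>B\<close> itself.\<close>

definition memE :: "rexp \<Rightarrow> rexp \<Rightarrow> rexp" where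
  "memE j v = RIf (RG 7 v) (RC 1) (andE (leE v j) (leE j v))"

definition open_timeE :: "nat \<Rightarrow> rexp \<Rightarrow> rexp \<Rightarrow> rexp" where
  "open_timeE d j i = minE d (memE j (RV (d + 1)))
     (let c = andE (memE j (RV (d + 3))) (leE (distE i (RV (d + 3))) (distE i (RV (d + 1))))
      in RDiv (RAdd (costE i) (sumE (d + 2) c (distE i (RV (d + 3))))) (sumE (d + 2) c (RC 1)))"

definition shareE :: "nat \<Rightarrow> rexp \<Rightarrow> rexp" where
  "shareE d j = minE d (fieldE 0 (RV (d + 1)))
     (let t = open_timeE (d + 2) j (RV (d + 1)); e = distE (RV (d + 1)) j
      in RIf (RSub t e) t e)"

text \<open>Only input entries are admissible as factors, so the factor u + 1 of the factorial is
  realised by adding the accumulator once for each v \<le> u. The denominators are input entries and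
  are multiplied in directly.\<close>

definition scaleE :: rexp where
  "scaleE =
     RFold (RFold
       (RFold (RC 1) (RFold (RC 0) (RIf (RAdd (RSub (RV 1) (RV 3)) (RC 1)) (RAdd (RV 2) (RV 0)) (RV 2))))
       (RMul (recordE 7 (RV 1)) (RV 0)))
       (RFold (RV 0) (RMul (pairE 1 (RV 1) (RV 3)) (RV 2)))"

text \<open>Stopping at \<open>k\<close> chosen clients is part of the test, so the greedy loop can
  run a fixed number of rounds. A negative level excludes a point for every level bound.\<close>

definition candidateE :: "(nat \<Rightarrow> rexp \<Rightarrow> rexp) \<Rightarrow> rexp" where
  "candidateE lev = andE (RSub (RC 1) (RG 7 (RV 1))) (andE (leE (RC 0) (lev 2 (RV 1)))
     (andE (leE (lev 2 (RV 1)) (cellE 6)) (RSub (RG 0 (RC 1)) (sumE 2 (RG 7 (RV 3)) (RC 1)))))"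

definition argmaxE :: "(nat \<Rightarrow> rexp \<Rightarrow> rexp) \<Rightarrow> rexp" where
  "argmaxE lev = RFold (RC (-1)) (RIf (candidateE lev)
     (RIf (RAdd (RV 0) (RC 1)) (RIf (RSub (shareE 2 (RV 1)) (shareE 2 (RV 0))) (RV 1) (RV 0)) (RV 1))
     (RV 0))"

text \<open>Arrays: 1 output, 2 common denominator, 4 value of the output, 6 level bound, 7 greedy set,
  9 client chosen next (or \<open>-1\<close>), 10 share of the client chosen last, 11 value of the greedy set;
  3, 5 and 8 are loop counters.\<close>

definition greedy_prog :: "(nat \<Rightarrow> rexp \<Rightarrow> rexp) \<Rightarrow> hprog" where
  "greedy_prog lev = HFor 8 (HSeq (HPut 9 (RC 0) (argmaxE lev))
     (HSeq (HPut 10 (RC 0) (RIf (leE (RC 0) (cellE 9)) (shareE 0 (cellE 9)) (cellE 10)))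
       (HPut 7 (cellE 9) (RIf (leE (RC 0) (cellE 9)) (RC 1) (RG 7 (RC 0))))))"

text \<open>For y = p / q and level bound R, cell 11 receives q * scale * estimate - 2 p R, which is
  2 q * scale times the certified value estimate / 2 - y R / scale. The common positive factor makes
  values of different levels comparable as integers; p and q are input entries 2 and 3.\<close>

definition level_prog :: "(nat \<Rightarrow> rexp \<Rightarrow> rexp) \<Rightarrow> hprog" where
  "level_prog lev =
     HSeq (HPut 6 (RC 0) (RIf (leE (RC 0) (lev 0 (cellE 5))) (lev 0 (cellE 5)) (RC 0)))
     (HSeq (HFor 3 (HPut 7 (cellE 3) (RC 0)))
     (HSeq (greedy_prog lev)
     (HSeq (HPut 11 (RC 0) (RSub (RMul (RC 3) (sumE 0 (RG 7 (RV 1)) (RAdd (shareE 2 (RV 1)) (cellE 10))))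
       (twiceE (RMul (RC 2) (cellE 6)))))
     (HSeq (HFor 3 (HPut 1 (cellE 3) (RIf (RSub (cellE 11) (cellE 4)) (RG 7 (cellE 3)) (RG 1 (cellE 3)))))
       (HPut 4 (RC 0) (RIf (RSub (cellE 11) (cellE 4)) (cellE 11) (cellE 4)))))))"

text \<open>The output starts as \<open>A\<close> and its value as 0, which is a valid lower bound
  because the penalty of \<open>A\<close> is 0. Each point in turn then proposes its own level as
  bound, so every level that occurs is tried.\<close>

definition scenario_prog :: "(nat \<Rightarrow> rexp \<Rightarrow> rexp) \<Rightarrow> hprog" where
  "scenario_prog lev = HSeq (HPut 2 (RC 0) scaleE)
     (HSeq (HFor 3 (HPut 1 (cellE 3) (fieldE 3 (cellE 3)))) (HFor 5 (level_prog lev)))"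

text \<open>Levels are distances times the common denominator, so distance 1 appears as the content
  of cell 2; -1 excludes points that are not clients.\<close>

definition discrete_levelE :: "nat \<Rightarrow> rexp \<Rightarrow> rexp" where
  "discrete_levelE d v = RIf (fieldE 1 v) (RIf (fieldE 3 v) (RC 0) (cellE 2)) (RC (-1))"

text \<open>The minimum is -1 exactly when \<open>A\<close> is empty, and then every nonempty
  scenario is at infinite distance. For y > 0 all clients are excluded; for y = 0 the penalty is 0
  and so is the level. The sign of \<open>y\<close> is that of its numerator, input entry 2.\<close>

definition asym_levelE :: "nat \<Rightarrow> rexp \<Rightarrow> rexp" where
  "asym_levelE d v = RIf (fieldE 1 v)
     (let m = minE d (fieldE 3 (RV (d + 1))) (distE v (RV (d + 1)))
      in RIf (leE (RC 0) m) m (RIf (RG 0 (RC 2)) (RC (-1)) (RC 0)))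
     (RC (-1))"

lemmas exp_defs = sumE_def minE_def andE_def leE_def twiceE_def recordE_def pairE_def fieldE_def
  distE_def costE_def memE_def open_timeE_def shareE_def Let_def

lemma wf_scenario_prog:
  assumes "\<And>d v. wf_rexp d v \<Longrightarrow> wf_rexp d (lev d v)"
  shows "wf_hprog (scenario_prog lev)"
  using assms[of 2 "RV 1"] assms[of 0 "cellE 5"]
  by (simp add: scenario_prog_def level_prog_def greedy_prog_def argmaxE_def candidateE_def scaleE_def
      exp_defs visible_def numeral_2_eq_2)

lemma wf_rexp_mono: "wf_rexp d e \<Longrightarrow> d \<le> d' \<Longrightarrow> wf_rexp d' e"
proof (induction e arbitrary: d d')
  case (RFold e1 e2)
  then show ?case using RFold.IH(2)[of "d + 2" "d' + 2"] by auto
qed auto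

lemma wf_discrete_levelE: "wf_rexp d v \<Longrightarrow> wf_rexp d (discrete_levelE d v)"
  by (simp add: discrete_levelE_def exp_defs visible_def)

lemma wf_asym_levelE: "wf_rexp d v \<Longrightarrow> wf_rexp d (asym_levelE d v)"
  using wf_rexp_mono[of d v "Suc (Suc d)"] by (simp add: asym_levelE_def exp_defs visible_def)

section \<open>Evaluation of folds and tests\<close>

lemma reval_RFold:
  assumes "\<And>v a. v < nat (s 0 0) \<Longrightarrow> reval b (d + 2) (\<rho>(d := a, d + 1 := int v)) s = h v a"
    and "reval e d \<rho> s = z"
  shows "reval (RFold e b) d \<rho> s = fold h [0..<nat (s 0 0)] z"
  unfolding reval.simps(9) assms(2) by (rule fold_upt_cong) (rule assms(1))

lemma reval_sumE:
  assumes "\<And>v a. v < nat (s 0 0) \<Longrightarrow> 0 < reval c (d + 2) (\<rho>(d := a, d + 1 := int v)) s \<longleftrightarrow> Q v"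
    and "\<And>v a. v < nat (s 0 0) \<Longrightarrow> Q v \<Longrightarrow> reval b (d + 2) (\<rho>(d := a, d + 1 := int v)) s = h v"
  shows "reval (sumE d c b) d \<rho> s = (\<Sum>v | v < nat (s 0 0) \<and> Q v. h v)"
proof -
  have "reval (sumE d c b) d \<rho> s = fold (\<lambda>v x. if Q v then x + h v else x) [0..<nat (s 0 0)] 0"
    unfolding sumE_def reval.simps(1,9) by (rule fold_upt_cong) (use assms in simp)
  then show ?thesis by (simp add: fold_sum)
qed

lemma reval_minE:
  assumes "\<And>v a. v < nat (s 0 0) \<Longrightarrow> 0 < reval c (d + 2) (\<rho>(d := a, d + 1 := int v)) s \<longleftrightarrow> Q v"
    and "\<And>v a. v < nat (s 0 0) \<Longrightarrow> Q v \<Longrightarrow> reval b (d + 2) (\<rho>(d := a, d + 1 := int v)) s = h v"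
    and "\<And>v. v < nat (s 0 0) \<Longrightarrow> Q v \<Longrightarrow> 0 \<le> h v"
  shows "reval (minE d c b) d \<rho> s =
    (if \<exists>v<nat (s 0 0). Q v then Min (h ` {v. v < nat (s 0 0) \<and> Q v}) else -1)"
proof -
  have "reval (minE d c b) d \<rho> s =
      fold (\<lambda>v x. if Q v then if 0 < x + 1 then if 0 < x - h v then h v else x else h v else x) [0..<nat (s 0 0)] (-1)"
    unfolding minE_def reval.simps(1,9) by (rule fold_upt_cong) (use assms in simp)
  also have "\<dots> = (if \<exists>v<nat (s 0 0). Q v then Min (h ` {v. v < nat (s 0 0) \<and> Q v}) else -1)"
    by (rule fold_min) (rule assms(3))
  finally show ?thesis .
qed

text \<open>The value of \<open>e\<close> is \<open>a\<close>, also below further binders.\<close>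

definition steady :: "rexp \<Rightarrow> nat \<Rightarrow> (nat \<Rightarrow> int) \<Rightarrow> store \<Rightarrow> int \<Rightarrow> bool" where
  "steady e d \<rho> s a \<longleftrightarrow> (\<forall>d' \<rho>'. (\<forall>k<d. \<rho>' k = \<rho> k) \<longrightarrow> reval e d' \<rho>' s = a)"

lemma steadyD: "steady e d \<rho> s a \<Longrightarrow> reval e d \<rho> s = a"
  by (simp add: steady_def)

lemma steady_weaken: "steady e d \<rho> s a \<Longrightarrow> steady e (d + 2) (\<rho>(d := u, d + 1 := v)) s a"
  by (simp add: steady_def)

lemma steady_RV: "k < d \<Longrightarrow> \<rho> k = a \<Longrightarrow> steady (RV k) d \<rho> s a"
  by (simp add: steady_def)

lemma steady_cellE: "steady (cellE b) d \<rho> s (s b 0)"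
  by (simp add: steady_def)

lemma reval_andE: "0 < reval (andE e1 e2) d \<rho> s \<longleftrightarrow> 0 < reval e1 d \<rho> s \<and> 0 < reval e2 d \<rho> s"
  by (simp add: andE_def)

lemma reval_leE: "0 < reval (leE e1 e2) d \<rho> s \<longleftrightarrow> reval e1 d \<rho> s \<le> reval e2 d \<rho> s"
  by (auto simp: leE_def)


section \<open>Evaluation on an encoded query\<close>

locale query = second_stage +
  fixes k :: nat and y :: rat and A :: "nat set"
  assumes y_nonneg: "0 \<le> y" and A_scenario: "A \<in> k_bounded_scenarios I k"
begin

section \<open>Layout of an encoded query\<close>

abbreviation "n \<equiv> npoints I"

definition code :: "int list" where
  "code = encode_query (I, k, x, y, A)"

definition inp :: "nat \<Rightarrow> int" where
  "inp = input_store code 0"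

definition point_code :: "nat \<Rightarrow> int list" where
  "point_code v = [of_bool (v \<in> Fac), of_bool (v \<in> clients I), of_bool (v \<in> Fac \<and> x v = 1), of_bool (v \<in> A)] @
     encode_rat (if v \<in> Fac then cost_I I v else 0) @ encode_rat (if v \<in> Fac then cost_II I v else 0)"

definition row_code :: "nat \<Rightarrow> int list" where
  "row_code u = concat (map (\<lambda>v. encode_rat (fl_dist I u v)) [0..<n])"

lemma n_pos: "0 < n"
proof -
  obtain i where "i \<in> Fac" using Fac_nonempty by blast
  then have "i \<in> {..<n}" using P_eq by blast
  then show ?thesis by simp
qed

lemma code_eq: "code = [int n, int k, fst (quotient_of y), snd (quotient_of y)] @
    concat (map point_code [0..<n]) @ concat (map row_code [0..<n])"
  unfolding code_def encode_query_def point_code_def row_code_def prod.case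
  by (simp only: encode_rat_def[of y] append.simps append_assoc)

lemma length_codes:
  "length (point_code v) = 8" "length (row_code u) = 2 * n"
  "length (concat (map point_code [0..<n])) = 8 * n" "length (concat (map row_code [0..<n])) = 2 * n * n"
proof -
  show 1: "length (point_code v) = 8" for v by (simp add: point_code_def encode_rat_def)
  show 2: "length (row_code u) = 2 * n" for u
    unfolding row_code_def by (rule concat_map_upt_nth(2)[where v = 0 and i = 0])
      (simp_all add: encode_rat_def n_pos)
  show "length (concat (map point_code [0..<n])) = 8 * n"
    by (rule concat_map_upt_nth(2)[where v = 0 and i = 0]) (simp_all add: 1 n_pos)
  show "length (concat (map row_code [0..<n])) = 2 * n * n"
    by (rule concat_map_upt_nth(2)[where v = 0 and i = 0]) (simp_all add: 2 n_pos)
qed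

lemma length_code: "length code = 4 + 8 * n + 2 * n * n"
  by (simp add: code_eq length_codes del: length_concat)

lemma inp_header: "inp 0 = int n" "inp 1 = int k" "inp 2 = fst (quotient_of y)" "inp 3 = snd (quotient_of y)"
  by (simp_all add: inp_def input_store_def code_eq)

lemma inp_record:
  assumes v: "v < n"
  shows "inp (4 + 8 * v) = of_bool (v \<in> Fac)" "inp (5 + 8 * v) = of_bool (v \<in> clients I)"
    "inp (6 + 8 * v) = of_bool (v \<in> Fac \<and> x v = 1)" "inp (7 + 8 * v) = of_bool (v \<in> A)"
    "inp (10 + 8 * v) = fst (quotient_of (if v \<in> Fac then cost_II I v else 0))"
    "inp (11 + 8 * v) = snd (quotient_of (if v \<in> Fac then cost_II I v else 0))"
proof -
  have "inp (i + 4 + 8 * v) = point_code v ! i" if "i < 8" for i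
  proof -
    have "8 * v + i < 8 * n" using v that by linarith
    then have "inp (4 + (8 * v + i)) = concat (map point_code [0..<n]) ! (8 * v + i)"
      by (simp add: inp_def input_store_def code_eq nth_append length_codes del: length_concat)
    also have "\<dots> = point_code v ! i"
      by (rule concat_map_upt_nth(1)[OF length_codes(1) v that])
    finally show ?thesis by (simp only: ac_simps)
  qed
  from this[of 0] this[of 1] this[of 2] this[of 3] this[of 6] this[of 7]
  show "inp (4 + 8 * v) = of_bool (v \<in> Fac)" "inp (5 + 8 * v) = of_bool (v \<in> clients I)"
    "inp (6 + 8 * v) = of_bool (v \<in> Fac \<and> x v = 1)" "inp (7 + 8 * v) = of_bool (v \<in> A)"
    "inp (10 + 8 * v) = fst (quotient_of (if v \<in> Fac then cost_II I v else 0))"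
    "inp (11 + 8 * v) = snd (quotient_of (if v \<in> Fac then cost_II I v else 0))"
    by (simp_all add: point_code_def encode_rat_def)
qed

lemma inp_dist:
  assumes uv: "u < n" "v < n"
  shows "inp (4 + 8 * n + 2 * (n * u + v)) = fst (quotient_of (fl_dist I u v))"
    "inp (5 + 8 * n + 2 * (n * u + v)) = snd (quotient_of (fl_dist I u v))"
proof -
  have "inp (4 + i + 8 * n + 2 * (n * u + v)) = encode_rat (fl_dist I u v) ! i" if "i < 2" for i
  proof -
    have vi: "2 * v + i < 2 * n" using uv that by linarith
    have "2 * n * u + (2 * v + i) < 2 * n * Suc u" using vi by (simp add: algebra_simps)
    also have "\<dots> \<le> 2 * n * n" using uv by (intro mult_le_mono2) simp
    finally have "inp (4 + (8 * n + (2 * n * u + (2 * v + i))))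
        = concat (map row_code [0..<n]) ! (2 * n * u + (2 * v + i))"
      by (simp add: inp_def input_store_def code_eq nth_append length_codes del: length_concat)
    also have "\<dots> = row_code u ! (2 * v + i)"
      by (rule concat_map_upt_nth(1)[OF length_codes(2) uv(1) vi])
    also have "\<dots> = encode_rat (fl_dist I u v) ! i"
      unfolding row_code_def by (rule concat_map_upt_nth(1)[OF _ uv(2) that]) (simp add: encode_rat_def)
    finally show ?thesis by (simp add: algebra_simps)
  qed
  from this[of 0] this[of 1]
  show "inp (4 + 8 * n + 2 * (n * u + v)) = fst (quotient_of (fl_dist I u v))"
    "inp (5 + 8 * n + 2 * (n * u + v)) = snd (quotient_of (fl_dist I u v))"
    by (simp_all add: encode_rat_def)
qed

section \<open>The common denominator and scaled data\<close>

definition scale :: int where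
  "scale = fact n * ((\<Prod>v<n. inp (11 + 8 * v)) * (\<Prod>u<n. \<Prod>v<n. inp (5 + 8 * n + 2 * (n * u + v))))"

lemma scale_pos: "0 < scale"
proof -
  have "0 < inp (11 + 8 * v)" if "v < n" for v
    unfolding inp_record(6)[OF that] by (rule quotient_of_denom_pos')
  moreover have "0 < inp (5 + 8 * n + 2 * (n * u + v))" if "u < n" "v < n" for u v
    unfolding inp_dist(2)[OF that] by (rule quotient_of_denom_pos')
  ultimately show ?thesis unfolding scale_def
    by (intro mult_pos_pos prod_pos ballI) (simp_all only: lessThan_iff fact_gt_zero)
qed

text \<open>The factorial survives the cancellation of any single denominator. Hence scaled
  distances and costs are not only integers but multiples of n!, as the divisions in
  \<open>zratio\<close> require.\<close>

lemma dvd_scale: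
  "v < n \<Longrightarrow> fact n * inp (11 + 8 * v) dvd scale"
  "u < n \<Longrightarrow> v < n \<Longrightarrow> fact n * inp (5 + 8 * n + 2 * (n * u + v)) dvd scale"
proof -
  show "fact n * inp (11 + 8 * v) dvd scale" if "v < n"
    unfolding scale_def using that by (intro mult_dvd_mono dvd_refl dvd_mult2 dvd_prodI) auto
  assume uv: "u < n" "v < n"
  have "inp (5 + 8 * n + 2 * (n * u + v)) dvd (\<Prod>v<n. inp (5 + 8 * n + 2 * (n * u + v)))"
    using uv by (intro dvd_prodI) auto
  also have "\<dots> dvd (\<Prod>u<n. \<Prod>v<n. inp (5 + 8 * n + 2 * (n * u + v)))"
    using uv by (intro dvd_prodI[where f = "\<lambda>u. \<Prod>v<n. inp (5 + 8 * n + 2 * (n * u + v))"]) auto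
  finally show "fact n * inp (5 + 8 * n + 2 * (n * u + v)) dvd scale"
    unfolding scale_def by (intro mult_dvd_mono dvd_refl dvd_mult)
qed

definition ready :: "store \<Rightarrow> bool" where
  "ready s \<longleftrightarrow> s 0 = inp \<and> s 2 0 = scale"

lemma nat_record: "nat (4 + int c + 8 * int v) = 4 + c + 8 * v"
  by linarith

lemma reval_recordE:
  "reval e dp \<rho> s = int v \<Longrightarrow> nat (reval (recordE (int c) e) dp \<rho> s) = 4 + c + 8 * v"
  by (simp add: recordE_def twiceE_def nat_record)

lemma reval_fieldE:
  assumes "s 0 = inp" "reval e dp \<rho> s = int v" "v < n"
  shows "reval (fieldE 0 e) dp \<rho> s = of_bool (v \<in> Fac)" "reval (fieldE 1 e) dp \<rho> s = of_bool (v \<in> clients I)"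
    "reval (fieldE 2 e) dp \<rho> s = of_bool (v \<in> Fac \<and> x v = 1)" "reval (fieldE 3 e) dp \<rho> s = of_bool (v \<in> A)"
  using reval_recordE[OF assms(2), of 0] reval_recordE[OF assms(2), of 1] reval_recordE[OF assms(2), of 2]
    reval_recordE[OF assms(2), of 3] inp_record[OF assms(3)] assms(1)
  by (simp_all add: fieldE_def)

lemma reval_pairE:
  assumes "s 0 = inp" "reval e1 dp \<rho> s = int u" "reval e2 dp \<rho> s = int v"
  shows "nat (reval (pairE (int c) e1 e2) dp \<rho> s) = 4 + c + 8 * n + 2 * (n * u + v)"
proof -
  have "reval (pairE (int c) e1 e2) dp \<rho> s = int (4 + c + 8 * n + 2 * (n * u + v))"
    using assms by (simp add: pairE_def recordE_def twiceE_def inp_header algebra_simps)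
  then show ?thesis by (metis nat_int)
qed

lemma scaled_rat:
  assumes "fact n * snd (quotient_of r) dvd scale"
  shows "real_of_int (fst (quotient_of r) * (scale div snd (quotient_of r))) = scale * real_of_rat r"
    "fact n dvd fst (quotient_of r) * (scale div snd (quotient_of r))"
proof -
  obtain p q where pq: "quotient_of r = (p, q)" by (cases "quotient_of r")
  have q: "0 < q" using quotient_of_denom_pos[OF pq] .
  from assms obtain m where m: "scale = fact n * q * m" unfolding pq by auto
  have div: "scale div q = fact n * m" unfolding m using q by simp
  show "fact n dvd fst (quotient_of r) * (scale div snd (quotient_of r))" by (simp add: pq div)
  have "real_of_rat r = real_of_int p / real_of_int q"
    using quotient_of_div[OF pq] by (simp add: of_rat_divide)
  then show "real_of_int (fst (quotient_of r) * (scale div snd (quotient_of r))) = scale * real_of_rat r"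
    using q by (simp add: pq div m)
qed

definition zdist :: "nat \<Rightarrow> nat \<Rightarrow> int" where
  "zdist u v = fst (quotient_of (fl_dist I u v)) * (scale div snd (quotient_of (fl_dist I u v)))"

definition zcost :: "nat \<Rightarrow> int" where
  "zcost i = (if x i = 1 then 0
     else fst (quotient_of (cost_II I i)) * (scale div snd (quotient_of (cost_II I i))))"

lemma zdist:
  assumes "u < n" "v < n"
  shows "real_of_int (zdist u v) = scale * d u v" "fact n dvd zdist u v" "0 \<le> zdist u v"
proof -
  have "fact n * snd (quotient_of (fl_dist I u v)) dvd scale"
    using dvd_scale(2)[OF assms] inp_dist(2)[OF assms] by simp
  from scaled_rat[OF this] show 1: "real_of_int (zdist u v) = scale * d u v" and "fact n dvd zdist u v"
    by (simp_all add: zdist_def d_def)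
  have "0 \<le> scale * d u v" using scale_pos by simp
  then show "0 \<le> zdist u v" unfolding 1[symmetric] by simp
qed

lemma zdist_le_iff: "u < n \<Longrightarrow> v < n \<Longrightarrow> w < n \<Longrightarrow> zdist u v \<le> zdist u w \<longleftrightarrow> d u v \<le> d u w"
  using zdist(1)[of u v] zdist(1)[of u w] scale_pos
  by (metis mult_le_cancel_left_pos of_int_0_less_iff of_int_le_iff)

lemma zcost:
  assumes "i \<in> Fac"
  shows "real_of_int (zcost i) = scale * f i" "fact n dvd zcost i"
proof -
  have i: "i < n" using assms P_eq by auto
  have "fact n * snd (quotient_of (cost_II I i)) dvd scale"
    using dvd_scale(1)[OF i] inp_record(6)[OF i] assms by simp
  from scaled_rat[OF this] show "real_of_int (zcost i) = scale * f i" "fact n dvd zcost i"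
    by (simp_all add: zcost_def f_def)
qed

lemma reval_distE:
  assumes "ready s" "reval e1 dp \<rho> s = int u" "reval e2 dp \<rho> s = int v" "u < n" "v < n"
  shows "reval (distE e1 e2) dp \<rho> s = zdist u v"
proof -
  have s: "s 0 = inp" "s 2 0 = scale" using assms(1) by (auto simp: ready_def)
  show ?thesis
    using reval_pairE[OF s(1) assms(2,3), of 0] reval_pairE[OF s(1) assms(2,3), of 1] s inp_dist[OF assms(4,5)]
    by (simp add: distE_def zdist_def)
qed

lemma reval_costE:
  assumes "ready s" "reval e dp \<rho> s = int i" "i \<in> Fac"
  shows "reval (costE e) dp \<rho> s = zcost i"
proof -
  have s: "s 0 = inp" "s 2 0 = scale" using assms(1) by (auto simp: ready_def)
  have i: "i < n" using assms(3) P_eq by auto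
  show ?thesis
    using reval_recordE[OF assms(2), of 6] reval_recordE[OF assms(2), of 7] s inp_record[OF i] assms(3)
      reval_fieldE(3)[OF s(1) assms(2) i]
    by (simp add: costE_def fieldE_def zcost_def)
qed

lemma reval_scaleE:
  assumes "s 0 = inp"
  shows "reval scaleE 0 \<rho> s = scale"
proof -
  have n: "nat (s 0 0) = n" by (simp add: assms inp_header)
  define factE where
    "factE = RFold (RC 0) (RIf (RAdd (RSub (RV 1) (RV 3)) (RC 1)) (RAdd (RV 2) (RV 0)) (RV 2))"
  define rowE where "rowE = RFold (RV 0) (RMul (pairE 1 (RV 1) (RV 3)) (RV 2))"
  have 1: "reval (RFold (RC 1) factE) 0 \<rho> s = fact n"
  proof -
    have "reval factE (0 + 2) (\<rho>(0 := a, 0 + 1 := int u)) s = int (Suc u) * a" if "u < n" for u a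
    proof -
      have "reval factE (0 + 2) (\<rho>(0 := a, 0 + 1 := int u)) s
          = fold (\<lambda>v x. if v \<le> u then x + a else x) [0..<nat (s 0 0)] 0"
        unfolding factE_def by (rule reval_RFold) auto
      also have "\<dots> = (\<Sum>v | v < n \<and> v \<le> u. a)" unfolding n by (rule fold_sum)
      also have "{v. v < n \<and> v \<le> u} = {..u}" using that by auto
      also have "(\<Sum>v\<le>u. a) = int (Suc u) * a" by simp
      finally show ?thesis .
    qed
    then have "reval (RFold (RC 1) factE) 0 \<rho> s = fold (\<lambda>v x. int (Suc v) * x) [0..<nat (s 0 0)] 1"
      by (intro reval_RFold) (simp_all only: n reval.simps)
    moreover have "fold (\<lambda>v x. int (Suc v) * x) [0..<m] 1 = fact m" for m
      by (induction m) auto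
    ultimately show ?thesis by (simp only: n)
  qed
  have 2: "reval (RFold (RFold (RC 1) factE) (RMul (recordE 7 (RV 1)) (RV 0))) 0 \<rho> s
      = (\<Prod>v<n. inp (11 + 8 * v)) * fact n"
  proof -
    have "reval (RMul (recordE 7 (RV 1)) (RV 0)) (0 + 2) (\<rho>(0 := a, 0 + 1 := int v)) s = inp (11 + 8 * v) * a" for a v
      using reval_recordE[of "RV 1" 2 "\<rho>(0 := a, 1 := int v)" s v 7] by (simp add: assms numeral_2_eq_2)
    then have "reval (RFold (RFold (RC 1) factE) (RMul (recordE 7 (RV 1)) (RV 0))) 0 \<rho> s
        = fold (\<lambda>v a. inp (11 + 8 * v) * a) [0..<nat (s 0 0)] (fact n)"
      by (intro reval_RFold 1)
    then show ?thesis by (simp only: fold_prod n)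
  qed
  have "reval rowE (0 + 2) (\<rho>(0 := a, 0 + 1 := int u)) s
      = (\<Prod>v<n. inp (5 + 8 * n + 2 * (n * u + v))) * a" for a u
  proof -
    have "reval (RMul (pairE 1 (RV 1) (RV 3)) (RV 2)) (0 + 2 + 2)
        ((\<rho>(0 := a, 0 + 1 := int u))(0 + 2 := b, 0 + 2 + 1 := int v)) s
        = inp (5 + 8 * n + 2 * (n * u + v)) * b" for b v
      using reval_pairE[of s "RV 1" "0 + 2 + 2" "(\<rho>(0 := a, 0 + 1 := int u))(0 + 2 := b, 0 + 2 + 1 := int v)" u "RV 3" v 1]
      by (simp add: assms)
    then have "reval rowE (0 + 2) (\<rho>(0 := a, 0 + 1 := int u)) s
        = fold (\<lambda>v b. inp (5 + 8 * n + 2 * (n * u + v)) * b) [0..<nat (s 0 0)] a"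
      unfolding rowE_def by (intro reval_RFold) simp_all
    then show ?thesis by (simp only: fold_prod n)
  qed
  then have "reval (RFold (RFold (RFold (RC 1) factE) (RMul (recordE 7 (RV 1)) (RV 0))) rowE) 0 \<rho> s
      = fold (\<lambda>u a. (\<Prod>v<n. inp (5 + 8 * n + 2 * (n * u + v))) * a) [0..<nat (s 0 0)]
          ((\<Prod>v<n. inp (11 + 8 * v)) * fact n)"
    by (intro reval_RFold 2)
  then show ?thesis
    unfolding scaleE_def factE_def[symmetric] rowE_def[symmetric] fold_prod n scale_def
    by (simp only: mult.commute mult.left_commute)
qed

section \<open>Evaluation of opening times and shares\<close>

definition chosen :: "store \<Rightarrow> nat set" where
  "chosen s = {v. s 7 v \<noteq> 0}"

definition chosen_ok :: "store \<Rightarrow> bool" where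
  "chosen_ok s \<longleftrightarrow> (\<forall>v. s 7 v = 0 \<or> s 7 v = 1) \<and> chosen s \<subseteq> {..<n}"

lemma reval_memE:
  assumes "chosen_ok s" "reval j dp \<rho> s = int a" "reval v dp \<rho> s = int b"
  shows "0 < reval (memE j v) dp \<rho> s \<longleftrightarrow> b \<in> insert a (chosen s)"
proof -
  have "s 7 b = 0 \<or> s 7 b = 1" using assms(1) by (simp add: chosen_ok_def)
  then show ?thesis using assms(2,3) unfolding memE_def by (auto simp: reval_andE reval_leE chosen_def)
qed

definition zratio :: "nat set \<Rightarrow> nat \<Rightarrow> nat \<Rightarrow> int" where
  "zratio S i l = (zcost i + (\<Sum>j\<in>closest S i l. zdist i j)) div int (card (closest S i l))"

text \<open>The integer division is exact: the divisor is the size of a nonempty set of points,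
  hence divides n!, which divides every summand of the numerator.\<close>

lemma zratio:
  assumes "S \<subseteq> {..<n}" "l \<in> S" "i \<in> Fac"
  shows "real_of_int (zratio S i l) = scale * ratio S i l" "0 \<le> zratio S i l"
proof -
  have i: "i < n" using assms P_eq by auto
  have fS: "finite S" using assms(1) by (rule finite_subset) simp
  let ?T = "closest S i l"
  have T: "j < n" if "j \<in> ?T" for j using that assms(1) by (auto simp: closest_def)
  have c: "0 < card ?T" by (rule card_closest_pos[OF fS assms(2)])
  have "?T \<subseteq> {..<n}" using T by auto
  from card_mono[OF _ this] have "card ?T \<le> n" by simp
  then have "card ?T dvd fact n" using c by (intro dvd_fact) auto
  then have "int (card ?T) dvd fact n" by (metis int_dvd_int_iff of_nat_fact)
  moreover have "fact n dvd zcost i + (\<Sum>j\<in>?T. zdist i j)"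
    using zcost(2)[OF assms(3)] zdist(2)[OF i T] by (intro dvd_add dvd_sum) auto
  ultimately have "int (card ?T) dvd zcost i + (\<Sum>j\<in>?T. zdist i j)" by (rule dvd_trans)
  then have "real_of_int (zratio S i l) = (zcost i + (\<Sum>j\<in>?T. zdist i j)) / card ?T"
    unfolding zratio_def by (subst real_of_int_div) simp_all
  also have "\<dots> = (scale * f i + (\<Sum>j\<in>?T. scale * d i j)) / card ?T"
    using zcost(1)[OF assms(3)] zdist(1)[OF i T] by simp
  also have "\<dots> = scale * ratio S i l"
    by (simp add: ratio_def sum_distrib_left[symmetric] distrib_left[symmetric])
  finally show 1: "real_of_int (zratio S i l) = scale * ratio S i l" .
  have "0 \<le> ratio S i l"
    unfolding ratio_def using f_nonneg[OF assms(3)] by (intro divide_nonneg_nonneg add_nonneg_nonneg sum_nonneg) auto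
  then have "0 \<le> real_of_int (zratio S i l)" unfolding 1 using scale_pos by simp
  then show "0 \<le> zratio S i l" by simp
qed

lemma reval_open_timeE:
  assumes s: "ready s" "chosen_ok s" and j: "steady ej dp \<rho> s (int j)" "j < n"
    and i: "steady ei dp \<rho> s (int i)" "i \<in> Fac"
  shows "real_of_int (reval (open_timeE dp ej ei) dp \<rho> s) = scale * open_time (insert j (chosen s)) i"
proof -
  let ?S = "insert j (chosen s)"
  have inn: "i < n" using i(2) P_eq by auto
  have n: "nat (s 0 0) = n" using s by (simp add: ready_def inp_header)
  have S: "?S \<subseteq> {..<n}" using s(2) j(2) by (auto simp: chosen_ok_def)
  have fS: "finite ?S" using S by (rule finite_subset) simp
  define c where
    "c = andE (memE ej (RV (dp + 3))) (leE (distE ei (RV (dp + 3))) (distE ei (RV (dp + 1))))"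
  define b where
    "b = RDiv (RAdd (costE ei) (sumE (dp + 2) c (distE ei (RV (dp + 3))))) (sumE (dp + 2) c (RC 1))"
  have b: "reval b (dp + 2) (\<rho>(dp := a, dp + 1 := int l)) s = zratio ?S i l" if l: "l < n" for l a
  proof -
    let ?\<rho> = "\<rho>(dp := a, dp + 1 := int l)"
    have j1: "steady ej (dp + 2) ?\<rho> s (int j)" and i1: "steady ei (dp + 2) ?\<rho> s (int i)"
      by (rule steady_weaken[OF j(1)], rule steady_weaken[OF i(1)])
    have *: "reval ej (dp + 2 + 2) (?\<rho>(dp + 2 := a', dp + 2 + 1 := int v)) s = int j"
      "reval ei (dp + 2 + 2) (?\<rho>(dp + 2 := a', dp + 2 + 1 := int v)) s = int i"
      "reval (RV (dp + 1)) (dp + 2 + 2) (?\<rho>(dp + 2 := a', dp + 2 + 1 := int v)) s = int l"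
      "reval (RV (dp + 3)) (dp + 2 + 2) (?\<rho>(dp + 2 := a', dp + 2 + 1 := int v)) s = int v" for a' v
      using steadyD[OF steady_weaken[OF j1]] steadyD[OF steady_weaken[OF i1]] by simp_all
    have c: "0 < reval c (dp + 2 + 2) (?\<rho>(dp + 2 := a', dp + 2 + 1 := int v)) s \<longleftrightarrow> v \<in> closest ?S i l"
      if v: "v < n" for a' v
      unfolding c_def reval_andE reval_leE reval_memE[OF s(2) *(1,4)] reval_distE[OF s(1) *(2,4) inn v]
        reval_distE[OF s(1) *(2,3) inn l] zdist_le_iff[OF inn v l]
      by (auto simp: closest_def)
    have cl: "{v. v < n \<and> v \<in> closest ?S i l} = closest ?S i l"
      using S by (auto simp: closest_def)
    have "reval (sumE (dp + 2) c (distE ei (RV (dp + 3)))) (dp + 2) ?\<rho> s = (\<Sum>v\<in>closest ?S i l. zdist i v)"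
      using reval_sumE[of s c "dp + 2" ?\<rho> "\<lambda>v. v \<in> closest ?S i l" "distE ei (RV (dp + 3))" "zdist i"]
        c reval_distE[OF s(1) *(2,4) inn] by (simp only: n cl)
    moreover have "reval (sumE (dp + 2) c (RC 1)) (dp + 2) ?\<rho> s = (\<Sum>v\<in>closest ?S i l. 1)"
      using reval_sumE[of s c "dp + 2" ?\<rho> "\<lambda>v. v \<in> closest ?S i l" "RC 1" "\<lambda>_. 1"]
        c by (simp only: n cl reval.simps)
    moreover have "reval (costE ei) (dp + 2) ?\<rho> s = zcost i"
      by (rule reval_costE[OF s(1) steadyD[OF i1] i(2)])
    ultimately show ?thesis by (simp add: b_def zratio_def)
  qed
  have m: "0 < reval (memE ej (RV (dp + 1))) (dp + 2) (\<rho>(dp := a, dp + 1 := int v)) s \<longleftrightarrow> v \<in> ?S" for a v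
    by (rule reval_memE[OF s(2) steadyD[OF steady_weaken[OF j(1)]]]) simp
  \<comment> \<open>The set contains \<open>j\<close>, so the minimum is a genuine one and not the
    default -1.\<close>
  have Sn: "{v. v < n \<and> v \<in> ?S} = ?S" "\<exists>v<n. v \<in> ?S" using S j(2) by auto
  have "reval (open_timeE dp ej ei) dp \<rho> s = Min (zratio ?S i ` ?S)"
    using reval_minE[of s "memE ej (RV (dp + 1))" dp \<rho> "\<lambda>v. v \<in> ?S" b "zratio ?S i"] m b
      zratio(2)[OF S _ i(2)] Sn
    unfolding open_timeE_def Let_def c_def[symmetric] b_def[symmetric] n by simp
  also have "real_of_int \<dots> = scale * Min (ratio ?S i ` ?S)"
    using fS scale_pos zratio(1)[OF S _ i(2)] by (intro of_int_Min_scaled) auto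
  finally show ?thesis by (simp add: open_time_def)
qed

lemma reval_shareE:
  assumes s: "ready s" "chosen_ok s" and j: "steady ej dp \<rho> s (int j)" "j < n"
  shows "real_of_int (reval (shareE dp ej) dp \<rho> s) = scale * share (insert j (chosen s)) j"
proof -
  let ?S = "insert j (chosen s)"
  have n: "nat (s 0 0) = n" using s by (simp add: ready_def inp_header)
  have fS: "finite ?S" using s(2) finite_subset[of "chosen s" "{..<n}"] by (auto simp: chosen_ok_def)
  have Fn: "i < n" if "i \<in> Fac" for i using that P_eq by auto
  define t where "t = open_timeE (dp + 2) ej (RV (dp + 1))"
  define b where "b = RIf (RSub t (distE (RV (dp + 1)) ej)) t (distE (RV (dp + 1)) ej)"
  \<comment> \<open>\<open>reval_minE\<close> wants an integer function independent of the
    accumulator. The scaled values are integers, so rounding down only names them.\<close>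
  define h where "h = (\<lambda>i. \<lfloor>scale * max (open_time ?S i) (d i j)\<rfloor>)"
  have b: "real_of_int (reval b (dp + 2) (\<rho>(dp := a, dp + 1 := int i)) s) = scale * max (open_time ?S i) (d i j)"
    if i: "i \<in> Fac" for i a
  proof -
    let ?\<rho> = "\<rho>(dp := a, dp + 1 := int i)"
    have j1: "steady ej (dp + 2) ?\<rho> s (int j)" by (rule steady_weaken[OF j(1)])
    have i1: "steady (RV (dp + 1)) (dp + 2) ?\<rho> s (int i)" by (rule steady_RV) auto
    have t: "real_of_int (reval t (dp + 2) ?\<rho> s) = scale * open_time ?S i"
      unfolding t_def by (rule reval_open_timeE[OF s j1 j(2) i1 i])
    have e: "real_of_int (reval (distE (RV (dp + 1)) ej) (dp + 2) ?\<rho> s) = scale * d i j"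
      unfolding reval_distE[OF s(1) steadyD[OF i1] steadyD[OF j1] Fn[OF i] j(2)] by (rule zdist(1)[OF Fn[OF i] j(2)])
    have "real_of_int (reval b (dp + 2) ?\<rho> s) =
        max (real_of_int (reval t (dp + 2) ?\<rho> s)) (real_of_int (reval (distE (RV (dp + 1)) ej) (dp + 2) ?\<rho> s))"
      by (simp add: b_def max_def)
    then show ?thesis unfolding t e using scale_pos by (simp add: max_mult_distrib_left)
  qed
  have hb: "reval b (dp + 2) (\<rho>(dp := a, dp + 1 := int i)) s = h i" if "i \<in> Fac" for i a
    unfolding h_def b[OF that, of a, symmetric] by simp
  have h: "real_of_int (h i) = scale * max (open_time ?S i) (d i j)" if "i \<in> Fac" for i
    using hb[OF that, of 0] b[OF that, of 0] by simp
  have h0: "0 \<le> h i" if "i \<in> Fac" for i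
  proof -
    have "0 \<le> scale * max (open_time ?S i) (d i j)" using scale_pos by (auto simp: le_max_iff_disj)
    then show ?thesis using h[OF that] by linarith
  qed
  have m: "0 < reval (fieldE 0 (RV (dp + 1))) (dp + 2) (\<rho>(dp := a, dp + 1 := int i)) s \<longleftrightarrow> i \<in> Fac"
    if "i < n" for i a
    using reval_fieldE(1)[of s "RV (dp + 1)" "dp + 2" "\<rho>(dp := a, dp + 1 := int i)" i] that s(1)
    by (simp add: ready_def)
  have Sn: "{v. v < n \<and> v \<in> Fac} = Fac" "\<exists>v<n. v \<in> Fac" using Fn Fac_nonempty by auto
  have "reval (shareE dp ej) dp \<rho> s = Min (h ` Fac)"
    using reval_minE[of s "fieldE 0 (RV (dp + 1))" dp \<rho> "\<lambda>v. v \<in> Fac" b h] m hb h0 Sn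
    unfolding shareE_def Let_def t_def[symmetric] b_def[symmetric] n by simp
  also have "real_of_int \<dots> = scale * Min ((\<lambda>i. max (open_time ?S i) (d i j)) ` Fac)"
    using scale_pos h Fac_nonempty by (intro of_int_Min_scaled) auto
  finally show ?thesis by (simp add: share_def)
qed

end


section \<open>Correctness\<close>

text \<open>Needed for the choice of a largest share: there the accumulator is itself used as a
  client, and the evaluation of its share is known only while it is a point or -1.\<close>

lemma fold_upt_cong_inv:
  assumes "\<And>v a. v < m \<Longrightarrow> Q a \<Longrightarrow> h v a = h' v a \<and> Q (h' v a)" "Q z"
  shows "fold h [0..<m] z = fold h' [0..<m] z"
proof -
  have "fold h [0..<i] z = fold h' [0..<i] z \<and> Q (fold h' [0..<i] z)" if "i \<le> m" for i
    using that assms by (induction i) auto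
  then show ?thesis by blast
qed

context query
begin

definition level_set :: "(nat \<Rightarrow> int) \<Rightarrow> int \<Rightarrow> nat set" where
  "level_set lv R = {v. v < n \<and> 0 \<le> lv v \<and> lv v \<le> R}"

definition penalty :: "(fl_instance \<Rightarrow> nat set \<Rightarrow> nat set \<Rightarrow> ennreal) \<Rightarrow> nat set \<Rightarrow> ereal" where
  "penalty \<kappa> B = ereal (real_of_rat y) * enn2ereal (\<kappa> I A B)"

definition scaled_penalty :: "int \<Rightarrow> real" where
  "scaled_penalty R = real_of_rat y * (R / scale)"

text \<open>The 2 stems from halving the estimate; the other two factors are the denominators of
  \<open>y\<close> and of the scaled data.\<close>

definition value_of :: "int \<Rightarrow> real" where
  "value_of z = z / (2 * snd (quotient_of y) * scale)"

lemma value_of_mono: "z \<le> z' \<Longrightarrow> value_of z \<le> value_of z'"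
  unfolding value_of_def using scale_pos quotient_of_denom_pos'[of y] by (intro divide_right_mono) auto

lemma value_of_nonneg: "0 \<le> z \<Longrightarrow> 0 \<le> value_of z"
  using value_of_mono[of 0 z] by (simp add: value_of_def)

end

text \<open>What the algorithm needs of a scenario metric. A level is, up to scaling, the least
  distance that a client forces on a scenario containing it. The upper bound on the penalty is
  demanded only for sets of the size that the greedy choice produces: under the discrete metric a
  proper subset of \<open>A\<close> has only clients of level 0 and yet pays the full
  penalty.\<close>

locale leveled_query = query +
  fixes \<kappa> :: "fl_instance \<Rightarrow> nat set \<Rightarrow> nat set \<Rightarrow> ennreal"
    and lv :: "nat \<Rightarrow> int" and levE :: "nat \<Rightarrow> rexp \<Rightarrow> rexp"
  assumes reval_levE: "\<And>s e dp \<rho> v. ready s \<Longrightarrow> steady e dp \<rho> s (int v) \<Longrightarrow> v < n \<Longrightarrow>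
      reval (levE dp e) dp \<rho> s = lv v"
    and lv_client: "\<And>v. v < n \<Longrightarrow> 0 \<le> lv v \<Longrightarrow> v \<in> clients I"
    and penalty_le: "\<And>R B. 0 \<le> R \<Longrightarrow> B \<subseteq> level_set lv R \<Longrightarrow> card B = min k (card (level_set lv R)) \<Longrightarrow>
      penalty \<kappa> B \<le> ereal (scaled_penalty R)"
    and le_penalty: "\<And>A'. A' \<in> k_bounded_scenarios I k \<Longrightarrow> A' \<noteq> {} \<Longrightarrow> penalty \<kappa> A' = \<infinity> \<or>
      (\<forall>v\<in>A'. 0 \<le> lv v) \<and> ereal (scaled_penalty (Max (lv ` A'))) \<le> penalty \<kappa> A'"
    and penalty_self: "penalty \<kappa> A = 0"
begin

abbreviation "C \<equiv> level_set lv"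

lemma level_set_clients: "C R \<subseteq> clients I"
  using lv_client by (auto simp: level_set_def)

lemma finite_level_set: "finite (C R)"
  using level_set_clients finite_clients by (rule finite_subset)

lemma card_level_set: "card (C R) \<le> n"
  using card_mono[of "{..<n}" "C R"] by (auto simp: level_set_def)

lemma ready_n: "ready s \<Longrightarrow> nat (s 0 0) = n"
  by (simp add: ready_def inp_header)

lemma reval_candidateE:
  assumes "ready s" "chosen_ok s" "s 6 0 = R" "v < n" "\<rho> 1 = int v"
  shows "0 < reval (candidateE levE) 2 \<rho> s \<longleftrightarrow> v \<in> C R - chosen s \<and> card (chosen s) < k"
proof -
  have n: "nat (s 0 0) = n" by (rule ready_n[OF assms(1)])
  have v: "steady (RV 1) 2 \<rho> s (int v)" using assms(5) by (intro steady_RV) auto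
  have lv: "reval (levE 2 (RV 1)) 2 \<rho> s = lv v" by (rule reval_levE[OF assms(1) v assms(4)])
  have s7: "s 7 u = 0 \<or> s 7 u = 1" for u using assms(2) by (simp add: chosen_ok_def)
  have pos: "0 < s 7 u \<longleftrightarrow> u \<in> chosen s" for u using s7[of u] by (auto simp: chosen_def)
  have sub: "chosen s \<subseteq> {..<n}" using assms(2) by (simp add: chosen_ok_def)
  have "reval (sumE 2 (RG 7 (RV 3)) (RC 1)) 2 \<rho> s = (\<Sum>u | u < n \<and> u \<in> chosen s. 1)"
    using reval_sumE[of s "RG 7 (RV 3)" 2 \<rho> "\<lambda>u. u \<in> chosen s" "RC 1" "\<lambda>_. 1"] pos by (simp add: n)
  also have "{u. u < n \<and> u \<in> chosen s} = chosen s" using sub by auto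
  finally have "reval (sumE 2 (RG 7 (RV 3)) (RC 1)) 2 \<rho> s = int (card (chosen s))" by simp
  moreover have "s 0 1 = int k" using assms(1) inp_header by (simp add: ready_def)
  moreover have "0 < 1 - s 7 v \<longleftrightarrow> v \<notin> chosen s" using s7[of v] by (auto simp: chosen_def)
  ultimately show ?thesis
    unfolding candidateE_def reval_andE reval_leE lv using assms(3-5) by (auto simp: level_set_def)
qed

lemma eval_argmaxE:
  assumes s: "ready s" "chosen_ok s" "s 6 0 = R"
  shows "eval0 (argmaxE levE) s = -1 \<and> (C R \<subseteq> chosen s \<or> k \<le> card (chosen s)) \<or>
    (\<exists>l\<in>C R - chosen s. eval0 (argmaxE levE) s = int l \<and> card (chosen s) < k \<and>
      (\<forall>v\<in>C R - chosen s. share (insert v (chosen s)) v \<le> share (insert l (chosen s)) l))"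
proof -
  define H where "H = (\<lambda>v. \<lfloor>scale * share (insert v (chosen s)) v\<rfloor>)"
  define Q where "Q = (\<lambda>v. v \<in> C R - chosen s \<and> card (chosen s) < k)"
  have n: "nat (s 0 0) = n" by (rule ready_n[OF s(1)])
  have sh: "reval (shareE 2 e) 2 \<rho> s = H v \<and> real_of_int (H v) = scale * share (insert v (chosen s)) v"
    if "steady e 2 \<rho> s (int v)" "v < n" for e \<rho> v
    using reval_shareE[OF s(1,2) that] unfolding H_def by (metis floor_of_int)
  have H: "real_of_int (H v) = scale * share (insert v (chosen s)) v" if "v < n" for v
    using sh[of "RV 0" "\<lambda>_. int v" v] that by (simp add: steady_RV)
  have "eval0 (argmaxE levE) s =
      fold (\<lambda>v x. if Q v then if 0 < x + 1 then if 0 < H v - H (nat x) then int v else x else int v else x) [0..<n] (-1)"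
    unfolding argmaxE_def reval.simps(1,9) n
  proof (rule fold_upt_cong_inv[where Q = "\<lambda>a. a = -1 \<or> 0 \<le> a \<and> a < int n"], intro conjI)
    fix v a assume v: "v < n" and a: "a = -1 \<or> 0 \<le> a \<and> a < int n"
    let ?\<rho> = "(\<lambda>_. 0)(0 := a, 0 + 1 := int v)"
    have c: "0 < reval (candidateE levE) (0 + 2) ?\<rho> s \<longleftrightarrow> Q v"
      using reval_candidateE[OF s v, of ?\<rho>] by (simp add: Q_def numeral_2_eq_2)
    have 1: "reval (shareE 2 (RV 1)) (0 + 2) ?\<rho> s = H v"
      using sh[of "RV 1" ?\<rho> v] v by (simp add: steady_RV numeral_2_eq_2)
    have 0: "reval (shareE 2 (RV 0)) (0 + 2) ?\<rho> s = H (nat a)" if "0 \<le> a" "a < int n"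
      using sh[of "RV 0" ?\<rho> "nat a"] that by (simp add: steady_RV numeral_2_eq_2)
    show "reval (RIf (candidateE levE) (RIf (RAdd (RV 0) (RC 1)) (RIf (RSub (shareE 2 (RV 1)) (shareE 2 (RV 0))) (RV 1) (RV 0)) (RV 1)) (RV 0)) (0 + 2) ?\<rho> s
      = (if Q v then if 0 < a + 1 then if 0 < H v - H (nat a) then int v else a else int v else a)"
      using a 0 unfolding reval.simps(2,4,5,8) c 1 by auto
    show "(if Q v then if 0 < a + 1 then if 0 < H v - H (nat a) then int v else a else int v else a) = -1 \<or>
      0 \<le> (if Q v then if 0 < a + 1 then if 0 < H v - H (nat a) then int v else a else int v else a) \<and>
      (if Q v then if 0 < a + 1 then if 0 < H v - H (nat a) then int v else a else int v else a) < int n"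
      using a v by auto
  qed simp
  then have "eval0 (argmaxE levE) s = -1 \<and> (\<forall>v<n. \<not> Q v) \<or>
      (\<exists>l<n. eval0 (argmaxE levE) s = int l \<and> Q l \<and> (\<forall>v<n. Q v \<longrightarrow> H v \<le> H l))"
    using fold_argmax[where m = n and Q = Q and h = H] by simp
  then show ?thesis
  proof (elim disjE exE conjE)
    assume "eval0 (argmaxE levE) s = -1" "\<forall>v<n. \<not> Q v"
    then show ?thesis by (auto simp: Q_def level_set_def)
  next
    fix l assume l: "l < n" "eval0 (argmaxE levE) s = int l" "Q l" "\<forall>v<n. Q v \<longrightarrow> H v \<le> H l"
    have "share (insert v (chosen s)) v \<le> share (insert l (chosen s)) l" if "v \<in> C R - chosen s" for v
    proof -
      have vn: "v < n" using that by (simp add: level_set_def)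
      then have "H v \<le> H l" using l that by (simp add: Q_def)
      then have "real_of_int (H v) \<le> real_of_int (H l)" by simp
      then show ?thesis unfolding H[OF vn] H[OF l(1)] using scale_pos by simp
    qed
    then show ?thesis using l by (auto simp: Q_def)
  qed
qed

text \<open>The loop always makes n rounds, which is enough because a level set has at most n
  clients. Once no candidate is left, a round keeps the chosen set and the last share, so after i
  rounds the size is the minimum of i, \<open>k\<close> and the size of the level set.\<close>

lemma greedy_prog_correct:
  assumes s: "ready s" "chosen s = {}" "s 6 0 = R"
  defines "s' \<equiv> hrun (greedy_prog levE) s"
  shows "chosen_ok s'" "greedy_inv (C R) (chosen s') (s' 10 0 / scale)"
    "card (chosen s') = min k (card (C R))"
proof -
  define p where "p = HSeq (HPut 9 (RC 0) (argmaxE levE))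
     (HSeq (HPut 10 (RC 0) (RIf (leE (RC 0) (cellE 9)) (shareE 0 (cellE 9)) (cellE 10)))
       (HPut 7 (cellE 9) (RIf (leE (RC 0) (cellE 9)) (RC 1) (RG 7 (RC 0)))))"
  define Inv where "Inv = (\<lambda>i u. ready u \<and> chosen_ok u \<and> u 6 0 = R \<and>
    greedy_inv (C R) (chosen u) (u 10 0 / scale) \<and> card (chosen u) = min i (min k (card (C R))))"
  have "Inv (nat (s 0 0)) (hrun (HFor 8 p) s)"
  proof (rule hrun_HFor_invariant[where Inv = Inv])
    show "Inv 0 (upd s 8 0 0)"
      using s by (auto simp: Inv_def ready_def chosen_ok_def chosen_def greedy_inv_def)
    fix i u assume i: "i < nat (s 0 0)" and u: "u 0 = s 0" "u 8 0 = int i" "Inv i u"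
    then have r: "ready u" "chosen_ok u" "u 6 0 = R" and g: "greedy_inv (C R) (chosen u) (u 10 0 / scale)"
      and c: "card (chosen u) = min i (min k (card (C R)))" by (auto simp: Inv_def)
    have BC: "chosen u \<subseteq> C R" using g by (simp add: greedy_inv_def)
    have fB: "finite (chosen u)" using BC finite_level_set by (rule finite_subset)
    define m where "m = eval0 (argmaxE levE) u"
    define u1 where "u1 = upd u 9 0 m"
    have u1: "ready u1" "chosen_ok u1" "chosen u1 = chosen u"
      using r by (auto simp: u1_def ready_def chosen_ok_def chosen_def)
    from eval_argmaxE[OF r] show "Inv (Suc i) (upd (hrun p u) 8 0 (int i + 1))"
      unfolding m_def[symmetric]
    proof
      assume "m = -1 \<and> (C R \<subseteq> chosen u \<or> k \<le> card (chosen u))"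
      then have m: "m = -1" and full: "C R \<subseteq> chosen u \<or> k \<le> card (chosen u)" by auto
      have "card (chosen u) = min (Suc i) (min k (card (C R)))"
        using full
      proof
        assume "C R \<subseteq> chosen u"
        then have "card (chosen u) = card (C R)" using BC by (simp add: subset_antisym)
        then show ?thesis using c by auto
      qed (use c in auto)
      \<comment> \<open>Without a candidate, cell 9 holds -1, which as an index is read as 0; the
        entry written there is its own old value.\<close>
      moreover have "hrun p u = upd (upd u1 10 0 (u 10 0)) 7 0 (u 7 0)"
        by (simp add: p_def m_def[symmetric] u1_def m leE_def)
      moreover have "chosen (upd (upd (upd u1 10 0 (u 10 0)) 7 0 (u 7 0)) 8 0 (int i + 1)) = chosen u"
        by (auto simp: chosen_def u1_def)
      ultimately show ?thesis
        using r g by (auto simp: Inv_def ready_def chosen_ok_def u1_def)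
    next
      assume "\<exists>l\<in>C R - chosen u. m = int l \<and> card (chosen u) < k \<and>
        (\<forall>v\<in>C R - chosen u. share (insert v (chosen u)) v \<le> share (insert l (chosen u)) l)"
      then obtain l where l: "l \<in> C R - chosen u" "m = int l" "card (chosen u) < k"
        and mx: "\<forall>v\<in>C R - chosen u. share (insert v (chosen u)) v \<le> share (insert l (chosen u)) l"
        by blast
      have ln: "l < n" using l by (simp add: level_set_def)
      define a where "a = reval (shareE 0 (cellE 9)) 0 (\<lambda>_. 0) u1"
      have "steady (cellE 9) 0 (\<lambda>_. 0) u1 (int l)"
        using steady_cellE[of 9 0 "\<lambda>_. 0" u1] l(2) by (simp add: u1_def)
      from reval_shareE[OF u1(1,2) this ln] have a: "real_of_int a = scale * share (insert l (chosen u)) l"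
        by (simp add: a_def u1(3))
      define u' where "u' = upd (upd (upd u1 10 0 a) 7 l 1) 8 0 (int i + 1)"
      have run: "upd (hrun p u) 8 0 (int i + 1) = u'"
        by (simp add: p_def m_def[symmetric] u1_def[symmetric] u'_def leE_def a_def)
           (simp add: u1_def l(2))
      have ch: "chosen u' = insert l (chosen u)" by (auto simp: chosen_def u'_def u1_def)
      have "u' 10 0 / scale = share (insert l (chosen u)) l"
        using a scale_pos by (simp add: u'_def)
      then have "greedy_inv (C R) (chosen u') (u' 10 0 / scale)"
        unfolding ch using greedy_inv_insert[OF g finite_level_set l(1)] mx by auto
      moreover have "card (chosen u') = min (Suc i) (min k (card (C R)))"
      proof -
        have "card (chosen u') = Suc (card (chosen u))" unfolding ch using l(1) fB by simp
        moreover have "card (chosen u) < card (C R)"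
          using l(1) BC finite_level_set by (intro psubset_card_mono) auto
        ultimately show ?thesis using c l(3) by (auto simp: min_def split: if_splits)
      qed
      moreover have "ready u'" "u' 6 0 = R" using r by (auto simp: ready_def u'_def u1_def)
      moreover have "chosen_ok u'"
        using r(2) ch ln by (auto simp: chosen_ok_def u'_def u1_def)
      ultimately show ?thesis unfolding run Inv_def by blast
    qed
  qed (auto simp: p_def)
  then have "Inv n s'" using s(1) by (simp add: s'_def greedy_prog_def p_def ready_n)
  then show "chosen_ok s'" "greedy_inv (C R) (chosen s') (s' 10 0 / scale)" "card (chosen s') = min k (card (C R))"
    using card_level_set[of R] by (auto simp: Inv_def)
qed

text \<open>\<open>V\<close> works from both sides: it is certified from above by \<open>B\<close>,
  and it dominates a sixth of every competing value in the same level set, less the penalty of the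
  level. Candidates of different levels can thus be compared by \<open>V\<close>, although the value
  of \<open>B\<close> is never computed.\<close>

lemma level_prog_correct:
  assumes s: "ready s" "chosen_ok s" "s 5 0 = int r" "r < n" "output_set s \<subseteq> {..<n}"
  defines "s' \<equiv> hrun (level_prog levE) s"
  obtains B V where "B \<subseteq> C (max 0 (lv r))" "card B = min k (card (C (max 0 (lv r))))"
    "value_of V \<le> g B - scaled_penalty (max 0 (lv r))"
    "\<forall>A'. A' \<subseteq> C (max 0 (lv r)) \<longrightarrow> card A' \<le> k \<longrightarrow> g A' / 6 - scaled_penalty (max 0 (lv r)) \<le> value_of V"
    "ready s'" "chosen_ok s'" "output_set s' = (if s 4 0 < V then B else output_set s)"
    "s' 4 0 = max (s 4 0) V"
proof -
  define R where "R = max 0 (lv r)"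
  define s1 where "s1 = upd s 6 0 R"
  define s2 where "s2 = hrun (HFor 3 (HPut 7 (cellE 3) (RC 0))) s1"
  define s3 where "s3 = hrun (greedy_prog levE) s2"
  define V where "V = eval0 (RSub (RMul (RC 3) (sumE 0 (RG 7 (RV 1)) (RAdd (shareE 2 (RV 1)) (cellE 10))))
       (twiceE (RMul (RC 2) (cellE 6)))) s3"
  define s4 where "s4 = upd s3 11 0 V"
  define s5 where "s5 = hrun (HFor 3 (HPut 1 (cellE 3)
    (RIf (RSub (cellE 11) (cellE 4)) (RG 7 (cellE 3)) (RG 1 (cellE 3))))) s4"
  define B where "B = chosen s3"
  define a :: real where "a = s3 10 0 / scale"
  have "steady (cellE 5) 0 (\<lambda>_. 0) s (int r)" using steady_cellE[of 5 0 "\<lambda>_. 0" s] s(3) by simp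
  from reval_levE[OF s(1) this s(4)] have "hrun (HPut 6 (RC 0)
      (RIf (leE (RC 0) (levE 0 (cellE 5))) (levE 0 (cellE 5)) (RC 0))) s = s1"
    by (simp add: s1_def R_def leE_def max_def)
  then have s': "s' = upd s5 4 0 (if 0 < s5 11 0 - s5 4 0 then s5 11 0 else s5 4 0)"
    by (simp add: s'_def level_prog_def s2_def s3_def V_def s4_def s5_def)
  have f2: "s2 b = s1 b" if "b \<noteq> 3" "b \<noteq> 7" for b
    unfolding s2_def using that by (intro hrun_frame) auto
  have f3: "s3 b = s2 b" if "b \<notin> {7, 8, 9, 10}" for b
    unfolding s3_def using that by (intro hrun_frame) (auto simp: greedy_prog_def)
  have f5: "s5 b = s4 b" if "b \<noteq> 3" "b \<noteq> 1" for b
    unfolding s5_def using that by (intro hrun_frame) auto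
  have r1: "ready s1" using s(1) by (simp add: ready_def s1_def)
  have r2: "ready s2" using r1 f2 by (simp add: ready_def)
  have r3: "ready s3" using r2 f3 by (simp add: ready_def)
  have "s2 7 = (\<lambda>i. if i < nat (s1 0 0) then 0 else s1 7 i)"
    unfolding s2_def by (rule hrun_fill) auto
  \<comment> \<open>Only the first n entries are cleared; beyond them \<open>chosen_ok\<close>
    guarantees zeros.\<close>
  moreover have "s1 7 i = 0" if "\<not> i < n" for i
    using s(2) that by (auto simp: s1_def chosen_ok_def chosen_def)
  ultimately have ch2: "chosen s2 = {}" by (auto simp: chosen_def ready_n[OF r1])
  have R3: "s3 6 0 = R" using f3 f2 by (simp add: s1_def)
  have "s2 6 0 = R" using f2 by (simp add: s1_def)
  note gr = greedy_prog_correct[OF r2 ch2 this, folded s3_def, folded B_def a_def]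
  have BC: "B \<subseteq> C R" using gr(2) by (simp add: greedy_inv_def)
  have Bn: "B \<subseteq> {..<n}" using BC by (auto simp: level_set_def)
  have "value_of V = estimate B a / 2 - scaled_penalty R"
  proof -
    define h where "h = (\<lambda>v. reval (RAdd (shareE 2 (RV 1)) (cellE 10)) (0 + 2) ((\<lambda>_. 0)(0 := 0, 0 + 1 := int v)) s3)"
    have h': "real_of_int (reval (RAdd (shareE 2 (RV 1)) (cellE 10)) (0 + 2) ((\<lambda>_. 0)(0 := z, 0 + 1 := int v)) s3)
        = scale * (share B v + a)" if "v \<in> B" for v z
    proof -
      have "steady (RV 1) 2 ((\<lambda>_. 0)(0 := z, 0 + 1 := int v)) s3 (int v)" by (rule steady_RV) auto
      from reval_shareE[OF r3 gr(1) this] Bn that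
      have "real_of_int (reval (shareE 2 (RV 1)) (0 + 2) ((\<lambda>_. 0)(0 := z, 0 + 1 := int v)) s3) = scale * share B v"
        by (auto simp: B_def[symmetric] insert_absorb numeral_2_eq_2)
      then show ?thesis using scale_pos by (simp add: a_def distrib_left)
    qed
    have h: "real_of_int (h v) = scale * (share B v + a)" if "v \<in> B" for v
      unfolding h_def by (rule h'[OF that])
    \<comment> \<open>The sum rule asks for one integer per client that is independent of the
      accumulator \<open>z\<close>. The real value does not depend on \<open>z\<close>, and it
      determines the integer.\<close>
    have hz: "reval (RAdd (shareE 2 (RV 1)) (cellE 10)) (0 + 2) ((\<lambda>_. 0)(0 := z, 0 + 1 := int v)) s3 = h v"
      if "v \<in> B" for v z
    proof -
      have "real_of_int (reval (RAdd (shareE 2 (RV 1)) (cellE 10)) (0 + 2) ((\<lambda>_. 0)(0 := z, 0 + 1 := int v)) s3) = real_of_int (h v)"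
        unfolding h[OF that] by (rule h'[OF that])
      then show ?thesis by (simp only: of_int_eq_iff)
    qed
    have pos: "0 < s3 7 v \<longleftrightarrow> v \<in> B" for v
    proof -
      have "s3 7 v = 0 \<or> s3 7 v = 1" using gr(1) by (simp add: chosen_ok_def)
      then show ?thesis by (auto simp: B_def chosen_def)
    qed
    have "eval0 (sumE 0 (RG 7 (RV 1)) (RAdd (shareE 2 (RV 1)) (cellE 10))) s3 = (\<Sum>v | v < nat (s3 0 0) \<and> v \<in> B. h v)"
      by (rule reval_sumE) (use pos hz in \<open>auto simp del: reval.simps(4)\<close>)
    also have "{v. v < nat (s3 0 0) \<and> v \<in> B} = B" using Bn by (auto simp: ready_n[OF r3])
    finally have "real_of_int (eval0 (sumE 0 (RG 7 (RV 1)) (RAdd (shareE 2 (RV 1)) (cellE 10))) s3) = (\<Sum>v\<in>B. scale * (share B v + a))"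
      using h by simp
    also have "\<dots> = scale * estimate B a" by (simp add: estimate_def sum_distrib_left)
    finally have H: "real_of_int (eval0 (sumE 0 (RG 7 (RV 1)) (RAdd (shareE 2 (RV 1)) (cellE 10))) s3) = scale * estimate B a" .
    obtain p q where pq: "quotient_of y = (p, q)" by (cases "quotient_of y")
    have q: "0 < q" using quotient_of_denom_pos[OF pq] .
    have y: "real_of_rat y = real_of_int p / real_of_int q"
      using quotient_of_div[OF pq] by (simp add: of_rat_divide)
    have "s3 0 2 = p" "s3 0 3 = q" using r3 inp_header pq by (simp_all add: ready_def)
    then have "real_of_int V = q * (scale * estimate B a) - 2 * (p * R)"
      unfolding V_def H[symmetric] by (simp add: twiceE_def R3)
    then have "value_of V = (q * (scale * estimate B a) - 2 * (p * R)) / (2 * q * scale)"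
      by (simp add: value_of_def pq)
    also have "\<dots> = estimate B a / 2 - scaled_penalty R"
      using q scale_pos by (simp add: scaled_penalty_def y field_simps)
    finally show ?thesis .
  qed
  note V_eq = this
  have V1: "value_of V \<le> g B - scaled_penalty R"
    using estimate_le[OF gr(2) finite_level_set] unfolding V_eq by linarith
  have V2: "\<forall>A'. A' \<subseteq> C R \<longrightarrow> card A' \<le> k \<longrightarrow> g A' / 6 - scaled_penalty R \<le> value_of V"
  proof (intro allI impI)
    fix A' assume "A' \<subseteq> C R" "card A' \<le> k"
    from le_estimate[OF gr(2) level_set_clients gr(3) this]
    show "g A' / 6 - scaled_penalty R \<le> value_of V" unfolding V_eq by linarith
  qed
  have "s4 1 = s 1" "s4 4 = s 4" "s4 7 = s3 7" "s4 11 0 = V"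
    using f3 f2 by (simp_all add: s4_def s1_def)
  moreover have "nat (s4 0 0) = n" by (simp add: s4_def ready_n[OF r3])
  ultimately have f: "s4 1 = s 1" "s4 4 = s 4" "s4 7 = s3 7" "s4 11 0 = V" "nat (s4 0 0) = n" .
  have s51: "s5 1 = (\<lambda>i. if i < nat (s4 0 0) then (if s 4 0 < V then s3 7 i else s 1 i) else s4 1 i)"
    unfolding s5_def
  proof (rule hrun_fill)
    fix i u assume "i < nat (s4 0 0)" and u: "\<And>c. c \<noteq> 3 \<Longrightarrow> c \<noteq> 1 \<Longrightarrow> u c = s4 c" "u 3 0 = int i" "u 1 i = s4 1 i"
    then show "eval0 (RIf (RSub (cellE 11) (cellE 4)) (RG 7 (cellE 3)) (RG 1 (cellE 3))) u
        = (if s 4 0 < V then s3 7 i else s 1 i)"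
      using u(1)[of 11] u(1)[of 4] u(1)[of 7] f by simp
  qed auto
  have out: "output_set s' = (if s 4 0 < V then B else output_set s)"
  proof -
    have "s 1 i = 0" "s3 7 i = 0" if "\<not> i < n" for i
      using that s(5) Bn by (auto simp: output_set_def B_def chosen_def)
    then show ?thesis by (auto simp: s' output_set_def s51 f B_def chosen_def simp del: One_nat_def)
  qed
  have s'4: "s' 4 0 = max (s 4 0) V" using f f5 by (simp add: s' max_def)
  have "ready s'" "chosen_ok s'"
    using r3 gr(1) f5 by (simp_all add: s' s4_def ready_def chosen_ok_def chosen_def)
  from that[OF BC[unfolded R_def] gr(3)[unfolded R_def] V1[unfolded R_def] V2[unfolded R_def] this out s'4]
  show thesis .
qed

theorem scenario_prog_correct:
  "approx_scenario \<kappa> 6 1 I k x (real_of_rat y) A (output_set (hrun (scenario_prog levE) (input_store code)))"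
proof -
  define s0 where "s0 = input_store code"
  define s1 where "s1 = upd s0 2 0 scale"
  define s2 where "s2 = hrun (HFor 3 (HPut 1 (cellE 3) (fieldE 3 (cellE 3)))) s1"
  define s' where "s' = hrun (HFor 5 (level_prog levE)) s2"
  have s0: "s0 0 = inp" "\<And>b i. b \<noteq> 0 \<Longrightarrow> s0 b i = 0" by (simp_all add: s0_def inp_def input_store_def)
  have run: "hrun (scenario_prog levE) (input_store code) = s'"
    using reval_scaleE[of s0, OF s0(1)] by (simp add: scenario_prog_def s'_def s2_def s1_def s0_def)
  have f2: "s2 b = s1 b" if "b \<noteq> 3" "b \<noteq> 1" for b
    unfolding s2_def using that by (intro hrun_frame) auto
  have r2: "ready s2" using s0 f2 by (simp add: ready_def s1_def)
  have n1: "nat (s1 0 0) = n" using s0 inp_header by (simp add: s1_def)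
  have s11: "s1 1 i = 0" for i by (simp add: s1_def s0(2))
  have "s2 1 = (\<lambda>i. if i < nat (s1 0 0) then of_bool (i \<in> A) else s1 1 i)"
    unfolding s2_def
  proof (rule hrun_fill)
    fix i u assume u: "i < nat (s1 0 0)" "\<And>c. c \<noteq> 3 \<Longrightarrow> c \<noteq> 1 \<Longrightarrow> u c = s1 c" "u 3 0 = int i"
    have "u 0 = inp" using u(2)[of 0] s0(1) by (simp add: s1_def)
    then show "eval0 (fieldE 3 (cellE 3)) u = of_bool (i \<in> A)"
      using u n1 by (intro reval_fieldE(4)) auto
  qed auto
  then have "s2 1 = (\<lambda>i. if i < n then of_bool (i \<in> A) else 0)"
    unfolding n1 s11 .
  moreover have "A \<subseteq> {..<n}" using A_scenario P_eq by (auto simp: k_bounded_scenarios_def)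
  ultimately have out2: "output_set s2 = A" by (auto simp: output_set_def)
  have finA: "finite B" if "B \<in> k_bounded_scenarios I k" for B
    using that finite_subset[of B "clients I"] by (auto simp: k_bounded_scenarios_def)
  \<comment> \<open>Cell 4 separates the two sides of the guarantee: it is at most the penalized
    value of the current output and at least the discounted value of every competitor confined to a
    level tried so far.\<close>
  define Inv where "Inv = (\<lambda>i u. ready u \<and> chosen_ok u \<and> output_set u \<in> k_bounded_scenarios I k \<and> 0 \<le> u 4 0 \<and>
    ereal (value_of (u 4 0)) \<le> ereal (g (output_set u)) - penalty \<kappa> (output_set u) \<and>
    (\<forall>r<i. \<forall>A'. A' \<subseteq> C (max 0 (lv r)) \<longrightarrow> card A' \<le> k \<longrightarrow>
      g A' / 6 - scaled_penalty (max 0 (lv r)) \<le> value_of (u 4 0)))"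
  have "Inv (nat (s2 0 0)) s'"
    unfolding s'_def
  proof (rule hrun_HFor_invariant[where Inv = Inv])
    have z: "s2 4 0 = 0" "\<And>i. s2 7 i = 0" using f2 s0(2) by (simp_all add: s1_def)
    have o: "output_set (upd s2 5 0 0) = A" using out2 by (simp add: output_set_def)
    show "Inv 0 (upd s2 5 0 0)"
      using r2 A_scenario z g_nonneg[OF finA[OF A_scenario]]
      by (simp add: Inv_def o ready_def chosen_ok_def chosen_def penalty_self value_of_def)
    fix i u assume i: "i < nat (s2 0 0)" and u: "u 0 = s2 0" "u 5 0 = int i" "Inv i u"
    then have Iu: "ready u" "chosen_ok u" "output_set u \<in> k_bounded_scenarios I k" "0 \<le> u 4 0"
      "ereal (value_of (u 4 0)) \<le> ereal (g (output_set u)) - penalty \<kappa> (output_set u)"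
      and old: "\<And>r A'. r < i \<Longrightarrow> A' \<subseteq> C (max 0 (lv r)) \<Longrightarrow> card A' \<le> k \<Longrightarrow>
        g A' / 6 - scaled_penalty (max 0 (lv r)) \<le> value_of (u 4 0)"
      by (auto simp: Inv_def)
    have i': "i < n" using i r2 by (simp add: ready_n)
    have out: "output_set u \<subseteq> {..<n}" using Iu(3) P_eq by (auto simp: k_bounded_scenarios_def)
    obtain B V where
      B: "B \<subseteq> C (max 0 (lv i))" "card B = min k (card (C (max 0 (lv i))))"
        "value_of V \<le> g B - scaled_penalty (max 0 (lv i))"
      and new: "\<forall>A'. A' \<subseteq> C (max 0 (lv i)) \<longrightarrow> card A' \<le> k \<longrightarrow>
        g A' / 6 - scaled_penalty (max 0 (lv i)) \<le> value_of V"
      and post: "ready (hrun (level_prog levE) u)" "chosen_ok (hrun (level_prog levE) u)"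
        "output_set (hrun (level_prog levE) u) = (if u 4 0 < V then B else output_set u)"
        "hrun (level_prog levE) u 4 0 = max (u 4 0) V"
      by (rule level_prog_correct[OF Iu(1,2) u(2) i' out])
    define w where "w = upd (hrun (level_prog levE) u) 5 0 (int i + 1)"
    have w: "ready w" "chosen_ok w" "output_set w = (if u 4 0 < V then B else output_set u)" "w 4 0 = max (u 4 0) V"
      using post by (simp_all add: w_def ready_def chosen_ok_def chosen_def output_set_def)
    have B_scen: "B \<in> k_bounded_scenarios I k"
      using B(1,2) level_set_clients by (auto simp: k_bounded_scenarios_def)
    have pB: "penalty \<kappa> B \<le> ereal (scaled_penalty (max 0 (lv i)))" by (rule penalty_le[OF _ B(1,2)]) simp
    have "ereal (value_of V) \<le> ereal (g B) - ereal (scaled_penalty (max 0 (lv i)))" using B(3) by simp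
    also have "\<dots> \<le> ereal (g B) - penalty \<kappa> B" using pB by (intro ereal_minus_mono) auto
    finally have BV: "ereal (value_of V) \<le> ereal (g B) - penalty \<kappa> B" .
    have "g A' / 6 - scaled_penalty (max 0 (lv r)) \<le> value_of (w 4 0)"
      if "r < Suc i" "A' \<subseteq> C (max 0 (lv r))" "card A' \<le> k" for r A'
    proof (cases "r = i")
      case True
      then show ?thesis using new[rule_format, of A'] that value_of_mono[of V "w 4 0"] w(4) by simp
    next
      case False
      then show ?thesis using old[of r A'] that value_of_mono[of "u 4 0" "w 4 0"] w(4) by simp
    qed
    moreover have "ereal (value_of (w 4 0)) \<le> ereal (g (output_set w)) - penalty \<kappa> (output_set w)"
      using BV Iu(5) by (simp add: w(3,4) max_def)
    ultimately show "Inv (Suc i) (upd (hrun (level_prog levE) u) 5 0 (int i + 1))"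
      unfolding w_def[symmetric] Inv_def using w(1,2) Iu(3,4) B_scen by (simp add: w(3,4))
  qed (auto simp: level_prog_def greedy_prog_def)
  then have fin: "output_set s' \<in> k_bounded_scenarios I k" "0 \<le> s' 4 0"
      "ereal (value_of (s' 4 0)) \<le> ereal (g (output_set s')) - penalty \<kappa> (output_set s')"
    and best: "\<And>r A'. r < n \<Longrightarrow> A' \<subseteq> C (max 0 (lv r)) \<Longrightarrow> card A' \<le> k \<Longrightarrow>
      g A' / 6 - scaled_penalty (max 0 (lv r)) \<le> value_of (s' 4 0)"
    unfolding Inv_def ready_n[OF r2] by blast+
  have "ereal (g A' / 6) - penalty \<kappa> A' \<le> ereal (value_of (s' 4 0))" if A': "A' \<in> k_bounded_scenarios I k" for A'
  \<comment> \<open>The empty scenario has no largest level, but its value is 0 and cell 4 is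
    nonnegative; an infinite penalty makes the claim trivial.\<close>
  proof (cases "A' = {} \<or> penalty \<kappa> A' = \<infinity>")
    case True
    then show ?thesis
    proof
      assume "A' = {}"
      moreover have "0 \<le> penalty \<kappa> {}" using y_nonneg by (simp add: penalty_def)
      ultimately show ?thesis using value_of_nonneg[OF fin(2)]
        by (cases "penalty \<kappa> {}") (simp_all add: g_empty zero_ereal_def)
    next
      assume "penalty \<kappa> A' = \<infinity>"
      then show ?thesis by simp
    qed
  next
    case False
    then have lv: "\<forall>v\<in>A'. 0 \<le> lv v" "ereal (scaled_penalty (Max (lv ` A'))) \<le> penalty \<kappa> A'"
      using le_penalty[OF A'] by auto
    \<comment> \<open>A client \<open>r\<close> of largest level in \<open>A'\<close> is one of the
      points visited by the outer loop, and in its round the level set contains all of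
      \<open>A'\<close>.\<close>
    have "Max (lv ` A') \<in> lv ` A'" using False finA[OF A'] by (intro Max_in) auto
    then obtain r where r: "r \<in> A'" "Max (lv ` A') = lv r" by auto
    have n: "v < n" if "v \<in> A'" for v using that A' P_eq by (auto simp: k_bounded_scenarios_def)
    have m: "max 0 (lv r) = lv r" using lv(1) r(1) by simp
    have "A' \<subseteq> C (lv r)"
      using lv(1) n r(2) finA[OF A'] by (auto simp: level_set_def simp flip: r(2))
    then have "g A' / 6 - scaled_penalty (lv r) \<le> value_of (s' 4 0)"
      using best[OF n[OF r(1)], of A'] A' by (simp add: m k_bounded_scenarios_def)
    then have "ereal (g A' / 6) - ereal (scaled_penalty (lv r)) \<le> ereal (value_of (s' 4 0))" by simp
    moreover have "ereal (g A' / 6) - penalty \<kappa> A' \<le> ereal (g A' / 6) - ereal (scaled_penalty (lv r))"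
      using lv(2) r(2) by (intro ereal_minus_mono) auto
    ultimately show ?thesis by (rule order_trans[rotated])
  qed
  from order_trans[OF this fin(3)] show ?thesis
    unfolding run approx_scenario_def mult_1 penalty_def using fin(1) by blast
qed

end


section \<open>The two scenario metrics\<close>

context query
begin

lemma scaled_penalty_mono: "R \<le> R' \<Longrightarrow> scaled_penalty R \<le> scaled_penalty R'"
  unfolding scaled_penalty_def using scale_pos y_nonneg
  by (intro mult_left_mono divide_right_mono) auto

lemma scaled_penalty_0: "scaled_penalty 0 = 0"
  by (simp add: scaled_penalty_def)

lemma scaled_penalty_scale: "scaled_penalty scale = real_of_rat y"
  using scale_pos by (simp add: scaled_penalty_def)

lemma scenario_less: "B \<in> k_bounded_scenarios I k \<Longrightarrow> v \<in> B \<Longrightarrow> v < n"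
  using P_eq by (auto simp: k_bounded_scenarios_def)

lemma finite_scenario: "B \<in> k_bounded_scenarios I k \<Longrightarrow> finite B"
  using finite_subset[of B "clients I"] by (auto simp: k_bounded_scenarios_def)

definition discrete_level :: "nat \<Rightarrow> int" where
  "discrete_level v = (if v \<in> clients I then if v \<in> A then 0 else scale else -1)"

lemma penalty_discrete: "penalty kappa_discrete B = (if A = B then 0 else ereal (real_of_rat y))"
  by (simp add: penalty_def kappa_discrete_def zero_ennreal.rep_eq one_ennreal.rep_eq)

lemma leveled_query_discrete: "leveled_query I x k y A kappa_discrete discrete_level discrete_levelE"
proof unfold_locales
  fix s e dp \<rho> v assume s: "ready s" "steady e dp \<rho> s (int v)" "v < n"
  have "s 0 = inp" "s 2 0 = scale" using s(1) by (auto simp: ready_def)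
  then show "reval (discrete_levelE dp e) dp \<rho> s = discrete_level v"
    using reval_fieldE(2,4)[of s e dp \<rho> v] steadyD[OF s(2)] s(3)
    by (simp add: discrete_levelE_def discrete_level_def)
next
  fix v assume "v < n" "0 \<le> discrete_level v"
  then show "v \<in> clients I" by (simp add: discrete_level_def split: if_splits)
next
  fix R B assume R: "0 \<le> R" and B: "B \<subseteq> level_set discrete_level R"
    "card B = min k (card (level_set discrete_level R))"
  show "penalty kappa_discrete B \<le> ereal (scaled_penalty R)"
  \<comment> \<open>Below distance 1 the level set is \<open>A\<close> itself. Since
    \<open>A\<close> has at most \<open>k\<close> elements, the size condition forces
    \<open>B = A\<close>, whose penalty is 0; otherwise the level pays for the full penalty
    \<open>y\<close>.\<close>
  proof (cases "R < scale")
    case True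
    then have "level_set discrete_level R = A"
      using R scenario_less[OF A_scenario] A_scenario
      by (auto simp: level_set_def discrete_level_def k_bounded_scenarios_def split: if_splits)
    then have "B = A"
      using B A_scenario by (intro card_subset_eq finite_scenario) (auto simp: k_bounded_scenarios_def)
    then show ?thesis using scaled_penalty_mono[OF R] by (simp add: penalty_discrete scaled_penalty_0)
  next
    case False
    then have "real_of_rat y \<le> scaled_penalty R" "0 \<le> scaled_penalty R"
      using scaled_penalty_mono[of scale R] scaled_penalty_mono[OF R] scaled_penalty_scale scaled_penalty_0 by auto
    then show ?thesis unfolding penalty_discrete by (cases "A = B") simp_all
  qed
next
  fix A' assume A': "A' \<in> k_bounded_scenarios I k" "A' \<noteq> {}"
  have cl: "A' \<subseteq> clients I" using A' by (simp add: k_bounded_scenarios_def)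
  have fin: "finite A'" by (rule finite_scenario[OF A'(1)])
  have "scaled_penalty (Max (discrete_level ` A')) \<le> (if A = A' then 0 else real_of_rat y)"
  proof (cases "A = A'")
    case True
    have "discrete_level v = 0" if "v \<in> A'" for v unfolding discrete_level_def using that True cl by auto
    then have "discrete_level ` A' = {0}" using A'(2) by auto
    then have "scaled_penalty (Max (discrete_level ` A')) = 0" by (simp add: scaled_penalty_0)
    then show ?thesis using True by simp
  next
    case False
    have "Max (discrete_level ` A') \<le> scale"
      using A'(2) fin scale_pos by (subst Max_le_iff) (auto simp: discrete_level_def)
    then show ?thesis using False scaled_penalty_mono[of _ scale] scaled_penalty_scale by auto
  qed
  moreover have "\<forall>v\<in>A'. 0 \<le> discrete_level v" using cl scale_pos by (auto simp: discrete_level_def)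
  ultimately show "penalty kappa_discrete A' = \<infinity> \<or> (\<forall>v\<in>A'. 0 \<le> discrete_level v) \<and>
      ereal (scaled_penalty (Max (discrete_level ` A'))) \<le> penalty kappa_discrete A'"
    unfolding penalty_discrete by (cases "A = A'") (simp_all add: zero_ereal_def)
next
  show "penalty kappa_discrete A = 0" by (simp add: penalty_discrete)
qed

definition asym_level :: "nat \<Rightarrow> int" where
  "asym_level v = (if v \<in> clients I
     then if A \<noteq> {} then Min (zdist v ` A) else if 0 < y then -1 else 0
     else -1)"

lemma asym_level_nonneg: "A \<noteq> {} \<Longrightarrow> v \<in> clients I \<Longrightarrow> 0 \<le> asym_level v"
  using finite_scenario[OF A_scenario] zdist(3)[of v] scenario_less[OF A_scenario] P_eq
  by (auto simp: asym_level_def Min_ge_iff)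

lemma INF_dist_eq:
  assumes "A \<noteq> {}" "v \<in> clients I"
  shows "(INF j\<in>A. ennreal (real_of_rat (fl_dist I v j))) = ennreal (asym_level v / scale)"
proof -
  have v: "v < n" using assms P_eq by auto
  have fin: "finite A" by (rule finite_scenario[OF A_scenario])
  have "real_of_int (asym_level v) = scale * Min (d v ` A)"
    using assms fin scale_pos zdist(1)[OF v] scenario_less[OF A_scenario]
    by (auto simp: asym_level_def intro!: of_int_Min_scaled)
  then have m: "asym_level v / scale = Min (d v ` A)" using scale_pos by simp
  have "Min (d v ` A) \<in> d v ` A" using assms fin by (intro Min_in) auto
  then obtain u where u: "u \<in> A" "Min (d v ` A) = d v u" by auto
  show ?thesis
    unfolding m d_def[symmetric]
  proof (rule antisym)
    show "(INF j\<in>A. ennreal (d v j)) \<le> ennreal (Min (d v ` A))"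
      unfolding u(2) by (rule INF_lower[OF u(1)])
    show "ennreal (Min (d v ` A)) \<le> (INF j\<in>A. ennreal (d v j))"
      using fin by (intro INF_greatest ennreal_leI Min_le) auto
  qed
qed

lemma y_times_ennreal:
  assumes "0 \<le> R"
  shows "ereal (real_of_rat y) * enn2ereal (ennreal (R / scale)) = ereal (scaled_penalty R)"
  using assms scale_pos by (simp add: enn2ereal_ennreal scaled_penalty_def)

lemma penalty_mono:
  "u \<le> u' \<Longrightarrow> ereal (real_of_rat y) * enn2ereal u \<le> ereal (real_of_rat y) * enn2ereal u'"
  using y_nonneg by (intro ereal_mult_left_mono) (auto simp: less_eq_ennreal.rep_eq)

lemma leveled_query_asym: "leveled_query I x k y A kappa_asym asym_level asym_levelE"
proof unfold_locales
  fix s e dp \<rho> v assume s: "ready s" "steady e dp \<rho> s (int v)" "v < n"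
  have s0: "s 0 = inp" using s(1) by (simp add: ready_def)
  have n: "nat (s 0 0) = n" by (simp add: s0 inp_header)
  let ?m = "minE dp (fieldE 3 (RV (dp + 1))) (distE e (RV (dp + 1)))"
  have "reval ?m dp \<rho> s = (if \<exists>u<nat (s 0 0). u \<in> A then Min (zdist v ` {u. u < nat (s 0 0) \<and> u \<in> A}) else -1)"
  proof (rule reval_minE)
    fix u a assume u: "u < nat (s 0 0)"
    show "0 < reval (fieldE 3 (RV (dp + 1))) (dp + 2) (\<rho>(dp := a, dp + 1 := int u)) s \<longleftrightarrow> u \<in> A"
      using reval_fieldE(4)[of s "RV (dp + 1)" "dp + 2" "\<rho>(dp := a, dp + 1 := int u)" u] s0 u n by simp
    show "reval (distE e (RV (dp + 1))) (dp + 2) (\<rho>(dp := a, dp + 1 := int u)) s = zdist v u"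
      using u n s(3) by (intro reval_distE[OF s(1) steadyD[OF steady_weaken[OF s(2)]]]) auto
  next
    fix u assume "u < nat (s 0 0)"
    then show "0 \<le> zdist v u" using zdist(3)[OF s(3)] n by simp
  qed
  moreover have "{u. u < n \<and> u \<in> A} = A" "(\<exists>u<n. u \<in> A) \<longleftrightarrow> A \<noteq> {}"
    using scenario_less[OF A_scenario] by auto
  ultimately have m: "reval ?m dp \<rho> s = (if A \<noteq> {} then Min (zdist v ` A) else -1)" by (simp only: n)
  have y: "0 < s 0 2 \<longleftrightarrow> 0 < y"
  proof -
    obtain p q where pq: "quotient_of y = (p, q)" by (cases "quotient_of y")
    have "0 < of_int p / (of_int q :: rat) \<longleftrightarrow> 0 < p"
      using quotient_of_denom_pos[OF pq] by (simp add: zero_less_divide_iff)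
    then show ?thesis unfolding quotient_of_div[OF pq, symmetric] s0 inp_header pq by simp
  qed
  have cl: "reval (fieldE 1 e) dp \<rho> s = of_bool (v \<in> clients I)"
    by (rule reval_fieldE(2)[OF s0 steadyD[OF s(2)] s(3)])
  show "reval (asym_levelE dp e) dp \<rho> s = asym_level v"
  proof (cases "v \<in> clients I \<and> A \<noteq> {}")
    case True
    then have "0 \<le> reval ?m dp \<rho> s" "reval ?m dp \<rho> s = asym_level v"
      using asym_level_nonneg[of v] m by (auto simp: asym_level_def)
    then show ?thesis using cl True unfolding asym_levelE_def Let_def by (simp add: reval_leE)
  next
    case False
    then show ?thesis using cl m y unfolding asym_levelE_def Let_def
      by (auto simp: reval_leE asym_level_def)
  qed
next
  fix v assume "v < n" "0 \<le> asym_level v"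
  then show "v \<in> clients I" by (simp add: asym_level_def split: if_splits)
next
  fix R B assume R: "0 \<le> R" and B: "B \<subseteq> level_set asym_level R"
  have BI: "v \<in> clients I \<and> asym_level v \<le> R \<and> 0 \<le> asym_level v" if "v \<in> B" for v
    using that B by (auto simp: level_set_def asym_level_def split: if_splits)
  show "penalty kappa_asym B \<le> ereal (scaled_penalty R)"
  proof (cases "A = {}")
    case True
    show ?thesis
    proof (cases "0 < y")
      case y: True
      \<comment> \<open>With \<open>A\<close> empty and y > 0 all levels are negative, so the only
        admissible \<open>B\<close> is empty, and its distance is 0 as a supremum over
        nothing.\<close>
      have "asym_level v < 0" for v unfolding asym_level_def using True y by simp
      then have "B = {}" using BI by (meson all_not_in_conv not_le)
      then show ?thesis
        using scaled_penalty_mono[OF R] by (simp add: penalty_def kappa_asym_def scaled_penalty_0 bot_ennreal zero_ennreal.rep_eq)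
    next
      case False
      then have y: "real_of_rat y = 0" using y_nonneg by simp
      show ?thesis unfolding penalty_def scaled_penalty_def y by (simp flip: zero_ereal_def)
    qed
  next
    case False
    have "kappa_asym I A B \<le> ennreal (R / scale)"
      unfolding kappa_asym_def
    proof (rule SUP_least)
      fix v assume v: "v \<in> B"
      show "(INF j\<in>A. ennreal (real_of_rat (fl_dist I v j))) \<le> ennreal (R / scale)"
        unfolding INF_dist_eq[OF False conjunct1[OF BI[OF v]]]
        using BI[OF v] scale_pos by (intro ennreal_leI divide_right_mono) auto
    qed
    from penalty_mono[OF this] show ?thesis unfolding penalty_def y_times_ennreal[OF R] .
  qed
next
  fix A' assume A': "A' \<in> k_bounded_scenarios I k" "A' \<noteq> {}"
  have cl: "A' \<subseteq> clients I" using A' by (simp add: k_bounded_scenarios_def)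
  show "penalty kappa_asym A' = \<infinity> \<or> (\<forall>v\<in>A'. 0 \<le> asym_level v) \<and>
      ereal (scaled_penalty (Max (asym_level ` A'))) \<le> penalty kappa_asym A'"
  proof (cases "A = {}")
    case True
    show ?thesis
    proof (cases "0 < y")
      case y: True
      have "kappa_asym I A A' = \<infinity>" using A'(2) by (simp add: kappa_asym_def True)
      then show ?thesis using y by (simp add: penalty_def)
    next
      case False
      then have y: "real_of_rat y = 0" using y_nonneg by simp
      have "asym_level v = 0" if "v \<in> A'" for v
        unfolding asym_level_def using that cl True False by auto
      then show ?thesis unfolding penalty_def scaled_penalty_def y by (simp flip: zero_ereal_def)
    qed
  next
    case False
    have "Max (asym_level ` A') \<in> asym_level ` A'" using A'(2) finite_scenario[OF A'(1)] by (intro Max_in) auto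
    then obtain r where r: "r \<in> A'" "Max (asym_level ` A') = asym_level r" by auto
    have rc: "r \<in> clients I" using r(1) cl by auto
    have "ennreal (asym_level r / scale) \<le> kappa_asym I A A'"
      unfolding kappa_asym_def INF_dist_eq[OF False rc, symmetric] by (rule SUP_upper[OF r(1)])
    from penalty_mono[OF this] have "ereal (scaled_penalty (Max (asym_level ` A'))) \<le> penalty kappa_asym A'"
      unfolding penalty_def y_times_ennreal[OF asym_level_nonneg[OF False rc]] r(2) .
    then show ?thesis using asym_level_nonneg[OF False] cl by auto
  qed
next
  have "(INF j\<in>A. ennreal (real_of_rat (fl_dist I v j))) \<le> 0" if "v \<in> A" for v
  proof -
    have "v \<in> P" using scenario_less[OF A_scenario that] P_eq by auto
    then have "ennreal (real_of_rat (fl_dist I v v)) = 0" using d_self[of v] by (simp add: d_def)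
    then show ?thesis using INF_lower[OF that, of "\<lambda>j. ennreal (real_of_rat (fl_dist I v j))"] by simp
  qed
  then have "kappa_asym I A A \<le> 0" unfolding kappa_asym_def by (rule SUP_least)
  then show "penalty kappa_asym A = 0" by (simp add: penalty_def zero_ennreal.rep_eq)
qed

end

text \<open>The level expression is fixed before the query, because one program must serve all
  inputs, while the levels that it computes may depend on the query.\<close>

lemma has_polytime_approximation_by_levels:
  assumes "\<And>d v. wf_rexp d v \<Longrightarrow> wf_rexp d (levE d v)"
    and "\<And>I x k y A. query I x k y A \<Longrightarrow> \<exists>lv. leveled_query I x k y A \<kappa> lv levE"
  shows "has_polytime_approximation \<kappa> 6 1"
  unfolding has_polytime_approximation_def
proof (rule polytime_solvable_hprog)
  show "wf_hprog (scenario_prog levE)" by (rule wf_scenario_prog[OF assms(1)])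
  fix q assume "q \<in> fl_queries"
  then obtain I k x y A where q: "q = (I, k, x, y, A)" and "query I x k y A"
    by (auto simp: fl_queries_def query_def query_axioms_def second_stage_def)
  then interpret query I x k y A by simp
  obtain lv where "leveled_query I x k y A \<kappa> lv levE" using assms(2)[OF query_axioms] by blast
  then interpret leveled_query I x k y A \<kappa> lv levE .
  have c: "encode_query q = code" by (simp add: q code_def)
  show "0 \<le> input_store (encode_query q) 0 0 \<and>
      nat (input_store (encode_query q) 0 0) \<le> length (encode_query q)"
    unfolding c inp_def[symmetric] by (simp add: inp_header length_code)
  show "(\<lambda>(I, k, x, y, A) B. approx_scenario \<kappa> 6 1 I k x (real_of_rat y) A B) q
      (output_set (hrun (scenario_prog levE) (input_store (encode_query q))))"
    unfolding c using scenario_prog_correct by (simp add: q)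
qed

theorem theorem3p20:
  shows "has_polytime_approximation kappa_discrete 6 1 \<and> has_polytime_approximation kappa_asym 6 1"
proof
  show "has_polytime_approximation kappa_discrete 6 1"
    by (rule has_polytime_approximation_by_levels[of discrete_levelE])
       (use wf_discrete_levelE query.leveled_query_discrete in blast)+
  show "has_polytime_approximation kappa_asym 6 1"
    by (rule has_polytime_approximation_by_levels[of asym_levelE])
       (use wf_asym_levelE query.leveled_query_asym in blast)+
qed

end
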